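(* Let $(\mathcal{C},\mathbb{E},\mathfrak{s})$ be an extriangulated category satisfying Condition (WIC), and let $\xi$ be a proper class of $\mathbb{E}$-triangles in $\mathcal{C}$ such that $\mathcal{C}$ has enough $\xi$-projectives and enough $\xi$-injectives. Assume that $M\in\widetilde{\mathcal{GP}}(\xi)$ and $N\in\widetilde{\mathcal{GI}}(\xi)$. Then $$\xi\mathrm{xt}_{\mathcal{GP}(\xi)}^n(M,N)\cong \xi\mathrm{xt}_{\mathcal{GI}(\xi)}^n(M,N)$$ for any $n\geq 1$.
   Context: **Extriangulated categories (Nakaoka--Palu).** Let $\mathcal{C}$ be an additive category with an additive bifunctor $\mathbb{E}:\mathcal{C}^{\mathrm{op}}\times\mathcal{C}\to\mathrm{Ab}$. An element $\delta\in\mathbb{E}(C,A)$ is an $\mathbb{E}$-extension; for $a:A\to A'$ and $c:C'\to C$ put $a_*\delta=\mathbb{E}(C,a)(\delta)$, $c^*\delta=\mathbb{E}(c,A)(\delta)$. A morphism from $\delta\in\mathbb{E}(C,A)$ to $\delta'\in\mathbb{E}(C',A')$ is a pair $(a:A\to A',\,c:C\to C')$ with $a_*\delta=c^*\delta'$. Sequences $A\to B\to C$ and $A\to B'\to C$ are equivalent if there is an isomorphism $B\cong B'$ compatible with the identities of $A$ and $C$. A realization $\mathfrak{s}$ assigns to each $\delta\in\mathbb{E}(C,A)$ an equivalence class $\mathfrak{s}(\delta)=[A\xrightarrow{x}B\xrightarrow{y}C]$ such that for every morphism $(a,c):\delta\to\delta'$, with $\mathfrak{s}(\delta')=[A'\xrightarrow{x'}B'\xrightarrow{y'}C']$,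 there is $b:B\to B'$ with $bx=x'a$, $y'b=cy$ (then $(a,b,c)$ realizes $(a,c)$). It is additive if $\mathfrak{s}(0)=[A\to A\oplus C\to C]$ and $\mathfrak{s}(\delta\oplus\delta')=\mathfrak{s}(\delta)\oplus\mathfrak{s}(\delta')$. $(\mathcal{C},\mathbb{E},\mathfrak{s})$ is extriangulated if $\mathfrak{s}$ is an additive realization and: (ET3) if $\mathfrak{s}(\delta)=[A\xrightarrow{x}B\xrightarrow{y}C]$, $\mathfrak{s}(\delta')=[A'\xrightarrow{x'}B'\xrightarrow{y'}C']$ and $bx=x'a$, there is $c:C\to C'$ with $cy=y'b$ and $a_*\delta=c^*\delta'$; (ET3)$^{\mathrm{op}}$ the dual; (ET4) if $\delta\in\mathbb{E}(D,A)$ and $\delta'\in\mathbb{E}(F,B)$ are realized by $A\xrightarrow{f}B\xrightarrow{f'}D$ and $B\xrightarrow{g}C\xrightarrow{g'}F$, there are an object $E$, morphisms $h'\colon C\to E$, $d\colon D\to E$, $e\colon E\to F$ with $h'g=df'$, $eh'=g'$, and $\delta''\in\mathbb{E}(E,A)$ realized by $A\xrightarrow{gf}C\xrightarrow{h'}E$, such that $D\xrightarrow{d}E\xrightarrow{e}F$ realizes $f'_*\delta'$, $d^*\delta''=\delta$ and $f_*\delta''=e^*\delta'$; (ET4)$^{\mathrm{op}}$ the dual. If $\mathfrak{s}(\delta)=[A\xrightarrow{x}B\xrightarrow{y}C]$, one calls $x$ an inflation, $y$ a deflation, and $A\xrightarrow{x}B\xrightarrow{y}C\dashrightarrow^{\delta}$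 an $\mathbb{E}$-triangle; it is split if $\delta=0$. A morphism of $\mathbb{E}$-triangles is a triple $(a,b,c)$ realizing a morphism of $\mathbb{E}$-extensions. **Condition (WIC).** For composable $f,g$: if $gf$ is an inflation, so is $f$; if $gf$ is a deflation, so is $g$. **Proper class.** A class $\xi$ of $\mathbb{E}$-triangles closed under isomorphisms is proper if: it is closed under finite coproducts and contains all split $\mathbb{E}$-triangles; it is closed under base change and cobase change (if the $\mathbb{E}$-triangle of $\delta$ is in $\xi$, so are all $\mathbb{E}$-triangles realizing $c^*\delta$ or $a_*\delta$); and it is saturated: for $\mathbb{E}$-triangles $A_i\xrightarrow{x_i}B_i\xrightarrow{y_i}C\dashrightarrow^{\delta_i}$ ($i=1,2$), if the $\mathbb{E}$-triangle of $\delta_2$ and the $\mathbb{E}$-triangle $A_1\to M\to B_2$ realizing $y_2^*\delta_1$ are in $\xi$, then the $\mathbb{E}$-triangle of $\delta_1$ is in $\xi$. **Projectives and injectives.** $P$ is $\xi$-projective if $0\to\mathcal{C}(P,A)\to\mathcal{C}(P,B)\to\mathcal{C}(P,C)\to0$ is exact for every $A\to B\to C\dashrightarrow$ in $\xi$; $\xi$-injective is dual. $\mathcal{P}(\xi)$, $\mathcal{I}(\xi)$ denote these classes. Enough $\xi$-projectives: each object $A$ fits in an $\mathbb{E}$-triangle $K\to P\to A\dashrightarrow$ in $\xi$ with $P\in\mathcal{P}(\xi)$; enough $\xi$-injectives: dual. **Exactness.** For a class $\mathcal{W}$ of objects, an $\mathbb{E}$-triangle $A\to B\to C\dashrightarrow$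 in $\xi$ is $\mathcal{C}(-,\mathcal{W})$-exact if $0\to\mathcal{C}(C,W)\to\mathcal{C}(B,W)\to\mathcal{C}(A,W)\to0$ is exact for all $W\in\mathcal{W}$, and $\mathcal{C}(\mathcal{W},-)$-exact if $0\to\mathcal{C}(W,A)\to\mathcal{C}(W,B)\to\mathcal{C}(W,C)\to0$ is exact for all $W\in\mathcal{W}$. A complex $\cdots\to X_1\xrightarrow{d_1}X_0\xrightarrow{d_0}X_{-1}\to\cdots$ is $\xi$-exact if there are $\mathbb{E}$-triangles $K_{n+1}\xrightarrow{g_n}X_n\xrightarrow{f_n}K_n\dashrightarrow$ in $\xi$ with $d_n=g_{n-1}f_n$ for all $n$; it is $\mathcal{C}(-,\mathcal{W})$-exact (resp. $\mathcal{C}(\mathcal{W},-)$-exact) if these can be chosen $\mathcal{C}(-,\mathcal{W})$-exact (resp. $\mathcal{C}(\mathcal{W},-)$-exact). **Gorenstein objects.** A complete $\xi$-projective resolution is a $\mathcal{C}(-,\mathcal{P}(\xi))$-exact complex with all terms in $\mathcal{P}(\xi)$; the objects $K_n$ in its $\mathcal{C}(-,\mathcal{P}(\xi))$-exact $\mathbb{E}$-triangles are called $\xi$-$\mathcal{G}$projective, and form the class $\mathcal{GP}(\xi)$. Dually, a complete $\xi$-injective coresolution is a $\mathcal{C}(\mathcal{I}(\xi),-)$-exact complex with all terms in $\mathcal{I}(\xi)$, and the objects $K_n$ in its $\mathcal{C}(\mathcal{I}(\xi),-)$-exact $\mathbb{E}$-triangles form the class $\mathcal{GI}(\xi)$ of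 $\xi$-$\mathcal{G}$injective objects. **Dimensions.** $\xi$-$\mathcal{G}\mathrm{pd}A=0$ if $A\in\mathcal{GP}(\xi)$; for $n>0$, $\xi$-$\mathcal{G}\mathrm{pd}A\le n$ if there is an $\mathbb{E}$-triangle $K\to G\to A\dashrightarrow$ in $\xi$ with $G\in\mathcal{GP}(\xi)$ and $\xi$-$\mathcal{G}\mathrm{pd}K\le n-1$; $\xi$-$\mathcal{G}\mathrm{pd}A$ is the least such $n$, or $\infty$. $\xi$-$\mathcal{G}\mathrm{id}$ is dual. $\widetilde{\mathcal{GP}}(\xi)$ (resp. $\widetilde{\mathcal{GI}}(\xi)$) is the full subcategory of objects of finite $\xi$-$\mathcal{G}$projective (resp. $\xi$-$\mathcal{G}$injective) dimension. **Gorenstein resolutions and cohomology.** A $\xi$-$\mathcal{G}$projective resolution $\mathbf{G}\to M$ is a $\xi$-exact complex $\cdots\to G_1\to G_0\to M\to0$ with $G_i\in\mathcal{GP}(\xi)$ whose $\mathbb{E}$-triangles $K_{i+1}\to G_i\to K_i\dashrightarrow$ ($i\ge0$, $K_0=M$) are in $\xi$ and $\mathcal{C}(\mathcal{GP}(\xi),-)$-exact. Dually, a $\xi$-$\mathcal{G}$injective coresolution $N\to\mathbf{E}$ has terms in $\mathcal{GI}(\xi)$ and $\mathcal{C}(-,\mathcal{GI}(\xi))$-exact $\mathbb{E}$-triangles. Every object of $\widetilde{\mathcal{GP}}(\xi)$ (resp. $\widetilde{\mathcal{GI}}(\xi)$) admits such a resolution (resp. coresolution). For $i\ge0$ define $\xi\mathrm{xt}^i_{\mathcal{GP}(\xi)}(M,N)=H^i(\mathcal{C}(\mathbf{G},N))$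 and $\xi\mathrm{xt}^i_{\mathcal{GI}(\xi)}(M,N)=H^i(\mathcal{C}(M,\mathbf{E}))$, where $\mathbf{G}$ is the deleted complex $\cdots\to G_1\to G_0\to0$ and $\mathbf{E}$ is the coresolution with $N$ deleted; these do not depend on the choices. *)

theory Defs
  imports "HOL-Algebra.Exact_Sequence" "HOL-Library.Extended_Nat"
begin

text \<open>
  Abelian groups are HOL-Algebra \<open>comm_group\<close>s and therefore written multiplicatively: in
  \<open>Hom \<C> A B\<close> and \<open>Ext \<C> C A\<close> the operation \<open>\<otimes>\<close> is the sum and \<open>\<one>\<close> is the zero element.
  \<open>EMap \<C> c a\<close> is the map \<open>\<E>(c, a)\<close>.  \<open>Rlz \<C> C A \<delta>\<close> is the equivalence class \<open>\<s>(\<delta>)\<close>, a set of triples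
  \<open>(B, x, y)\<close> standing for sequences \<open>A \<rightarrow> B \<rightarrow> C\<close>.
\<close>

record ('o, 'm, 'e) ext_cat =
  Obj :: "'o set"
  Hom :: "'o \<Rightarrow> 'o \<Rightarrow> 'm monoid"
  Ident :: "'o \<Rightarrow> 'm"
  Comp :: "'m \<Rightarrow> 'm \<Rightarrow> 'm"  (infixr \<open>\<cdot>\<index>\<close> 75)
  Ext :: "'o \<Rightarrow> 'o \<Rightarrow> 'e monoid"
  EMap :: "'m \<Rightarrow> 'm \<Rightarrow> 'e \<Rightarrow> 'e"
  Rlz :: "'o \<Rightarrow> 'o \<Rightarrow> 'e \<Rightarrow> ('o \<times> 'm \<times> 'm) set"

text \<open>\<open>(A, x, B, y, C, \<delta>)\<close> encodes \<open>A \<rightarrow> B \<rightarrow> C\<close> with maps \<open>x\<close>, \<open>y\<close> and extension \<open>\<delta>\<close> in \<open>\<E>(C, A)\<close>.\<close>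

type_synonym ('o, 'm, 'e) etri = "'o \<times> 'm \<times> 'o \<times> 'm \<times> 'o \<times> 'e"

definition cochain_cohomology :: "(nat \<Rightarrow> 'a monoid) \<Rightarrow> (nat \<Rightarrow> 'a \<Rightarrow> 'a) \<Rightarrow> nat \<Rightarrow> 'a set monoid" where
  "cochain_cohomology A d i =
     (A i)\<lparr>carrier := kernel (A i) (A (Suc i)) (d i)\<rparr>
       Mod (case i of 0 \<Rightarrow> {\<one>\<^bsub>A 0\<^esub>} | Suc j \<Rightarrow> d j ` carrier (A j))"

context
  fixes \<C> :: "('o, 'm, 'e) ext_cat" (structure)
begin

abbreviation Mor :: "'o \<Rightarrow> 'o \<Rightarrow> 'm set" where
  "Mor A B \<equiv> carrier (Hom \<C> A B)"


subsection \<open>Additive categories\<close>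

definition is_category :: bool where
  "is_category \<longleftrightarrow>
     (\<forall>A\<in>Obj \<C>. Ident \<C> A \<in> Mor A A) \<and>
     (\<forall>A\<in>Obj \<C>. \<forall>B\<in>Obj \<C>. \<forall>D\<in>Obj \<C>. \<forall>f\<in>Mor A B. \<forall>g\<in>Mor B D. g \<cdot> f \<in> Mor A D) \<and>
     (\<forall>A\<in>Obj \<C>. \<forall>B\<in>Obj \<C>. \<forall>f\<in>Mor A B. f \<cdot> Ident \<C> A = f \<and> Ident \<C> B \<cdot> f = f) \<and>
     (\<forall>A\<in>Obj \<C>. \<forall>B\<in>Obj \<C>. \<forall>D\<in>Obj \<C>. \<forall>F\<in>Obj \<C>. \<forall>f\<in>Mor A B. \<forall>g\<in>Mor B D. \<forall>h\<in>Mor D F.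
        (h \<cdot> g) \<cdot> f = h \<cdot> (g \<cdot> f)) \<and>
     (\<forall>A\<in>Obj \<C>. \<forall>B\<in>Obj \<C>. \<forall>A'\<in>Obj \<C>. \<forall>B'\<in>Obj \<C>.
        Mor A B \<inter> Mor A' B' \<noteq> {} \<longrightarrow> A = A' \<and> B = B')"

definition is_preadditive :: bool where
  "is_preadditive \<longleftrightarrow> is_category \<and>
     (\<forall>A\<in>Obj \<C>. \<forall>B\<in>Obj \<C>. comm_group (Hom \<C> A B)) \<and>
     (\<forall>A\<in>Obj \<C>. \<forall>B\<in>Obj \<C>. \<forall>D\<in>Obj \<C>. \<forall>f\<in>Mor A B. \<forall>f'\<in>Mor A B. \<forall>g\<in>Mor B D. \<forall>g'\<in>Mor B D.
        g \<cdot> (f \<otimes>\<^bsub>Hom \<C> A B\<^esub> f') = (g \<cdot> f) \<otimes>\<^bsub>Hom \<C> A D\<^esub> (g \<cdot> f') \<and>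
        (g \<otimes>\<^bsub>Hom \<C> B D\<^esub> g') \<cdot> f = (g \<cdot> f) \<otimes>\<^bsub>Hom \<C> A D\<^esub> (g' \<cdot> f))"

definition biproduct :: "'o \<Rightarrow> 'o \<Rightarrow> 'o \<Rightarrow> 'm \<Rightarrow> 'm \<Rightarrow> 'm \<Rightarrow> 'm \<Rightarrow> bool" where
  "biproduct A A' S i i' p p' \<longleftrightarrow>
     A \<in> Obj \<C> \<and> A' \<in> Obj \<C> \<and> S \<in> Obj \<C> \<and>
     i \<in> Mor A S \<and> i' \<in> Mor A' S \<and> p \<in> Mor S A \<and> p' \<in> Mor S A' \<and>
     p \<cdot> i = Ident \<C> A \<and> p' \<cdot> i' = Ident \<C> A' \<and>
     p \<cdot> i' = \<one>\<^bsub>Hom \<C> A' A\<^esub> \<and> p' \<cdot> i = \<one>\<^bsub>Hom \<C> A A'\<^esub> \<and>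
     (i \<cdot> p) \<otimes>\<^bsub>Hom \<C> S S\<^esub> (i' \<cdot> p') = Ident \<C> S"

definition zero_object :: "'o \<Rightarrow> bool" where
  "zero_object Z \<longleftrightarrow> Z \<in> Obj \<C> \<and>
     (\<forall>A\<in>Obj \<C>. (\<exists>!f. f \<in> Mor Z A) \<and> (\<exists>!f. f \<in> Mor A Z))"

definition is_additive :: bool where
  "is_additive \<longleftrightarrow> is_preadditive \<and> (\<exists>Z. zero_object Z) \<and>
     (\<forall>A\<in>Obj \<C>. \<forall>A'\<in>Obj \<C>. \<exists>S i i' p p'. biproduct A A' S i i' p p')"

definition isomorphism :: "'o \<Rightarrow> 'o \<Rightarrow> 'm \<Rightarrow> bool" where
  "isomorphism A B f \<longleftrightarrow> f \<in> Mor A B \<and>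
     (\<exists>g\<in>Mor B A. g \<cdot> f = Ident \<C> A \<and> f \<cdot> g = Ident \<C> B)"


subsection \<open>Extriangulated categories\<close>

definition additive_bifunctor :: bool where
  "additive_bifunctor \<longleftrightarrow>
     (\<forall>C\<in>Obj \<C>. \<forall>A\<in>Obj \<C>. comm_group (Ext \<C> C A) \<and>
        (\<forall>\<delta>\<in>carrier (Ext \<C> C A). EMap \<C> (Ident \<C> C) (Ident \<C> A) \<delta> = \<delta>)) \<and>
     (\<forall>C\<in>Obj \<C>. \<forall>C'\<in>Obj \<C>. \<forall>A\<in>Obj \<C>. \<forall>A'\<in>Obj \<C>. \<forall>c\<in>Mor C' C. \<forall>a\<in>Mor A A'.
        EMap \<C> c a \<in> hom (Ext \<C> C A) (Ext \<C> C' A')) \<and>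
     (\<forall>C\<in>Obj \<C>. \<forall>C'\<in>Obj \<C>. \<forall>C''\<in>Obj \<C>. \<forall>A\<in>Obj \<C>. \<forall>A'\<in>Obj \<C>. \<forall>A''\<in>Obj \<C>.
        \<forall>c\<in>Mor C' C. \<forall>c'\<in>Mor C'' C'. \<forall>a\<in>Mor A A'. \<forall>a'\<in>Mor A' A''. \<forall>\<delta>\<in>carrier (Ext \<C> C A).
        EMap \<C> (c \<cdot> c') (a' \<cdot> a) \<delta> = EMap \<C> c' a' (EMap \<C> c a \<delta>)) \<and>
     (\<forall>C\<in>Obj \<C>. \<forall>C'\<in>Obj \<C>. \<forall>A\<in>Obj \<C>. \<forall>A'\<in>Obj \<C>.
        \<forall>c\<in>Mor C' C. \<forall>d\<in>Mor C' C. \<forall>a\<in>Mor A A'. \<forall>b\<in>Mor A A'. \<forall>\<delta>\<in>carrier (Ext \<C> C A).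
        EMap \<C> (c \<otimes>\<^bsub>Hom \<C> C' C\<^esub> d) a \<delta> = EMap \<C> c a \<delta> \<otimes>\<^bsub>Ext \<C> C' A'\<^esub> EMap \<C> d a \<delta> \<and>
        EMap \<C> c (a \<otimes>\<^bsub>Hom \<C> A A'\<^esub> b) \<delta> = EMap \<C> c a \<delta> \<otimes>\<^bsub>Ext \<C> C' A'\<^esub> EMap \<C> c b \<delta>)"

definition push :: "'o \<Rightarrow> 'm \<Rightarrow> 'e \<Rightarrow> 'e" where
  "push C a \<delta> = EMap \<C> (Ident \<C> C) a \<delta>"

definition pull :: "'o \<Rightarrow> 'm \<Rightarrow> 'e \<Rightarrow> 'e" where
  "pull A c \<delta> = EMap \<C> c (Ident \<C> A) \<delta>"

definition seqs :: "'o \<Rightarrow> 'o \<Rightarrow> ('o \<times> 'm \<times> 'm) set" where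
  "seqs A C = {(B, x, y). B \<in> Obj \<C> \<and> x \<in> Mor A B \<and> y \<in> Mor B C}"

definition seq_equiv :: "'o \<Rightarrow> 'o \<Rightarrow> (('o \<times> 'm \<times> 'm) \<times> ('o \<times> 'm \<times> 'm)) set" where
  "seq_equiv A C = {((B, x, y), (B', x', y')).
     (B, x, y) \<in> seqs A C \<and> (B', x', y') \<in> seqs A C \<and>
     (\<exists>b. isomorphism B B' b \<and> b \<cdot> x = x' \<and> y' \<cdot> b = y)}"

definition etriangles :: "('o, 'm, 'e) etri set" where
  "etriangles = {(A, x, B, y, C, \<delta>).
     A \<in> Obj \<C> \<and> C \<in> Obj \<C> \<and> \<delta> \<in> carrier (Ext \<C> C A) \<and> (B, x, y) \<in> Rlz \<C> C A \<delta>}"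

definition ext_morphism :: "'o \<Rightarrow> 'o \<Rightarrow> 'e \<Rightarrow> 'o \<Rightarrow> 'o \<Rightarrow> 'e \<Rightarrow> 'm \<Rightarrow> 'm \<Rightarrow> bool" where
  "ext_morphism C A \<delta> C' A' \<delta>' a c \<longleftrightarrow>
     a \<in> Mor A A' \<and> c \<in> Mor C C' \<and> push C a \<delta> = pull A' c \<delta>'"

fun etri_morphism :: "('o, 'm, 'e) etri \<Rightarrow> ('o, 'm, 'e) etri \<Rightarrow> 'm \<Rightarrow> 'm \<Rightarrow> 'm \<Rightarrow> bool" where
  "etri_morphism (A, x, B, y, C, \<delta>) (A', x', B', y', C', \<delta>') a b c \<longleftrightarrow>
     ext_morphism C A \<delta> C' A' \<delta>' a c \<and> b \<in> Mor B B' \<and> b \<cdot> x = x' \<cdot> a \<and> y' \<cdot> b = c \<cdot> y"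

definition is_realization :: bool where
  "is_realization \<longleftrightarrow>
     (\<forall>C\<in>Obj \<C>. \<forall>A\<in>Obj \<C>. \<forall>\<delta>\<in>carrier (Ext \<C> C A). Rlz \<C> C A \<delta> \<in> seqs A C // seq_equiv A C) \<and>
     (\<forall>A x B y C \<delta> A' x' B' y' C' \<delta>' a c.
        (A, x, B, y, C, \<delta>) \<in> etriangles \<and> (A', x', B', y', C', \<delta>') \<in> etriangles \<and>
        ext_morphism C A \<delta> C' A' \<delta>' a c \<longrightarrow>
        (\<exists>b. etri_morphism (A, x, B, y, C, \<delta>) (A', x', B', y', C', \<delta>') a b c))"

text \<open>
  The third argument is a direct sum of the first two, formed with some choice of biproducts.
  The extension \<open>\<delta> \<oplus> \<delta>'\<close> is the element of \<open>\<E>(C \<oplus> C', A \<oplus> A')\<close> with components \<open>(\<delta>, 0, 0, \<delta>')\<close>.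
\<close>

fun etri_sum :: "('o, 'm, 'e) etri \<Rightarrow> ('o, 'm, 'e) etri \<Rightarrow> ('o, 'm, 'e) etri \<Rightarrow> bool" where
  "etri_sum (A, x, B, y, C, \<delta>) (A', x', B', y', C', \<delta>') (A'', x'', B'', y'', C'', \<delta>'') \<longleftrightarrow>
     (\<exists>iA iA' pA pA' iB iB' pB pB' iC iC' pC pC'.
        biproduct A A' A'' iA iA' pA pA' \<and>
        biproduct B B' B'' iB iB' pB pB' \<and>
        biproduct C C' C'' iC iC' pC pC' \<and>
        x'' = (iB \<cdot> x \<cdot> pA) \<otimes>\<^bsub>Hom \<C> A'' B''\<^esub> (iB' \<cdot> x' \<cdot> pA') \<and>
        y'' = (iC \<cdot> y \<cdot> pB) \<otimes>\<^bsub>Hom \<C> B'' C''\<^esub> (iC' \<cdot> y' \<cdot> pB') \<and>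
        \<delta>'' = EMap \<C> pC iA \<delta> \<otimes>\<^bsub>Ext \<C> C'' A''\<^esub> EMap \<C> pC' iA' \<delta>')"

definition is_additive_realization :: bool where
  "is_additive_realization \<longleftrightarrow> is_realization \<and>
     (\<forall>A C S i i' p p'. biproduct A C S i i' p p' \<longrightarrow>
        Rlz \<C> C A \<one>\<^bsub>Ext \<C> C A\<^esub> = seq_equiv A C `` {(S, i, p')}) \<and>
     (\<forall>t\<in>etriangles. \<forall>t'\<in>etriangles. \<forall>t''. etri_sum t t' t'' \<longrightarrow> t'' \<in> etriangles)"

definition ET3 :: bool where
  "ET3 \<longleftrightarrow> (\<forall>A x B y C \<delta> A' x' B' y' C' \<delta>'. \<forall>a\<in>Mor A A'. \<forall>b\<in>Mor B B'.
     (A, x, B, y, C, \<delta>) \<in> etriangles \<and> (A', x', B', y', C', \<delta>') \<in> etriangles \<and>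
     b \<cdot> x = x' \<cdot> a \<longrightarrow>
     (\<exists>c\<in>Mor C C'. c \<cdot> y = y' \<cdot> b \<and> push C a \<delta> = pull A' c \<delta>'))"

definition ET3_op :: bool where
  "ET3_op \<longleftrightarrow> (\<forall>A x B y C \<delta> A' x' B' y' C' \<delta>'. \<forall>b\<in>Mor B B'. \<forall>c\<in>Mor C C'.
     (A, x, B, y, C, \<delta>) \<in> etriangles \<and> (A', x', B', y', C', \<delta>') \<in> etriangles \<and>
     c \<cdot> y = y' \<cdot> b \<longrightarrow>
     (\<exists>a\<in>Mor A A'. b \<cdot> x = x' \<cdot> a \<and> push C a \<delta> = pull A' c \<delta>'))"

definition ET4 :: bool where
  "ET4 \<longleftrightarrow> (\<forall>A f B f' D \<delta> g C g' F \<delta>'.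
     (A, f, B, f', D, \<delta>) \<in> etriangles \<and> (B, g, C, g', F, \<delta>') \<in> etriangles \<longrightarrow>
     (\<exists>E\<in>Obj \<C>. \<exists>h'\<in>Mor C E. \<exists>d\<in>Mor D E. \<exists>e\<in>Mor E F. \<exists>\<delta>''\<in>carrier (Ext \<C> E A).
        h' \<cdot> g = d \<cdot> f' \<and> e \<cdot> h' = g' \<and>
        (A, g \<cdot> f, C, h', E, \<delta>'') \<in> etriangles \<and>
        (D, d, E, e, F, push F f' \<delta>') \<in> etriangles \<and>
        pull A d \<delta>'' = \<delta> \<and>
        push E f \<delta>'' = pull B e \<delta>'))"

text \<open>\<open>ET4\<close> with all arrows reversed and the letters kept.\<close>

definition ET4_op :: bool where
  "ET4_op \<longleftrightarrow> (\<forall>A f B f' D \<delta> g C g' F \<delta>'.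
     (D, f', B, f, A, \<delta>) \<in> etriangles \<and> (F, g', C, g, B, \<delta>') \<in> etriangles \<longrightarrow>
     (\<exists>E\<in>Obj \<C>. \<exists>h'\<in>Mor E C. \<exists>d\<in>Mor E D. \<exists>e\<in>Mor F E. \<exists>\<delta>''\<in>carrier (Ext \<C> A E).
        g \<cdot> h' = f' \<cdot> d \<and> h' \<cdot> e = g' \<and>
        (E, h', C, f \<cdot> g, A, \<delta>'') \<in> etriangles \<and>
        (F, e, E, d, D, pull F f' \<delta>') \<in> etriangles \<and>
        push A d \<delta>'' = \<delta> \<and>
        pull E f \<delta>'' = push B e \<delta>'))"

definition extriangulated :: bool where
  "extriangulated \<longleftrightarrow> is_additive \<and> additive_bifunctor \<and> is_additive_realization \<and>
     ET3 \<and> ET3_op \<and> ET4 \<and> ET4_op"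

definition inflation :: "'m \<Rightarrow> bool" where
  "inflation x \<longleftrightarrow> (\<exists>A B y C \<delta>. (A, x, B, y, C, \<delta>) \<in> etriangles)"

definition deflation :: "'m \<Rightarrow> bool" where
  "deflation y \<longleftrightarrow> (\<exists>A x B C \<delta>. (A, x, B, y, C, \<delta>) \<in> etriangles)"

definition WIC :: bool where
  "WIC \<longleftrightarrow> (\<forall>A\<in>Obj \<C>. \<forall>B\<in>Obj \<C>. \<forall>C\<in>Obj \<C>. \<forall>f\<in>Mor A B. \<forall>g\<in>Mor B C.
     (inflation (g \<cdot> f) \<longrightarrow> inflation f) \<and> (deflation (g \<cdot> f) \<longrightarrow> deflation g))"


subsection \<open>Proper classes\<close>

fun etri_iso :: "('o, 'm, 'e) etri \<Rightarrow> ('o, 'm, 'e) etri \<Rightarrow> bool" where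
  "etri_iso (A, x, B, y, C, \<delta>) (A', x', B', y', C', \<delta>') \<longleftrightarrow>
     (\<exists>a b c. etri_morphism (A, x, B, y, C, \<delta>) (A', x', B', y', C', \<delta>') a b c \<and>
        isomorphism A A' a \<and> isomorphism B B' b \<and> isomorphism C C' c)"

definition saturated :: "('o, 'm, 'e) etri set \<Rightarrow> bool" where
  "saturated \<xi> \<longleftrightarrow> (\<forall>A1 x1 B1 y1 C \<delta>1 A2 x2 B2 y2 \<delta>2 m M e.
     (A1, x1, B1, y1, C, \<delta>1) \<in> etriangles \<and> (A2, x2, B2, y2, C, \<delta>2) \<in> \<xi> \<and>
     (A1, m, M, e, B2, pull A1 y2 \<delta>1) \<in> \<xi> \<longrightarrow>
     (A1, x1, B1, y1, C, \<delta>1) \<in> \<xi>)"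

text \<open>The empty coproduct needs no clause of its own: the zero \<open>\<E>\<close>-triangle is split.\<close>

definition proper_class :: "('o, 'm, 'e) etri set \<Rightarrow> bool" where
  "proper_class \<xi> \<longleftrightarrow> \<xi> \<subseteq> etriangles \<and>
     (\<forall>t\<in>\<xi>. \<forall>t'\<in>etriangles. etri_iso t t' \<longrightarrow> t' \<in> \<xi>) \<and>
     (\<forall>t\<in>\<xi>. \<forall>t'\<in>\<xi>. \<forall>t''. etri_sum t t' t'' \<longrightarrow> t'' \<in> \<xi>) \<and>
     (\<forall>A x B y C. (A, x, B, y, C, \<one>\<^bsub>Ext \<C> C A\<^esub>) \<in> etriangles \<longrightarrow>
        (A, x, B, y, C, \<one>\<^bsub>Ext \<C> C A\<^esub>) \<in> \<xi>) \<and>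
     (\<forall>A x B y C \<delta> C' x' B' y'. \<forall>c\<in>Mor C' C. (A, x, B, y, C, \<delta>) \<in> \<xi> \<and>
        (A, x', B', y', C', pull A c \<delta>) \<in> etriangles \<longrightarrow> (A, x', B', y', C', pull A c \<delta>) \<in> \<xi>) \<and>
     (\<forall>A x B y C \<delta> A' x' B' y'. \<forall>a\<in>Mor A A'. (A, x, B, y, C, \<delta>) \<in> \<xi> \<and>
        (A', x', B', y', C, push C a \<delta>) \<in> etriangles \<longrightarrow> (A', x', B', y', C, push C a \<delta>) \<in> \<xi>) \<and>
     saturated \<xi>"


subsection \<open>Exactness, projectives and injectives\<close>

text \<open>
  In the library, \<open>short_exact_sequence G3 G2 G1 q j\<close> lists an exact sequence
  \<open>0 \<rightarrow> G1 \<rightarrow> G2 \<rightarrow> G3 \<rightarrow> 0\<close> with maps \<open>j\<close>, \<open>q\<close> from right to left.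
\<close>

fun hom_from_exact :: "'o \<Rightarrow> ('o, 'm, 'e) etri \<Rightarrow> bool" where
  "hom_from_exact W (A, x, B, y, C, \<delta>) \<longleftrightarrow>
     short_exact_sequence (Hom \<C> W C) (Hom \<C> W B) (Hom \<C> W A) (\<lambda>\<phi>. y \<cdot> \<phi>) (\<lambda>\<phi>. x \<cdot> \<phi>)"

fun hom_into_exact :: "'o \<Rightarrow> ('o, 'm, 'e) etri \<Rightarrow> bool" where
  "hom_into_exact W (A, x, B, y, C, \<delta>) \<longleftrightarrow>
     short_exact_sequence (Hom \<C> A W) (Hom \<C> B W) (Hom \<C> C W) (\<lambda>\<phi>. \<phi> \<cdot> x) (\<lambda>\<phi>. \<phi> \<cdot> y)"

text \<open>The \<open>\<E>\<close>-triangles in \<open>\<xi>\<close> that are \<open>\<C>(\<W>,-)\<close>-exact, respectively \<open>\<C>(-,\<W>)\<close>-exact.\<close>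

definition cov_exact :: "('o, 'm, 'e) etri set \<Rightarrow> 'o set \<Rightarrow> ('o, 'm, 'e) etri set" where
  "cov_exact \<xi> \<W> = {t \<in> \<xi>. \<forall>W\<in>\<W>. hom_from_exact W t}"

definition contra_exact :: "('o, 'm, 'e) etri set \<Rightarrow> 'o set \<Rightarrow> ('o, 'm, 'e) etri set" where
  "contra_exact \<xi> \<W> = {t \<in> \<xi>. \<forall>W\<in>\<W>. hom_into_exact W t}"

definition xi_projectives :: "('o, 'm, 'e) etri set \<Rightarrow> 'o set" where
  "xi_projectives \<xi> = {P \<in> Obj \<C>. \<forall>t\<in>\<xi>. hom_from_exact P t}"

definition xi_injectives :: "('o, 'm, 'e) etri set \<Rightarrow> 'o set" where
  "xi_injectives \<xi> = {I \<in> Obj \<C>. \<forall>t\<in>\<xi>. hom_into_exact I t}"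

definition enough_projectives :: "('o, 'm, 'e) etri set \<Rightarrow> bool" where
  "enough_projectives \<xi> \<longleftrightarrow>
     (\<forall>A\<in>Obj \<C>. \<exists>K x P y \<delta>. (K, x, P, y, A, \<delta>) \<in> \<xi> \<and> P \<in> xi_projectives \<xi>)"

definition enough_injectives :: "('o, 'm, 'e) etri set \<Rightarrow> bool" where
  "enough_injectives \<xi> \<longleftrightarrow>
     (\<forall>A\<in>Obj \<C>. \<exists>x I y K \<delta>. (A, x, I, y, K, \<delta>) \<in> \<xi> \<and> I \<in> xi_injectives \<xi>)"


subsection \<open>Gorenstein objects and dimensions\<close>

definition is_complex :: "(int \<Rightarrow> 'o) \<Rightarrow> (int \<Rightarrow> 'm) \<Rightarrow> bool" where
  "is_complex X d \<longleftrightarrow> (\<forall>n. X n \<in> Obj \<C> \<and> d n \<in> Mor (X n) (X (n - 1)) \<and>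
     d (n - 1) \<cdot> d n = \<one>\<^bsub>Hom \<C> (X n) (X (n - 2))\<^esub>)"

text \<open>
  The complex \<open>(X, d)\<close> is spliced from \<open>\<E>\<close>-triangles \<open>K\<^sub>n\<^sub>+\<^sub>1 \<rightarrow> X\<^sub>n \<rightarrow> K\<^sub>n\<close> belonging to \<open>T\<close>.
  For \<open>T = \<xi>\<close> this is \<open>\<xi>\<close>-exactness of \<open>(X, d)\<close>; for \<open>T = contra_exact \<xi> \<W>\<close> (\<open>cov_exact \<xi> \<W>\<close>) it is
  \<open>\<C>(-,\<W>)\<close>-exactness (\<open>\<C>(\<W>,-)\<close>-exactness).
\<close>

definition spliced :: "('o, 'm, 'e) etri set \<Rightarrow> (int \<Rightarrow> 'o) \<Rightarrow> (int \<Rightarrow> 'm) \<Rightarrow> (int \<Rightarrow> 'o) \<Rightarrow> bool" where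
  "spliced T X d K \<longleftrightarrow> is_complex X d \<and>
     (\<exists>g f \<delta>. \<forall>n. (K (n + 1), g n, X n, f n, K n, \<delta> n) \<in> T \<and> d n = g (n - 1) \<cdot> f n)"

definition GP :: "('o, 'm, 'e) etri set \<Rightarrow> 'o set" where
  "GP \<xi> = {G. \<exists>X d K n. (\<forall>k. X k \<in> xi_projectives \<xi>) \<and>
     spliced (contra_exact \<xi> (xi_projectives \<xi>)) X d K \<and> G = K n}"

definition GI :: "('o, 'm, 'e) etri set \<Rightarrow> 'o set" where
  "GI \<xi> = {G. \<exists>X d K n. (\<forall>k. X k \<in> xi_injectives \<xi>) \<and>
     spliced (cov_exact \<xi> (xi_injectives \<xi>)) X d K \<and> G = K n}"

fun Gpd_le :: "('o, 'm, 'e) etri set \<Rightarrow> 'o \<Rightarrow> nat \<Rightarrow> bool" where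
  "Gpd_le \<xi> A 0 \<longleftrightarrow> A \<in> GP \<xi>"
| "Gpd_le \<xi> A (Suc n) \<longleftrightarrow>
     (\<exists>K x G y \<delta>. (K, x, G, y, A, \<delta>) \<in> \<xi> \<and> G \<in> GP \<xi> \<and> Gpd_le \<xi> K n)"

fun Gid_le :: "('o, 'm, 'e) etri set \<Rightarrow> 'o \<Rightarrow> nat \<Rightarrow> bool" where
  "Gid_le \<xi> A 0 \<longleftrightarrow> A \<in> GI \<xi>"
| "Gid_le \<xi> A (Suc n) \<longleftrightarrow>
     (\<exists>x G y K \<delta>. (A, x, G, y, K, \<delta>) \<in> \<xi> \<and> G \<in> GI \<xi> \<and> Gid_le \<xi> K n)"

definition Gpd :: "('o, 'm, 'e) etri set \<Rightarrow> 'o \<Rightarrow> enat" where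
  "Gpd \<xi> A = (INF n\<in>{n. Gpd_le \<xi> A n}. enat n)"

definition Gid :: "('o, 'm, 'e) etri set \<Rightarrow> 'o \<Rightarrow> enat" where
  "Gid \<xi> A = (INF n\<in>{n. Gid_le \<xi> A n}. enat n)"

definition GP_finite :: "('o, 'm, 'e) etri set \<Rightarrow> 'o set" where
  "GP_finite \<xi> = {A \<in> Obj \<C>. Gpd \<xi> A < \<infinity>}"

definition GI_finite :: "('o, 'm, 'e) etri set \<Rightarrow> 'o set" where
  "GI_finite \<xi> = {A \<in> Obj \<C>. Gid \<xi> A < \<infinity>}"


subsection \<open>Gorenstein resolutions and cohomology\<close>

text \<open>
  \<open>d 0\<close> is the augmentation \<open>G\<^sub>0 \<rightarrow> M\<close> and \<open>d (i + 1)\<close> is the differential \<open>G\<^sub>i\<^sub>+\<^sub>1 \<rightarrow> G\<^sub>i\<close>; dually for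
  coresolutions.  The cohomology of the deleted complexes does not involve \<open>d 0\<close>.
\<close>

definition GP_resolution :: "('o, 'm, 'e) etri set \<Rightarrow> 'o \<Rightarrow> (nat \<Rightarrow> 'o) \<Rightarrow> (nat \<Rightarrow> 'm) \<Rightarrow> bool" where
  "GP_resolution \<xi> M G d \<longleftrightarrow> (\<forall>i. G i \<in> GP \<xi>) \<and>
     (\<exists>K g f \<delta>. K 0 = M \<and>
        (\<forall>i. (K (Suc i), g i, G i, f i, K i, \<delta> i) \<in> cov_exact \<xi> (GP \<xi>)) \<and>
        d 0 = f 0 \<and> (\<forall>i. d (Suc i) = g i \<cdot> f (Suc i)))"

definition GI_coresolution :: "('o, 'm, 'e) etri set \<Rightarrow> 'o \<Rightarrow> (nat \<Rightarrow> 'o) \<Rightarrow> (nat \<Rightarrow> 'm) \<Rightarrow> bool" where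
  "GI_coresolution \<xi> N E d \<longleftrightarrow> (\<forall>i. E i \<in> GI \<xi>) \<and>
     (\<exists>K g f \<delta>. K 0 = N \<and>
        (\<forall>i. (K i, g i, E i, f i, K (Suc i), \<delta> i) \<in> contra_exact \<xi> (GI \<xi>)) \<and>
        d 0 = g 0 \<and> (\<forall>i. d (Suc i) = g (Suc i) \<cdot> f i))"

text \<open>The cohomology groups are formed with an arbitrary choice of a (co)resolution.\<close>

definition xt_GP :: "('o, 'm, 'e) etri set \<Rightarrow> nat \<Rightarrow> 'o \<Rightarrow> 'o \<Rightarrow> 'm set monoid" where
  "xt_GP \<xi> i M N =
     (let (G, d) = (SOME (G, d). GP_resolution \<xi> M G d)
      in cochain_cohomology (\<lambda>j. Hom \<C> (G j) N) (\<lambda>j \<phi>. \<phi> \<cdot> d (Suc j)) i)"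

definition xt_GI :: "('o, 'm, 'e) etri set \<Rightarrow> nat \<Rightarrow> 'o \<Rightarrow> 'o \<Rightarrow> 'm set monoid" where
  "xt_GI \<xi> i M N =
     (let (E, d) = (SOME (E, d). GI_coresolution \<xi> N E d)
      in cochain_cohomology (\<lambda>j. Hom \<C> M (E j)) (\<lambda>j \<phi>. d (Suc j) \<cdot> \<phi>) i)"

end

end

theory Submission
  imports Defs
begin

text \<open>
  Call a map a ghost if it is killed by all maps from \<open>\<xi>\<close>-projectives, equivalently by all maps to
  \<open>\<xi>\<close>-injectives, and write \<open>E \<bottom> C\<close> if every extension in \<open>\<xi>\<close> of \<open>E\<close> by \<open>C\<close> and every ghost
  \<open>E \<rightarrow> C\<close> vanishes.  Both notions are self-dual.  Dimension shifting along \<open>\<xi>\<close> gives \<open>G \<bottom> L\<close> and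
  \<open>L \<bottom> I\<close> for \<open>G\<close> Gorenstein projective, \<open>I\<close> Gorenstein injective and \<open>L\<close> of finite projective
  dimension.  Since Gorenstein projectives are closed under extensions, an object \<open>M\<close> of finite
  Gorenstein projective dimension has a triangle \<open>L \<rightarrow> E \<rightarrow> M\<close> in \<open>\<xi>\<close> with \<open>L\<close> of finite projective
  dimension and \<open>E\<close> Gorenstein projective.  Comparing an arbitrary Gorenstein projective resolution
  of \<open>M\<close> with this triangle shows that it remains exact under \<open>\<C>(-, I)\<close>; dually for coresolutions
  of \<open>N\<close>.  So the double complex \<open>\<C>(G\<^sub>i, E\<^sub>j)\<close> has exact rows and columns, and shifting along it
  identifies the two cohomologies.
\<close>

section \<open>Extriangulated categories\<close>

text \<open>No higher extension groups are available, so every vanishing statement is reduced to one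
  relation between two objects, \<open>orth\<close>. Ghosts belong to it because a nonzero map may
  vanish after composition with a deflation: one end of a \<open>Hom\<close>-sequence is not
  controlled by extensions. Dimension shifting is then the repeated use of one lemma, without long
  exact sequences. The cohomologies are formed with a (co)resolution picked by \<open>SOME\<close>,
  about which nothing more is known. Exactness under maps to Gorenstein injectives must therefore
  hold for every Gorenstein projective resolution, not only for a well-built one, and the syzygies
  of an arbitrary resolution have to be controlled. Kernels, cokernels and pushouts in the abelian
  sense are absent; weak factorizations, \<open>ET4\<close> and saturation replace them. Most dual
  statements are instances of the original in the opposite category, which requires that the notion
  of proper class, stated with a one-sided saturation, be shown self-dual.\<close>

lemma (in comm_group) ex_left_diff:
  assumes "u \<in> carrier G" "v \<in> carrier G"
  obtains w where "w \<in> carrier G" "u = w \<otimes> v"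
  using assms by (metis inv_closed inv_solve_right m_closed)

section \<open>Typed arrows and the additive structure\<close>

locale extri_cat =
  fixes \<C> :: "('o, 'm, 'e) ext_cat" (structure)
  assumes extri: "extriangulated \<C>"
begin

text \<open>\<open>Hom \<C> A B\<close> is a total function of \<open>A\<close> and
  \<open>B\<close>, unconstrained outside \<open>Obj \<C>\<close>. Putting objecthood into the
  typing keeps these side conditions out of later statements.\<close>

definition arr :: "'m \<Rightarrow> 'o \<Rightarrow> 'o \<Rightarrow> bool" where
  "arr f A B \<longleftrightarrow> A \<in> Obj \<C> \<and> B \<in> Obj \<C> \<and> f \<in> Mor \<C> A B"

definition ext :: "'e \<Rightarrow> 'o \<Rightarrow> 'o \<Rightarrow> bool" where
  "ext \<delta> C A \<longleftrightarrow> C \<in> Obj \<C> \<and> A \<in> Obj \<C> \<and> \<delta> \<in> carrier (Ext \<C> C A)"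

definition tri :: "'o \<Rightarrow> 'm \<Rightarrow> 'o \<Rightarrow> 'm \<Rightarrow> 'o \<Rightarrow> 'e \<Rightarrow> bool" where
  "tri A x B y C \<delta> \<longleftrightarrow> (A, x, B, y, C, \<delta>) \<in> etriangles \<C>"

abbreviation Id :: "'o \<Rightarrow> 'm" where "Id \<equiv> Ident \<C>"
abbreviation zr :: "'o \<Rightarrow> 'o \<Rightarrow> 'm" where "zr A B \<equiv> \<one>\<^bsub>Hom \<C> A B\<^esub>"
abbreviation ze :: "'o \<Rightarrow> 'o \<Rightarrow> 'e" where "ze C A \<equiv> \<one>\<^bsub>Ext \<C> C A\<^esub>"
abbreviation psh :: "'o \<Rightarrow> 'm \<Rightarrow> 'e \<Rightarrow> 'e" where "psh \<equiv> push \<C>"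
abbreviation pll :: "'o \<Rightarrow> 'm \<Rightarrow> 'e \<Rightarrow> 'e" where "pll \<equiv> pull \<C>"

lemma cat: "is_category \<C>" and preadd: "is_preadditive \<C>" and addit: "is_additive \<C>"
  and bifun: "additive_bifunctor \<C>" and add_real: "is_additive_realization \<C>"
  and real: "is_realization \<C>" and et3: "ET3 \<C>" and et3op: "ET3_op \<C>"
  and et4: "ET4 \<C>" and et4op: "ET4_op \<C>"
  using extri
  by (simp_all add: extriangulated_def is_additive_def is_preadditive_def is_additive_realization_def)

lemma arr_obj: "arr f A B \<Longrightarrow> A \<in> Obj \<C>" "arr f A B \<Longrightarrow> B \<in> Obj \<C>"
  and arr_mor: "arr f A B \<Longrightarrow> f \<in> Mor \<C> A B"
  by (auto simp: arr_def)

lemma id_arr [simp, intro]: "A \<in> Obj \<C> \<Longrightarrow> arr (Id A) A A"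
  using cat by (simp add: is_category_def arr_def)

lemma comp_arr: "arr f A B \<Longrightarrow> arr g B D \<Longrightarrow> arr (g \<cdot> f) A D"
  using cat unfolding is_category_def arr_def by (elim conjE) blast

lemma id_right: "arr f A B \<Longrightarrow> f \<cdot> Id A = f"
  and id_left: "arr f A B \<Longrightarrow> Id B \<cdot> f = f"
  using cat unfolding is_category_def arr_def by (elim conjE, blast)+

lemma assoc: "arr f A B \<Longrightarrow> arr g B D \<Longrightarrow> arr h D F \<Longrightarrow> (h \<cdot> g) \<cdot> f = h \<cdot> (g \<cdot> f)"
  using cat unfolding is_category_def arr_def by (elim conjE) blast

lemma hom_comm_group: "A \<in> Obj \<C> \<Longrightarrow> B \<in> Obj \<C> \<Longrightarrow> comm_group (Hom \<C> A B)"
  using preadd unfolding is_preadditive_def by (elim conjE) blast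

lemma hom_group: "A \<in> Obj \<C> \<Longrightarrow> B \<in> Obj \<C> \<Longrightarrow> group (Hom \<C> A B)"
  by (rule comm_group.axioms(2)[OF hom_comm_group])

lemma zr_arr [simp, intro]: "A \<in> Obj \<C> \<Longrightarrow> B \<in> Obj \<C> \<Longrightarrow> arr (zr A B) A B"
  by (simp add: arr_def monoid.one_closed group.is_monoid hom_group)

lemma sum_arr: "arr f A B \<Longrightarrow> arr g A B \<Longrightarrow> arr (f \<otimes>\<^bsub>Hom \<C> A B\<^esub> g) A B"
  by (simp add: arr_def monoid.m_closed group.is_monoid hom_group)

lemma comp_sum_right:
  "arr f A B \<Longrightarrow> arr f' A B \<Longrightarrow> arr g B D \<Longrightarrow>
    g \<cdot> (f \<otimes>\<^bsub>Hom \<C> A B\<^esub> f') = (g \<cdot> f) \<otimes>\<^bsub>Hom \<C> A D\<^esub> (g \<cdot> f')"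
  and comp_sum_left:
  "arr f A B \<Longrightarrow> arr g B D \<Longrightarrow> arr g' B D \<Longrightarrow>
    (g \<otimes>\<^bsub>Hom \<C> B D\<^esub> g') \<cdot> f = (g \<cdot> f) \<otimes>\<^bsub>Hom \<C> A D\<^esub> (g' \<cdot> f)"
  using preadd unfolding is_preadditive_def arr_def by (elim conjE, blast)+

lemma post_hom: "arr g B D \<Longrightarrow> A \<in> Obj \<C> \<Longrightarrow> (\<lambda>f. g \<cdot> f) \<in> hom (Hom \<C> A B) (Hom \<C> A D)"
  using comp_arr[of _ A B g D] comp_sum_right[of _ A B _ g D] by (auto intro!: homI simp: arr_def)

lemma pre_hom: "arr f A B \<Longrightarrow> D \<in> Obj \<C> \<Longrightarrow> (\<lambda>g. g \<cdot> f) \<in> hom (Hom \<C> B D) (Hom \<C> A D)"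
  using comp_arr[of f A B _ D] comp_sum_left[of f A B _ D] by (auto intro!: homI simp: arr_def)

lemma hom_zr: "h \<in> hom (Hom \<C> A B) (Hom \<C> A' B') \<Longrightarrow> A \<in> Obj \<C> \<Longrightarrow> B \<in> Obj \<C> \<Longrightarrow>
    A' \<in> Obj \<C> \<Longrightarrow> B' \<in> Obj \<C> \<Longrightarrow> h (zr A B) = zr A' B'"
  by (rule hom_one[OF _ hom_group hom_group])

lemma comp_zr_right: "arr g B D \<Longrightarrow> A \<in> Obj \<C> \<Longrightarrow> g \<cdot> zr A B = zr A D"
  using hom_zr[OF post_hom[of g B D A]] arr_obj[of g B D] by simp

lemma comp_zr_left: "arr f A B \<Longrightarrow> D \<in> Obj \<C> \<Longrightarrow> zr B D \<cdot> f = zr A D"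
  using hom_zr[OF pre_hom[of f A B D]] arr_obj[of f A B] by simp

lemma sum_zr: "arr f A B \<Longrightarrow> f \<otimes>\<^bsub>Hom \<C> A B\<^esub> zr A B = f" "arr f A B \<Longrightarrow> zr A B \<otimes>\<^bsub>Hom \<C> A B\<^esub> f = f"
  by (simp_all add: arr_def monoid.l_one monoid.r_one group.is_monoid hom_group)

lemma arr_cancel:
  assumes "arr w A B" "arr v A B" "v = w \<otimes>\<^bsub>Hom \<C> A B\<^esub> v"
  shows "w = zr A B"
  using group.r_cancel_one'[OF hom_group, of A B v w] assms by (simp add: arr_def)

lemma diff_arr:
  assumes "arr u A B" "arr v A B"
  obtains w where "arr w A B" "u = w \<otimes>\<^bsub>Hom \<C> A B\<^esub> v"
  using comm_group.ex_left_diff[OF hom_comm_group, of A B u v] assms by (auto simp: arr_def)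

text \<open>Disjointness of the \<open>Hom\<close>-sets makes source and target functions of the
  arrow. Composability becomes an equation between \<open>src\<close> and \<open>tgt\<close>, which
  the simplifier can discharge through \<open>csimps\<close>.\<close>

definition src :: "'m \<Rightarrow> 'o" where "src f = (THE A. \<exists>B. arr f A B)"
definition tgt :: "'m \<Rightarrow> 'o" where "tgt f = (THE B. \<exists>A. arr f A B)"
definition mor :: "'m \<Rightarrow> bool" where "mor f \<longleftrightarrow> (\<exists>A B. arr f A B)"

lemma arr_unique:
  assumes "arr f A B" "arr f A' B'" shows "A = A'" "B = B'"
proof -
  have "\<forall>A\<in>Obj \<C>. \<forall>B\<in>Obj \<C>. \<forall>A'\<in>Obj \<C>. \<forall>B'\<in>Obj \<C>.
        Mor \<C> A B \<inter> Mor \<C> A' B' \<noteq> {} \<longrightarrow> A = A' \<and> B = B'"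
    using cat by (simp add: is_category_def)
  moreover have "f \<in> Mor \<C> A B \<inter> Mor \<C> A' B'" using assms by (simp add: arr_def)
  ultimately show "A = A'" "B = B'" using assms unfolding arr_def by fast+
qed

lemma arr_iff: "arr f A B \<longleftrightarrow> mor f \<and> src f = A \<and> tgt f = B"
proof -
  have "src f = A \<and> tgt f = B" if "arr f A B" for A B
    unfolding src_def tgt_def using that arr_unique by (intro conjI the_equality) blast+
  then show ?thesis unfolding mor_def by blast
qed

lemma mor_arr: "mor f \<Longrightarrow> arr f (src f) (tgt f)"
  by (simp add: arr_iff)

lemma mor_id [simp]: "A \<in> Obj \<C> \<Longrightarrow> mor (Id A)" "A \<in> Obj \<C> \<Longrightarrow> src (Id A) = A" "A \<in> Obj \<C> \<Longrightarrow> tgt (Id A) = A"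
  using id_arr[of A] by (auto simp: arr_iff)

lemma mor_zr [simp]:
  assumes "A \<in> Obj \<C>" "B \<in> Obj \<C>"
  shows "mor (zr A B)" "src (zr A B) = A" "tgt (zr A B) = B"
  using zr_arr[OF assms] by (auto simp: arr_iff)

lemma mor_comp:
  assumes "mor f" "mor g" "src g = tgt f"
  shows "mor (g \<cdot> f)" "src (g \<cdot> f) = src f" "tgt (g \<cdot> f) = tgt g"
  using comp_arr[of f "src f" "tgt f" g "tgt g"] assms by (auto simp: arr_iff)

lemma mor_obj: "mor f \<Longrightarrow> src f \<in> Obj \<C>" "mor f \<Longrightarrow> tgt f \<in> Obj \<C>"
  using arr_obj mor_arr by blast+

lemma comp_assoc: "mor f \<Longrightarrow> mor g \<Longrightarrow> mor h \<Longrightarrow> src g = tgt f \<Longrightarrow> src h = tgt g \<Longrightarrow>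
   (h \<cdot> g) \<cdot> f = h \<cdot> (g \<cdot> f)"
  by (rule assoc[of f "src f" "tgt f" g "tgt g" h "tgt h"]) (auto simp: arr_iff)

lemma comp_id: "mor f \<Longrightarrow> src f = A \<Longrightarrow> f \<cdot> Id A = f" "mor f \<Longrightarrow> tgt f = B \<Longrightarrow> Id B \<cdot> f = f"
  using id_right[of f "src f" "tgt f"] id_left[of f "src f" "tgt f"] by (simp_all add: arr_iff)

lemma comp_zr: "mor f \<Longrightarrow> src f = B \<Longrightarrow> A \<in> Obj \<C> \<Longrightarrow> f \<cdot> zr A B = zr A (tgt f)"
  "mor f \<Longrightarrow> tgt f = B \<Longrightarrow> A \<in> Obj \<C> \<Longrightarrow> zr B A \<cdot> f = zr (src f) A"
  using comp_zr_right[of f "src f" "tgt f" A] comp_zr_left[of f "src f" "tgt f" A] by (simp_all add: arr_iff)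

text \<open>Since \<open>csimps\<close> associates to the right, the plain equation for
  \<open>g\<close> after \<open>f\<close> would not match inside a longer composite; this form
  does.\<close>

lemma comp_eq: "g \<cdot> f = h \<Longrightarrow> mor k \<Longrightarrow> mor f \<Longrightarrow> mor g \<Longrightarrow> src f = tgt k \<Longrightarrow> src g = tgt f \<Longrightarrow>
   g \<cdot> (f \<cdot> k) = h \<cdot> k"
  using comp_assoc[of k f g] by simp

lemmas csimps = arr_iff mor_comp mor_obj comp_assoc comp_id comp_zr

section \<open>Extension groups and the calculus of \<open>push\<close> and
  \<open>pull\<close>\<close>

lemma ext_obj: "ext \<delta> C A \<Longrightarrow> C \<in> Obj \<C>" "ext \<delta> C A \<Longrightarrow> A \<in> Obj \<C>"
  by (auto simp: ext_def)

lemma ext_comm_group: "C \<in> Obj \<C> \<Longrightarrow> A \<in> Obj \<C> \<Longrightarrow> comm_group (Ext \<C> C A)"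
  using bifun by (simp add: additive_bifunctor_def)

lemma ext_group: "C \<in> Obj \<C> \<Longrightarrow> A \<in> Obj \<C> \<Longrightarrow> group (Ext \<C> C A)"
  by (rule comm_group.axioms(2)[OF ext_comm_group])

lemma ze_ext [simp, intro]: "C \<in> Obj \<C> \<Longrightarrow> A \<in> Obj \<C> \<Longrightarrow> ext (ze C A) C A"
  by (simp add: ext_def monoid.one_closed group.is_monoid ext_group)

lemma sum_ze: "ext f A B \<Longrightarrow> f \<otimes>\<^bsub>Ext \<C> A B\<^esub> ze A B = f" "ext f A B \<Longrightarrow> ze A B \<otimes>\<^bsub>Ext \<C> A B\<^esub> f = f"
  by (simp_all add: ext_def monoid.l_one monoid.r_one group.is_monoid ext_group)

lemma diff_ext:
  assumes "ext u A B" "ext v A B"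
  obtains w where "ext w A B" "u = w \<otimes>\<^bsub>Ext \<C> A B\<^esub> v"
  using comm_group.ex_left_diff[OF ext_comm_group, of A B u v] assms by (auto simp: ext_def)

lemma ext_cancel:
  assumes "ext w A B" "ext v A B" "v = w \<otimes>\<^bsub>Ext \<C> A B\<^esub> v"
  shows "w = ze A B"
  using group.r_cancel_one'[OF ext_group, of A B v w] assms by (simp add: ext_def)

lemma EMap_hom: "arr c C' C \<Longrightarrow> arr a A A' \<Longrightarrow> EMap \<C> c a \<in> hom (Ext \<C> C A) (Ext \<C> C' A')"
  using bifun unfolding additive_bifunctor_def arr_def by (elim conjE) blast

lemma EMap_comp: "arr c C' C \<Longrightarrow> arr c' C'' C' \<Longrightarrow> arr a A A' \<Longrightarrow> arr a' A' A'' \<Longrightarrow> ext \<delta> C A \<Longrightarrow>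
   EMap \<C> (c \<cdot> c') (a' \<cdot> a) \<delta> = EMap \<C> c' a' (EMap \<C> c a \<delta>)"
  using bifun unfolding additive_bifunctor_def arr_def ext_def by (elim conjE) blast

lemma EMap_sum:
  assumes "arr c C' C" "arr d C' C" "arr a A A'" "arr b A A'" "ext \<delta> C A"
  shows EMap_sum_left:
      "EMap \<C> (c \<otimes>\<^bsub>Hom \<C> C' C\<^esub> d) a \<delta> = EMap \<C> c a \<delta> \<otimes>\<^bsub>Ext \<C> C' A'\<^esub> EMap \<C> d a \<delta>"
    and EMap_sum_right:
      "EMap \<C> c (a \<otimes>\<^bsub>Hom \<C> A A'\<^esub> b) \<delta> = EMap \<C> c a \<delta> \<otimes>\<^bsub>Ext \<C> C' A'\<^esub> EMap \<C> c b \<delta>"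
  using conjunct2[OF conjunct2[OF conjunct2[OF bifun[unfolded additive_bifunctor_def]]],
      rule_format, of C C' A A' c d a b \<delta>] assms
  by (simp_all add: arr_def ext_def)

lemma push_hom: "C \<in> Obj \<C> \<Longrightarrow> arr a A A' \<Longrightarrow> psh C a \<in> hom (Ext \<C> C A) (Ext \<C> C A')"
  and pull_hom: "A \<in> Obj \<C> \<Longrightarrow> arr c C' C \<Longrightarrow> pll A c \<in> hom (Ext \<C> C A) (Ext \<C> C' A)"
  using EMap_hom unfolding push_def[abs_def] pull_def[abs_def] by (simp_all)

lemma push_ext: "ext \<delta> C A \<Longrightarrow> arr a A A' \<Longrightarrow> ext (psh C a \<delta>) C A'"
  using hom_in_carrier[OF push_hom, of C a A A' \<delta>] arr_obj(2)[of a A A'] by (simp add: ext_def)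

lemma pull_ext: "ext \<delta> C A \<Longrightarrow> arr c C' C \<Longrightarrow> ext (pll A c \<delta>) C' A"
  using hom_in_carrier[OF pull_hom, of A c C' C \<delta>] arr_obj(1)[of c C' C] by (simp add: ext_def)

lemma push_ze: "C \<in> Obj \<C> \<Longrightarrow> arr a A A' \<Longrightarrow> psh C a (ze C A) = ze C A'"
  by (rule hom_one[OF push_hom ext_group ext_group]) (auto dest: arr_obj)

lemma pull_ze: "A \<in> Obj \<C> \<Longrightarrow> arr c C' C \<Longrightarrow> pll A c (ze C A) = ze C' A"
  by (rule hom_one[OF pull_hom ext_group ext_group]) (auto dest: arr_obj)

lemma push_add: "ext \<delta> C A \<Longrightarrow> ext \<epsilon> C A \<Longrightarrow> arr a A A' \<Longrightarrow>
    psh C a (\<delta> \<otimes>\<^bsub>Ext \<C> C A\<^esub> \<epsilon>) = psh C a \<delta> \<otimes>\<^bsub>Ext \<C> C A'\<^esub> psh C a \<epsilon>"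
  by (rule hom_mult[OF push_hom]) (auto simp: ext_def)

lemma push_sum: "ext \<delta> C A \<Longrightarrow> arr a A A' \<Longrightarrow> arr b A A' \<Longrightarrow>
    psh C (a \<otimes>\<^bsub>Hom \<C> A A'\<^esub> b) \<delta> = psh C a \<delta> \<otimes>\<^bsub>Ext \<C> C A'\<^esub> psh C b \<delta>"
  unfolding push_def by (rule EMap_sum_right[of "Id C" C C "Id C"]) (auto dest: ext_obj)

lemma pull_sum: "ext \<delta> C A \<Longrightarrow> arr a C' C \<Longrightarrow> arr b C' C \<Longrightarrow>
    pll A (a \<otimes>\<^bsub>Hom \<C> C' C\<^esub> b) \<delta> = pll A a \<delta> \<otimes>\<^bsub>Ext \<C> C' A\<^esub> pll A b \<delta>"
  unfolding pull_def by (rule EMap_sum_left[of _ C' C _ "Id A" A A "Id A"]) (auto dest: ext_obj)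

lemma push_id: "ext \<delta> C A \<Longrightarrow> psh C (Id A) \<delta> = \<delta>"
  and pull_id: "ext \<delta> C A \<Longrightarrow> pll A (Id C) \<delta> = \<delta>"
  using bifun by (simp_all add: additive_bifunctor_def ext_def push_def pull_def)

lemma push_comp: "ext \<delta> C A \<Longrightarrow> arr a A A' \<Longrightarrow> arr a' A' A'' \<Longrightarrow>
    psh C (a' \<cdot> a) \<delta> = psh C a' (psh C a \<delta>)"
  using EMap_comp[of "Id C" C C "Id C" C a A A' a' A'' \<delta>] id_left[of "Id C" C C]
  by (simp add: push_def ext_obj)

lemma pull_comp: "ext \<delta> C A \<Longrightarrow> arr c C' C \<Longrightarrow> arr c' C'' C' \<Longrightarrow>
    pll A (c \<cdot> c') \<delta> = pll A c' (pll A c \<delta>)"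
  using EMap_comp[of c C' C c' C'' "Id A" A A "Id A" A \<delta>] id_left[of "Id A" A A]
  by (simp add: pull_def ext_obj)

lemma push_pull: "ext \<delta> C A \<Longrightarrow> arr c C' C \<Longrightarrow> arr a A A' \<Longrightarrow>
    psh C' a (pll A c \<delta>) = pll A' c (psh C a \<delta>)"
  using EMap_comp[of c C' C "Id C'" C' "Id A" A A a A' \<delta>]
    EMap_comp[of "Id C" C C c C' a A A' "Id A'" A' \<delta>]
    id_left[of a A A'] id_right[of a A A'] id_left[of c C' C] id_right[of c C' C]
  by (simp add: pull_def push_def ext_obj arr_obj)

lemma push_zr: assumes "ext \<delta> C A" "A' \<in> Obj \<C>" shows "psh C (zr A A') \<delta> = ze C A'"
proof -
  have z: "arr (zr A A') A A'" using assms ext_obj by blast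
  show ?thesis using ext_cancel[OF push_ext[OF assms(1) z] push_ext[OF assms(1) z]]
      push_sum[OF assms(1) z z] sum_zr(1)[OF z] by simp
qed

lemma pull_zr: assumes "ext \<delta> C A" "C' \<in> Obj \<C>" shows "pll A (zr C' C) \<delta> = ze C' A"
proof -
  have z: "arr (zr C' C) C' C" using assms ext_obj by blast
  show ?thesis using ext_cancel[OF pull_ext[OF assms(1) z] pull_ext[OF assms(1) z]]
      pull_sum[OF assms(1) z z] sum_zr(1)[OF z] by simp
qed

section \<open>The zero object, realizations and the axioms in typed form\<close>

definition Zo :: 'o where "Zo = (SOME Z. zero_object \<C> Z)"

lemma zero_Zo: "zero_object \<C> Zo"
  unfolding Zo_def using addit someI_ex[of "zero_object \<C>"] unfolding is_additive_def by blast

lemma Zo_obj [simp, intro]: "Zo \<in> Obj \<C>"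
  using zero_Zo unfolding zero_object_def by (elim conjE) blast

lemma to_Zo: "arr f A Zo \<Longrightarrow> f = zr A Zo"
  and from_Zo: "arr f Zo A \<Longrightarrow> f = zr Zo A"
  using zero_Zo zr_arr[of A Zo] zr_arr[of Zo A] unfolding zero_object_def arr_def by (elim conjE, blast)+

lemma ext_from_Zo: assumes "ext \<delta> Zo A" shows "\<delta> = ze Zo A"
  using pull_zr[OF assms Zo_obj] pull_id[OF assms] to_Zo[of "Id Zo" Zo] by simp

lemma tri_realize:
  assumes "ext \<delta> C A" obtains B x y where "tri A x B y C \<delta>"
proof -
  have "Rlz \<C> C A \<delta> \<in> seqs \<C> A C // seq_equiv \<C> A C"
    using real assms unfolding is_realization_def ext_def by (elim conjE) blast
  then obtain s where s: "s \<in> seqs \<C> A C" "Rlz \<C> C A \<delta> = seq_equiv \<C> A C `` {s}"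
    by (auto simp: quotient_def)
  obtain B x y where [simp]: "s = (B, x, y)" by (cases s)
  have B: "arr x A B" "arr y B C" using s(1) assms by (auto simp: seqs_def arr_def ext_def)
  have "isomorphism \<C> B B (Id B)"
    unfolding isomorphism_def using id_arr[of B] id_left[of "Id B" B B] B(1) arr_obj arr_mor by metis
  then have "(s, s) \<in> seq_equiv \<C> A C"
    using s(1) B id_left[OF B(1)] id_right[OF B(2)] by (auto simp: seq_equiv_def)
  then show thesis using that[of x B y] assms s unfolding tri_def etriangles_def ext_def by auto
qed

lemma tri_arr:
  assumes "tri A x B y C \<delta>"
  shows "arr x A B" "arr y B C" "ext \<delta> C A"
proof -
  have C: "C \<in> Obj \<C>" "A \<in> Obj \<C>" "\<delta> \<in> carrier (Ext \<C> C A)" "(B, x, y) \<in> Rlz \<C> C A \<delta>"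
    using assms unfolding tri_def etriangles_def by auto
  then have "Rlz \<C> C A \<delta> \<in> seqs \<C> A C // seq_equiv \<C> A C"
    using real unfolding is_realization_def by (elim conjE) blast
  with C(4) have "(B, x, y) \<in> seqs \<C> A C"
    by (auto simp: quotient_def seq_equiv_def)
  then show "arr x A B" "arr y B C" "ext \<delta> C A" using C by (auto simp: seqs_def arr_def ext_def)
qed

text \<open>Both sequences lie in one equivalence class, which is only known as the image of some
  representative. The isomorphism passes through that representative.\<close>

lemma tri_equiv:
  assumes "tri A x B y C \<delta>" "tri A x' B' y' C \<delta>"
  obtains b b' where "arr b B B'" "arr b' B' B" "b' \<cdot> b = Id B" "b \<cdot> b' = Id B'"
    "b \<cdot> x = x'" "y' \<cdot> b = y"
proof -
  have C: "C \<in> Obj \<C>" "A \<in> Obj \<C>" "\<delta> \<in> carrier (Ext \<C> C A)" "(B, x, y) \<in> Rlz \<C> C A \<delta>"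
     "(B', x', y') \<in> Rlz \<C> C A \<delta>"
    using assms unfolding tri_def etriangles_def by auto
  then have "Rlz \<C> C A \<delta> \<in> seqs \<C> A C // seq_equiv \<C> A C"
    using real unfolding is_realization_def by (elim conjE) blast
  then obtain s where s: "s \<in> seqs \<C> A C" "Rlz \<C> C A \<delta> = seq_equiv \<C> A C `` {s}"
    by (auto simp: quotient_def)
  obtain B0 x0 y0 where [simp]: "s = (B0, x0, y0)" by (cases s)
  note t = tri_arr[OF assms(1)] tri_arr[OF assms(2)]
  have B0: "arr x0 A B0" "arr y0 B0 C" using s(1) C by (auto simp: seqs_def arr_def)
  obtain b1 where b1: "isomorphism \<C> B0 B b1" "b1 \<cdot> x0 = x" "y \<cdot> b1 = y0"
    using C(4) s(2) by (auto simp: seq_equiv_def)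
  obtain b2 where b2: "isomorphism \<C> B0 B' b2" "b2 \<cdot> x0 = x'" "y' \<cdot> b2 = y0"
    using C(5) s(2) by (auto simp: seq_equiv_def)
  obtain c1 c2 where c: "arr c1 B B0" "c1 \<cdot> b1 = Id B0" "b1 \<cdot> c1 = Id B" "arr c2 B' B0"
    "c2 \<cdot> b2 = Id B0" "b2 \<cdot> c2 = Id B'"
    using b1(1) b2(1) t B0 unfolding isomorphism_def arr_def by blast
  have b: "arr b1 B0 B" "arr b2 B0 B'"
    using b1(1) b2(1) t B0 unfolding isomorphism_def arr_def by blast+
  show thesis
  proof
    show "arr (b2 \<cdot> c1) B B'" "arr (b1 \<cdot> c2) B' B" using b c by (simp_all add: csimps)
    note e = c(2,3,5,6) c(2,3,5,6)[THEN comp_eq] b1(2,3) b1(2,3)[THEN comp_eq] b2(2,3) b2(2,3)[THEN comp_eq]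
    show "(b1 \<cdot> c2) \<cdot> (b2 \<cdot> c1) = Id B" using b c(1,4) by (simp add: e csimps)
    show "(b2 \<cdot> c1) \<cdot> (b1 \<cdot> c2) = Id B'" using b c(1,4) by (simp add: e csimps)
    show "(b2 \<cdot> c1) \<cdot> x = x'" unfolding b1(2)[symmetric]
      using b c(1,4) B0 by (simp add: c(2) c(2)[THEN comp_eq] b2(2) csimps)
    have "y' \<cdot> (b2 \<cdot> c1) = y0 \<cdot> c1" using b c(1,4) t B0 by (simp add: b2(3)[THEN comp_eq] csimps)
    also have "\<dots> = y" unfolding b1(3)[symmetric] using b c(1,3) t B0 by (simp add: csimps)
    finally show "y' \<cdot> (b2 \<cdot> c1) = y" .
  qed
qed

lemma realize_mor:
  assumes "tri A x B y C \<delta>" "tri A' x' B' y' C' \<delta>'" "arr a A A'" "arr c C C'"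
    "psh C a \<delta> = pll A' c \<delta>'"
  obtains b where "arr b B B'" "b \<cdot> x = x' \<cdot> a" "y' \<cdot> b = c \<cdot> y"
proof -
  have "\<exists>b. etri_morphism \<C> (A, x, B, y, C, \<delta>) (A', x', B', y', C', \<delta>') a b c"
    using real assms unfolding is_realization_def tri_def ext_morphism_def arr_def by (elim conjE) blast
  then show thesis using that tri_arr[OF assms(1)] tri_arr[OF assms(2)] unfolding arr_def by auto
qed

lemma ET3:
  assumes "tri A x B y C \<delta>" "tri A' x' B' y' C' \<delta>'" "arr a A A'" "arr b B B'" "b \<cdot> x = x' \<cdot> a"
  obtains c where "arr c C C'" "c \<cdot> y = y' \<cdot> b" "psh C a \<delta> = pll A' c \<delta>'"
proof -
  have "\<exists>c\<in>Mor \<C> C C'. c \<cdot> y = y' \<cdot> b \<and> psh C a \<delta> = pll A' c \<delta>'"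
    using et3 assms unfolding ET3_def tri_def arr_def by blast
  then show thesis using that tri_arr[OF assms(1)] tri_arr[OF assms(2)] unfolding arr_def by auto
qed

lemma ET3_op:
  assumes "tri A x B y C \<delta>" "tri A' x' B' y' C' \<delta>'" "arr c C C'" "arr b B B'" "c \<cdot> y = y' \<cdot> b"
  obtains a where "arr a A A'" "b \<cdot> x = x' \<cdot> a" "psh C a \<delta> = pll A' c \<delta>'"
proof -
  have "\<exists>a\<in>Mor \<C> A A'. b \<cdot> x = x' \<cdot> a \<and> psh C a \<delta> = pll A' c \<delta>'"
    using et3op assms unfolding ET3_op_def tri_def arr_def by blast
  then show thesis using that tri_arr[OF assms(1)] tri_arr[OF assms(2)] unfolding arr_def by auto
qed

lemma ET4:
  assumes "tri A f B f' D \<delta>" "tri B g C g' F \<delta>'"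
  obtains E h' d e \<delta>'' where "arr h' C E" "arr d D E" "arr e E F" "ext \<delta>'' E A"
    "h' \<cdot> g = d \<cdot> f'" "e \<cdot> h' = g'" "tri A (g \<cdot> f) C h' E \<delta>''" "tri D d E e F (psh F f' \<delta>')"
    "pll A d \<delta>'' = \<delta>" "psh E f \<delta>'' = pll B e \<delta>'"
proof -
  obtain E h' d e \<delta>'' where E: "E\<in>Obj \<C>" "h'\<in>Mor \<C> C E" "d\<in>Mor \<C> D E" "e\<in>Mor \<C> E F"
     "\<delta>''\<in>carrier (Ext \<C> E A)"
    "h' \<cdot> g = d \<cdot> f'" "e \<cdot> h' = g'" "tri A (g \<cdot> f) C h' E \<delta>''" "tri D d E e F (psh F f' \<delta>')"
    "pll A d \<delta>'' = \<delta>" "psh E f \<delta>'' = pll B e \<delta>'"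
    using et4 assms unfolding ET4_def tri_def by metis
  show thesis
    by (rule that[OF tri_arr(2)[OF E(8)] tri_arr(1,2)[OF E(9)] tri_arr(3)[OF E(8)] E(6-11)])
qed

lemma ET4_op:
  assumes "tri D f' B f A \<delta>" "tri F g' C g B \<delta>'"
  obtains E h' d e \<delta>'' where "arr h' E C" "arr d E D" "arr e F E" "ext \<delta>'' A E"
    "g \<cdot> h' = f' \<cdot> d" "h' \<cdot> e = g'" "tri E h' C (f \<cdot> g) A \<delta>''" "tri F e E d D (pll F f' \<delta>')"
    "psh A d \<delta>'' = \<delta>" "pll E f \<delta>'' = psh B e \<delta>'"
proof -
  obtain E h' d e \<delta>'' where E: "E\<in>Obj \<C>" "h'\<in>Mor \<C> E C" "d\<in>Mor \<C> E D" "e\<in>Mor \<C> F E"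
     "\<delta>''\<in>carrier (Ext \<C> A E)"
    "g \<cdot> h' = f' \<cdot> d" "h' \<cdot> e = g'" "tri E h' C (f \<cdot> g) A \<delta>''" "tri F e E d D (pll F f' \<delta>')"
    "psh A d \<delta>'' = \<delta>" "pll E f \<delta>'' = psh B e \<delta>'"
    using et4op assms unfolding ET4_op_def tri_def by metis
  show thesis
    by (rule that[OF tri_arr(1)[OF E(8)] tri_arr(2,1)[OF E(9)] tri_arr(3)[OF E(8)] E(6-11)])
qed

lemma biprod_tri:
  assumes "biproduct \<C> A C S i i' p p'" shows "tri A i S p' C (ze C A)"
proof -
  have a: "A \<in> Obj \<C>" "C \<in> Obj \<C>" "S \<in> Obj \<C>" "i \<in> Mor \<C> A S" "p' \<in> Mor \<C> S C"
    using assms unfolding biproduct_def by auto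
  then have a': "arr i A S" "arr p' S C" by (auto simp: arr_def)
  have R: "Rlz \<C> C A (ze C A) = seq_equiv \<C> A C `` {(S, i, p')}"
    using add_real assms unfolding is_additive_realization_def by (elim conjE) blast
  have "isomorphism \<C> S S (Id S)"
    unfolding isomorphism_def using id_arr[of S] id_left[of "Id S" S S] a arr_mor by metis
  then have "((S, i, p'), (S, i, p')) \<in> seq_equiv \<C> A C"
    using a id_left[OF a'(1)] id_right[OF a'(2)] by (auto simp: seq_equiv_def seqs_def)
  then show ?thesis using R a ze_ext[of C A] by (auto simp: tri_def etriangles_def ext_def)
qed

text \<open>An isomorphism exhibits its target as the biproduct of its source with the zero object,
  and biproducts realize the zero extension.\<close>

lemma iso_tri:
  assumes "arr b A B" "arr b' B A" "b' \<cdot> b = Id A" "b \<cdot> b' = Id B"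
  shows "tri A b B (zr B Zo) Zo (ze Zo A)"
proof (rule biprod_tri)
  note o = arr_obj[OF assms(1)]
  have i: "arr (Id B) B B" using o by blast
  show "biproduct \<C> A Zo B b (zr Zo B) b' (zr B Zo)"
    unfolding biproduct_def using assms o arr_mor[OF zr_arr] arr_mor[OF assms(1)] arr_mor[OF assms(2)]
     comp_zr_left[OF assms(1), of Zo] comp_zr_right[OF assms(2), of Zo] to_Zo[of "Id Zo" Zo]
     comp_zr_right[of "zr Zo B" Zo B B]  comp_zr_right[of "zr B Zo" B Zo Zo] sum_zr(1)[OF i] by auto
qed

lemma iso_tri':
  assumes "arr b A B" "arr b' B A" "b' \<cdot> b = Id A" "b \<cdot> b' = Id B"
  shows "tri Zo (zr Zo A) A b B (ze B Zo)"
proof (rule biprod_tri)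
  note o = arr_obj[OF assms(1)]
  have i: "arr (Id A) A A" using o by blast
  show "biproduct \<C> Zo B A (zr Zo A) b' (zr A Zo) b"
    unfolding biproduct_def using assms o arr_mor[OF zr_arr] arr_mor[OF assms(1)] arr_mor[OF assms(2)]
     comp_zr_left[OF assms(2), of Zo] comp_zr_right[OF assms(1), of Zo] to_Zo[of "Id Zo" Zo]
     comp_zr_right[of "zr Zo A" Zo A A]  comp_zr_right[of "zr A Zo" A Zo Zo] sum_zr(2)[OF i] by auto
qed

lemma id_tri: "A \<in> Obj \<C> \<Longrightarrow> tri A (Id A) A (zr A Zo) Zo (ze Zo A)"
  and id_tri': "A \<in> Obj \<C> \<Longrightarrow> tri Zo (zr Zo A) A (Id A) A (ze A Zo)"
  using iso_tri[of "Id A" A A "Id A"] iso_tri'[of "Id A" A A "Id A"] id_left[of "Id A" A A] by auto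

section \<open>Exactness properties of a single triangle\<close>

context
  fixes A x B y C \<delta>
  assumes t: "tri A x B y C \<delta>"
begin

lemma tri_obj: "A \<in> Obj \<C>" "B \<in> Obj \<C>" "C \<in> Obj \<C>"
  using tri_arr[OF t] arr_obj by blast+

text \<open>\<open>ET3\<close>, applied from the triangle of \<open>Id A\<close>, factors the
  composite through the zero object.\<close>

lemma tri_comp: "y \<cdot> x = zr A C"
proof -
  note a = tri_arr[OF t]
  note o = tri_obj
  obtain c where c: "arr c Zo C" "c \<cdot> zr A Zo = y \<cdot> x"
    by (rule ET3[OF id_tri[OF o(1)] t id_arr[OF o(1)] a(1)]) (auto simp: o)
  then show ?thesis using comp_zr_right[OF c(1) o(1)] by simp
qed

text \<open>\<open>ET3\<close> towards the triangle of \<open>Id B\<close> turns the pushed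
  extension into a pullback of the zero extension of the zero object.\<close>

lemma tri_push: "psh C x \<delta> = ze C B"
proof -
  note a = tri_arr[OF t]
  note o = tri_obj
  obtain c where c: "arr c C Zo" "psh C x \<delta> = pll B c (ze Zo B)"
    by (rule ET3[OF t id_tri[OF o(2)] a(1) id_arr[OF o(2)] refl])
  then show ?thesis using pull_ze o by metis
qed

lemma tri_pull: "pll A y \<delta> = ze B A"
proof -
  note a = tri_arr[OF t]
  note o = tri_obj
  obtain c where c: "arr c Zo A" "psh B c (ze B Zo) = pll A y \<delta>"
    by (rule ET3_op[OF id_tri'[OF o(2)] t a(2) id_arr[OF o(2)] refl])
  then show ?thesis using push_ze o by metis
qed

text \<open>The hypothesis says that \<open>u\<close> and the zero map form a morphism of extensions
  to the triangle of \<open>Id D\<close>; the middle map of a realization is the required extension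
  of \<open>u\<close>.\<close>

lemma extend:
  assumes "arr u A D" "psh C u \<delta> = ze C D"
  obtains v where "arr v B D" "v \<cdot> x = u"
proof -
  note o = tri_obj
  have D: "D \<in> Obj \<C>" using assms arr_obj by blast
  have "psh C u \<delta> = pll D (zr C Zo) (ze Zo D)" using assms(2) pull_ze[OF D zr_arr[OF o(3) Zo_obj]] by simp
  then obtain v where "arr v B D" "v \<cdot> x = Id D \<cdot> u"
    by (rule realize_mor[OF t id_tri[OF D] assms(1) zr_arr[OF o(3) Zo_obj]])
  then show thesis using that id_left[OF assms(1)] by simp
qed

lemma lift:
  assumes "arr u D C" "pll A u \<delta> = ze D A"
  obtains v where "arr v D B" "y \<cdot> v = u"
proof -
  note o = tri_obj
  have D: "D \<in> Obj \<C>" using assms arr_obj by blast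
  have "psh D (zr Zo A) (ze D Zo) = pll A u \<delta>" using assms(2) push_ze[OF D zr_arr[OF Zo_obj o(1)]] by simp
  then obtain v where "arr v D B" "y \<cdot> v = u \<cdot> Id D"
    by (rule realize_mor[OF id_tri'[OF D] t zr_arr[OF Zo_obj o(1)] assms(1)])
  then show thesis using that id_right[OF assms(1)] by simp
qed

lemma extend_push: assumes "arr v B D" shows "psh C (v \<cdot> x) \<delta> = ze C D"
  using push_comp[OF tri_arr(3)[OF t] tri_arr(1)[OF t] assms] tri_push push_ze[OF tri_obj(3) assms] by simp

lemma lift_pull: assumes "arr v D B" shows "pll A (y \<cdot> v) \<delta> = ze D A"
  using pull_comp[OF tri_arr(3)[OF t] tri_arr(2)[OF t] assms] tri_pull pull_ze[OF tri_obj(1) assms] by simp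

text \<open>\<open>y\<close> is a weak cokernel of \<open>x\<close>: the given map and the zero map
  on \<open>A\<close> compare the triangle with \<open>0 \<rightarrow> D \<rightarrow> D\<close>,
  and \<open>ET3\<close> supplies the third component. No uniqueness of \<open>v\<close> is
  claimed.\<close>

lemma coker_factor:
  assumes "arr w B D" "w \<cdot> x = zr A D"
  obtains v where "arr v C D" "w = v \<cdot> y"
proof -
  note o = tri_obj
  have D: "D \<in> Obj \<C>" using assms arr_obj by blast
  have "w \<cdot> x = zr Zo D \<cdot> zr A Zo" using assms(2) comp_zr_right[OF zr_arr[OF Zo_obj D]] o by simp
  then obtain v where "arr v C D" "v \<cdot> y = Id D \<cdot> w"
    by (rule ET3[OF t id_tri'[OF D] zr_arr[OF o(1) Zo_obj] assms(1)])
  then show thesis using that id_left[OF assms(1)] by simp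
qed

lemma ker_factor:
  assumes "arr w D B" "y \<cdot> w = zr D C"
  obtains v where "arr v D A" "w = x \<cdot> v"
proof -
  note o = tri_obj
  have D: "D \<in> Obj \<C>" using assms arr_obj by blast
  have "zr Zo C \<cdot> zr D Zo = y \<cdot> w" using assms(2) comp_zr_right[OF zr_arr[OF Zo_obj o(3)]] D by simp
  then obtain v where "arr v D A" "w \<cdot> Id D = x \<cdot> v"
    by (rule ET3_op[OF id_tri[OF D] t zr_arr[OF Zo_obj o(3)] assms(1)])
  then show thesis using that id_right[OF assms(1)] by simp
qed

text \<open>Exactness of \<open>\<C>(A, D) \<rightarrow> \<E>(C, D) \<rightarrow> \<E>(B, D)\<close>
  in the middle: \<open>y\<close> lifts through the deflation of a realization of \<eta>, and
  \<open>ET3_op\<close> yields the map between the first terms.\<close>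

lemma pull_zero_imp_push:
  assumes "ext \<eta> C D" "pll D y \<eta> = ze B D"
  obtains u where "arr u A D" "psh C u \<delta> = \<eta>"
proof -
  note o = tri_obj
  obtain F f f' where s: "tri D f F f' C \<eta>" using tri_realize[OF assms(1)] .
  obtain k where k: "arr k B F" "f' \<cdot> k = y"
    using extri_cat.lift[OF extri_cat_axioms s tri_arr(2)[OF t] assms(2)] .
  have "Id C \<cdot> y = f' \<cdot> k" using k id_left[OF tri_arr(2)[OF t]] by simp
  then obtain u where "arr u A D" "psh C u \<delta> = pll D (Id C) \<eta>"
    by (rule ET3_op[OF t s id_arr[OF o(3)] k(1)])
  then show thesis using that pull_id[OF assms(1)] by simp
qed

lemma push_zero_imp_pull:
  assumes "ext \<eta> D A" "psh D x \<eta> = ze D B"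
  obtains u where "arr u D C" "pll A u \<delta> = \<eta>"
proof -
  note o = tri_obj
  obtain F f f' where s: "tri A f F f' D \<eta>" using tri_realize[OF assms(1)] .
  obtain k where k: "arr k F B" "k \<cdot> f = x"
    using extri_cat.extend[OF extri_cat_axioms s tri_arr(1)[OF t] assms(2)] .
  have "k \<cdot> f = x \<cdot> Id A" using k id_right[OF tri_arr(1)[OF t]] by simp
  then obtain u where "arr u D C" "psh D (Id A) \<eta> = pll A u \<delta>"
    by (rule ET3[OF s t id_arr[OF o(1)] k(1)])
  then show thesis using that push_id[OF assms(1)] by simp
qed

text \<open>
  \<open>ET4\<close> for the given triangle and a realization of \<open>\<eta>\<close> produces a split triangle; the lift is the
  pullback of the extension \<open>\<delta>''\<close> along a section of it.
\<close>

lemma push_zero_lift: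
  assumes "ext \<eta> D B" "psh D y \<eta> = ze D C"
  obtains \<theta> where "ext \<theta> D A" "psh D x \<theta> = \<eta>"
proof -
  obtain F g g' where s: "tri B g F g' D \<eta>" using tri_realize[OF assms(1)] .
  obtain E h' d e \<delta>'' where E: "arr h' F E" "arr d C E" "arr e E D" "ext \<delta>'' E A"
    "tri C d E e D (psh D y \<eta>)" "psh E x \<delta>'' = pll B e \<eta>"
    by (rule ET4[OF t s])
  have D: "D \<in> Obj \<C>" using ext_obj assms by blast
  have tt: "tri C d E e D (ze D C)" using E(5) assms(2) by simp
  obtain \<sigma> where \<sigma>: "arr \<sigma> D E" "e \<cdot> \<sigma> = Id D"
    using extri_cat.lift[OF extri_cat_axioms tt id_arr[OF D]] pull_id[of "ze D C" D C] D tri_obj by auto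
  have "psh D x (pll A \<sigma> \<delta>'') = pll B \<sigma> (pll B e \<eta>)"
    using push_pull[OF E(4) \<sigma>(1) tri_arr(1)[OF t]] E(6) by simp
  also have "\<dots> = \<eta>" using pull_comp[OF assms(1) E(3) \<sigma>(1)] \<sigma>(2) pull_id[OF assms(1)] by simp
  finally show thesis using that pull_ext[OF E(4) \<sigma>(1)] by blast
qed

end

text \<open>The section is prescribed and the projection has to fit it: \<open>Id B\<close> minus
  \<open>s\<close> after \<open>y\<close> is killed by \<open>y\<close>, hence factors as
  \<open>x\<close> after \<open>p\<close>. The retraction \<open>r\<close> only serves to cancel
  \<open>x\<close>; unlike \<open>p\<close>, it need not vanish on \<open>s\<close>.\<close>

lemma split_biproduct:
  assumes t: "tri A x B y C (ze C A)" and s: "arr s C B" "y \<cdot> s = Id C"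
  obtains p where "arr p B A" "biproduct \<C> A C B x s p y"
proof -
  note o = tri_obj[OF t]
  note a = tri_arr[OF t]
  have "psh C (Id A) (ze C A) = ze C A" using push_id o by blast
  then obtain r where r: "arr r B A" "r \<cdot> x = Id A" by (rule extend[OF t id_arr[OF o(1)]])
  have sy: "arr (s \<cdot> y) B B" using s(1) a(2) by (simp add: csimps)
  obtain w where w: "arr w B B" "Id B = w \<otimes>\<^bsub>Hom \<C> B B\<^esub> (s \<cdot> y)"
    using diff_arr[OF id_arr[OF o(2)] sy] .
  have "y = y \<cdot> (w \<otimes>\<^bsub>Hom \<C> B B\<^esub> (s \<cdot> y))" using w id_right[OF a(2)] by simp
  also have "\<dots> = (y \<cdot> w) \<otimes>\<^bsub>Hom \<C> B C\<^esub> (y \<cdot> (s \<cdot> y))" by (rule comp_sum_right[OF w(1) sy a(2)])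
  also have "y \<cdot> (s \<cdot> y) = y" using assoc[OF a(2) s(1) a(2)] s(2) id_left[OF a(2)] by simp
  finally have "y = y \<cdot> w \<otimes>\<^bsub>Hom \<C> B C\<^esub> y" .
  then have "y \<cdot> w = zr B C"
    by (rule arr_cancel[OF comp_arr[OF w(1) a(2)] a(2)])
  then obtain p where p: "arr p B A" "w = x \<cdot> p" using ker_factor[OF t w(1)] by blast
  have one: "Id B = (x \<cdot> p) \<otimes>\<^bsub>Hom \<C> B B\<^esub> (s \<cdot> y)" using w p by simp
  have xp: "arr (x \<cdot> p) B B" using p(1) a(1) by (simp add: csimps)
  have "x = ((x \<cdot> p) \<otimes>\<^bsub>Hom \<C> B B\<^esub> (s \<cdot> y)) \<cdot> x" using one id_left[OF a(1)] by simp
  also have "\<dots> = ((x \<cdot> p) \<cdot> x) \<otimes>\<^bsub>Hom \<C> A B\<^esub> ((s \<cdot> y) \<cdot> x)" by (rule comp_sum_left[OF a(1) xp sy])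
  also have "(s \<cdot> y) \<cdot> x = zr A B"
    using assoc[OF a(1) a(2) s(1)] tri_comp[OF t] comp_zr_right[OF s(1) o(1)] by simp
  finally have "x = x \<cdot> (p \<cdot> x)" using sum_zr(1)[OF comp_arr[OF a(1) xp]] assoc[OF a(1) p(1) a(1)] by simp
  then have "r \<cdot> x = (r \<cdot> x) \<cdot> (p \<cdot> x)" using assoc[OF comp_arr[OF a(1) p(1)] a(1) r(1)] by simp
  then have px: "p \<cdot> x = Id A" using r id_left[OF comp_arr[OF a(1) p(1)]] by simp
  have "s = ((x \<cdot> p) \<otimes>\<^bsub>Hom \<C> B B\<^esub> (s \<cdot> y)) \<cdot> s" using one id_left[OF s(1)] by simp
  also have "\<dots> = ((x \<cdot> p) \<cdot> s) \<otimes>\<^bsub>Hom \<C> C B\<^esub> ((s \<cdot> y) \<cdot> s)" by (rule comp_sum_left[OF s(1) xp sy])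
  also have "(s \<cdot> y) \<cdot> s = s" using assoc[OF s(1) a(2) s(1)] s(2) id_right[OF s(1)] by simp
  finally have "(x \<cdot> p) \<cdot> s = zr C B"
    by (rule arr_cancel[OF comp_arr[OF s(1) xp] s(1)])
  then have "x \<cdot> (p \<cdot> s) = zr C B" using assoc[OF s(1) p(1) a(1)] by simp
  then have "p \<cdot> (x \<cdot> (p \<cdot> s)) = zr C A" using comp_zr_right[OF p(1) o(3)] by simp
  then have ps: "p \<cdot> s = zr C A"
    using assoc[OF comp_arr[OF s(1) p(1)] a(1) p(1)] px id_left[OF comp_arr[OF s(1) p(1)]] by simp
  show thesis
  proof (rule that[OF p(1)])
    show "biproduct \<C> A C B x s p y"
      unfolding biproduct_def using o a p(1) s px ps one tri_comp[OF t] by (auto simp: arr_def)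
  qed
qed

lemma biproduct_swap:
  assumes b: "biproduct \<C> A B S i i' p p'" shows "biproduct \<C> B A S i' i p' p"
proof -
  have a: "S \<in> Obj \<C>" "arr i A S" "arr i' B S" "arr p S A" "arr p' S B"
    using b by (simp_all add: biproduct_def arr_def)
  have "(i \<cdot> p) \<otimes>\<^bsub>Hom \<C> S S\<^esub> (i' \<cdot> p') = (i' \<cdot> p') \<otimes>\<^bsub>Hom \<C> S S\<^esub> (i \<cdot> p)"
    by (rule comm_monoid.m_comm[OF comm_group.axioms(1)[OF hom_comm_group[OF a(1) a(1)]]
        arr_mor[OF comp_arr[OF a(4,2)]] arr_mor[OF comp_arr[OF a(5,3)]]])
  with b show ?thesis by (simp add: biproduct_def)
qed

text \<open>
  \<open>A \<rightarrow> F \<rightarrow> C2\<close> is another realization of \<open>\<delta>2\<close>; it cannot be taken equal to the given one without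
  first transporting triangles along isomorphisms of their end terms.
\<close>

lemma pushout:
  assumes t1: "tri A x1 B1 y1 C1 \<delta>1" and t2: "tri A x2 B2 y2 C2 \<delta>2"
  obtains M m m' F e d h k where "tri B1 m M m' C2 (psh C2 x1 \<delta>2)" "tri A e F d C2 \<delta>2"
    "tri F h M k C1 (psh C1 e \<delta>1)"
proof -
  note a1 = tri_arr[OF t1] and a2 = tri_arr[OF t2] and o1 = tri_obj[OF t1] and o2 = tri_obj[OF t2]
  obtain M m m' where tm: "tri B1 m M m' C2 (psh C2 x1 \<delta>2)"
    using tri_realize[OF push_ext[OF a2(3) a1(1)]] .
  obtain E h' d e \<delta>'' where E: "arr h' M E" "arr d C1 E" "arr e E C2" "ext \<delta>'' E A"
    "h' \<cdot> m = d \<cdot> y1" "e \<cdot> h' = m'" "tri A (m \<cdot> x1) M h' E \<delta>''"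
    "tri C1 d E e C2 (psh C2 y1 (psh C2 x1 \<delta>2))"
    "pll A d \<delta>'' = \<delta>1" "psh E x1 \<delta>'' = pll B1 e (psh C2 x1 \<delta>2)"
    by (rule ET4[OF t1 tm])
  have "psh C2 y1 (psh C2 x1 \<delta>2) = ze C2 C1"
    using push_comp[OF a2(3) a1(1,2)] tri_comp[OF t1] push_zr[OF a2(3) o1(3)] by simp
  with E(8) have tE: "tri C1 d E e C2 (ze C2 C1)" by simp
  have oE: "E \<in> Obj \<C>" using E(1) arr_obj by blast
  have "pll C1 (Id C2) (ze C2 C1) = ze C2 C1" using pull_id o1 o2 by blast
  \<comment> \<open>Pulling \<open>\<delta>''\<close> back along an arbitrary section gives
    \<open>\<delta>2\<close> only up to a summand \<omega> killed by pushing along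
    \<open>x1\<close>. So \<omega> is a pullback of \<open>\<delta>1\<close> along some
    \<open>t\<close>, and subtracting \<open>d \<cdot> t\<close> from the section removes it.
    Because \<open>e\<close> kills \<open>d\<close>, the result is still a section.\<close>
  then obtain s0 where s0: "arr s0 C2 E" "e \<cdot> s0 = Id C2" by (rule lift[OF tE id_arr[OF o2(3)]])
  have x0: "ext (pll A s0 \<delta>'') C2 A" using pull_ext[OF E(4) s0(1)] .
  obtain \<omega> where w: "ext \<omega> C2 A" "pll A s0 \<delta>'' = \<omega> \<otimes>\<^bsub>Ext \<C> C2 A\<^esub> \<delta>2" using diff_ext[OF x0 a2(3)] .
  have "psh C2 x1 (pll A s0 \<delta>'') = pll B1 s0 (pll B1 e (psh C2 x1 \<delta>2))"
    using push_pull[OF E(4) s0(1) a1(1)] E(10) by simp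
  also have "\<dots> = psh C2 x1 \<delta>2"
    using pull_comp[OF push_ext[OF a2(3) a1(1)] E(3) s0(1)] s0(2) pull_id[OF push_ext[OF a2(3) a1(1)]] by simp
  finally have "psh C2 x1 \<delta>2 = psh C2 x1 \<omega> \<otimes>\<^bsub>Ext \<C> C2 B1\<^esub> psh C2 x1 \<delta>2"
    using w push_add[OF w(1) a2(3) a1(1)] by simp
  then have "psh C2 x1 \<omega> = ze C2 B1" by (rule ext_cancel[OF push_ext[OF w(1) a1(1)] push_ext[OF a2(3) a1(1)]])
  then obtain t where t: "arr t C2 C1" "pll A t \<delta>1 = \<omega>" by (rule push_zero_imp_pull[OF t1 w(1)])
  have dt: "arr (d \<cdot> t) C2 E" using t(1) E(2) by (simp add: csimps)
  obtain s where s: "arr s C2 E" "s0 = s \<otimes>\<^bsub>Hom \<C> C2 E\<^esub> (d \<cdot> t)" using diff_arr[OF s0(1) dt] .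
  have "pll A (d \<cdot> t) \<delta>'' = \<omega>" using pull_comp[OF E(4) E(2) t(1)] E(9) t(2) by simp
  then have "\<omega> \<otimes>\<^bsub>Ext \<C> C2 A\<^esub> \<delta>2 = pll A s \<delta>'' \<otimes>\<^bsub>Ext \<C> C2 A\<^esub> \<omega>"
    using pull_sum[OF E(4) s(1) dt] s(2) w(2) by simp
  moreover have "comm_group (Ext \<C> C2 A)" using ext_comm_group o1 o2 by blast
  moreover have "ext (pll A s \<delta>'') C2 A" using pull_ext[OF E(4) s(1)] .
  ultimately have sd: "pll A s \<delta>'' = \<delta>2"
    using comm_monoid.m_comm[OF comm_group.axioms(1), of "Ext \<C> C2 A" \<omega> \<delta>2] w(1) a2(3)
      group.right_cancel[OF ext_group, of C2 A \<omega> "pll A s \<delta>''" \<delta>2] by (simp add: ext_def)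
  have "Id C2 = (e \<cdot> s) \<otimes>\<^bsub>Hom \<C> C2 C2\<^esub> (e \<cdot> (d \<cdot> t))" using s0(2) s(2) comp_sum_right[OF s(1) dt E(3)] by simp
  moreover have "e \<cdot> (d \<cdot> t) = zr C2 C2"
    using assoc[OF t(1) E(2,3)] tri_comp[OF tE] comp_zr_left[OF t(1) o2(3)] by simp
  ultimately have es: "e \<cdot> s = Id C2" using sum_zr(1)[OF comp_arr[OF s(1) E(3)]] by simp
  obtain r where r: "arr r E C1" "biproduct \<C> C1 C2 E d s r e" using split_biproduct[OF tE s(1) es] .
  have tr: "tri C2 s E r C1 (ze C1 C2)" using biprod_tri[OF biproduct_swap[OF r(2)]] .
  \<comment> \<open>The split triangle \<open>C2 \<rightarrow> E \<rightarrow> C1\<close> is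
    composed with \<open>M \<rightarrow> E\<close>. The object \<open>F\<close> that takes the place
    of the kernel of \<open>M \<rightarrow> C1\<close> is an extension of \<open>C2\<close> by
    \<open>A\<close> whose class is the pullback of \<open>\<delta>''\<close> along
    \<open>s\<close>, that is \<open>\<delta>2\<close>.\<close>
  obtain F h d' e' \<delta>3 where F: "arr h F M" "arr d' F C2" "arr e' A F" "ext \<delta>3 C1 F"
    "tri F h M (r \<cdot> h') C1 \<delta>3" "tri A e' F d' C2 (pll A s \<delta>'')"
    "pll F r \<delta>3 = psh E e' \<delta>''"
    by (rule ET4_op[OF tr E(7)])
  have "\<delta>3 = pll F d (pll F r \<delta>3)"
    using pull_comp[OF F(4) r(1) E(2)] r(2) pull_id[OF F(4)] unfolding biproduct_def by simp
  also have "\<dots> = psh C1 e' \<delta>1" using F(7) push_pull[OF E(4,2) F(3)] E(9) by simp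
  finally have "tri F h M (r \<cdot> h') C1 (psh C1 e' \<delta>1)" using F(5) by simp
  then show thesis using that tm F(6) sd by simp
qed

end

section \<open>The opposite category\<close>

text \<open>The dual lives in the same record type over the same objects, arrows and extensions, so
  a fact about every \<open>extri_cat\<close> or \<open>proper_cat\<close> can be instantiated with
  it and simplified back.\<close>

definition opc :: "('o, 'm, 'e) ext_cat \<Rightarrow> ('o, 'm, 'e) ext_cat" where
  "opc \<C> = \<lparr>Obj = Obj \<C>, Hom = (\<lambda>A B. Hom \<C> B A), Ident = Ident \<C>,
     Comp = (\<lambda>g f. Comp \<C> f g), Ext = (\<lambda>C A. Ext \<C> A C), EMap = (\<lambda>c a. EMap \<C> a c),
     Rlz = (\<lambda>C A \<delta>. (\<lambda>(B, x, y). (B, y, x)) ` Rlz \<C> A C \<delta>)\<rparr>"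

definition opt :: "('o, 'm, 'e) etri set \<Rightarrow> ('o, 'm, 'e) etri set" where
  "opt T = {(A, x, B, y, C, \<delta>). (C, y, B, x, A, \<delta>) \<in> T}"

lemma opc_simps [simp]:
  "Obj (opc \<C>) = Obj \<C>" "Hom (opc \<C>) A B = Hom \<C> B A" "Ident (opc \<C>) = Ident \<C>"
  "Comp (opc \<C>) = (\<lambda>g f. Comp \<C> f g)" "Ext (opc \<C>) C A = Ext \<C> A C" "EMap (opc \<C>) c a = EMap \<C> a c"
  "Rlz (opc \<C>) C A \<delta> = (\<lambda>(B, x, y). (B, y, x)) ` Rlz \<C> A C \<delta>"
  by (simp_all add: opc_def)

lemma opt_iff [simp]: "(A, x, B, y, C, \<delta>) \<in> opt T \<longleftrightarrow> (C, y, B, x, A, \<delta>) \<in> T"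
  by (simp add: opt_def)

lemma push_op [simp]: "push (opc \<C>) C a \<delta> = pull \<C> C a \<delta>"
  and pull_op [simp]: "pull (opc \<C>) C a \<delta> = push \<C> C a \<delta>"
  by (simp_all add: push_def pull_def)

lemma etriangles_op [simp]: "etriangles (opc \<C>) = opt (etriangles \<C>)"
  by (auto simp: etriangles_def opt_def image_iff split: prod.splits)

lemma biproduct_op [simp]: "biproduct (opc \<C>) A A' S i i' p p' \<longleftrightarrow> biproduct \<C> A A' S p p' i i'"
  by (auto simp: biproduct_def)

lemma isomorphism_op [simp]: "isomorphism (opc \<C>) A B f \<longleftrightarrow> isomorphism \<C> B A f"
  by (auto simp: isomorphism_def)

lemma zero_object_op [simp]: "zero_object (opc \<C>) Z \<longleftrightarrow> zero_object \<C> Z"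
  by (auto simp: zero_object_def)

lemma ext_morphism_op [simp]:
  "ext_morphism (opc \<C>) C A \<delta> C' A' \<delta>' a c \<longleftrightarrow> ext_morphism \<C> A' C' \<delta>' A C \<delta> c a"
  by (auto simp: ext_morphism_def)

lemma etri_morphism_op [simp]:
  "etri_morphism (opc \<C>) (A, x, B, y, C, \<delta>) (A', x', B', y', C', \<delta>') a b c \<longleftrightarrow>
   etri_morphism \<C> (C', y', B', x', A', \<delta>') (C, y, B, x, A, \<delta>) c b a"
  by auto

lemma etri_iso_op [simp]:
  "etri_iso (opc \<C>) (A, x, B, y, C, \<delta>) (A', x', B', y', C', \<delta>') \<longleftrightarrow>
   etri_iso \<C> (C', y', B', x', A', \<delta>') (C, y, B, x, A, \<delta>)"
  unfolding etri_iso.simps etri_morphism_op isomorphism_op by blast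

lemma hom_exact_op [simp]:
  "hom_from_exact (opc \<C>) W (A, x, B, y, C, \<delta>) \<longleftrightarrow> hom_into_exact \<C> W (C, y, B, x, A, \<delta>)"
  "hom_into_exact (opc \<C>) W (A, x, B, y, C, \<delta>) \<longleftrightarrow> hom_from_exact \<C> W (C, y, B, x, A, \<delta>)"
  by simp_all

lemma xi_projectives_op [simp]: "xi_projectives (opc \<C>) (opt \<xi>) = xi_injectives \<C> \<xi>"
  and xi_injectives_op [simp]: "xi_injectives (opc \<C>) (opt \<xi>) = xi_projectives \<C> \<xi>"
  unfolding xi_projectives_def xi_injectives_def Ball_def split_paired_All hom_exact_op opt_iff opc_simps
  by blast+

lemma enough_op [simp]:
  "enough_projectives (opc \<C>) (opt \<xi>) \<longleftrightarrow> enough_injectives \<C> \<xi>"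
  "enough_injectives (opc \<C>) (opt \<xi>) \<longleftrightarrow> enough_projectives \<C> \<xi>"
  unfolding enough_projectives_def enough_injectives_def by simp_all blast+

lemma exact_op [simp]:
  "contra_exact (opc \<C>) (opt \<xi>) W = opt (cov_exact \<C> \<xi> W)"
  "cov_exact (opc \<C>) (opt \<xi>) W = opt (contra_exact \<C> \<xi> W)"
  unfolding contra_exact_def cov_exact_def set_eq_iff split_paired_All opt_iff mem_Collect_eq hom_exact_op
  by simp_all

context extri_cat
begin

lemma is_preadditive_op: "is_preadditive (opc \<C>)"
proof -
  have "Mor \<C> B A \<inter> Mor \<C> B' A' \<noteq> {} \<longrightarrow> A = A' \<and> B = B'"
    if "A \<in> Obj \<C>" "A' \<in> Obj \<C>" "B \<in> Obj \<C>" "B' \<in> Obj \<C>" for A A' B B'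
    using that arr_unique[of _ B A B' A'] unfolding arr_def by blast
  then have "is_category (opc \<C>)"
    unfolding is_category_def
    using arr_mor[OF id_arr] comp_arr id_left id_right assoc by (simp add: arr_def)
  then show ?thesis
    unfolding is_preadditive_def using hom_comm_group comp_sum_left comp_sum_right by (simp add: arr_def)
qed

lemma is_additive_op: "is_additive (opc \<C>)"
proof -
  have "\<forall>A\<in>Obj \<C>. \<forall>A'\<in>Obj \<C>. \<exists>S i i' p p'. biproduct \<C> A A' S i i' p p'"
    using addit by (simp add: is_additive_def)
  then show ?thesis unfolding is_additive_def 
  proof (intro conjI ballI)
    fix A A' assume "A \<in> Obj (opc \<C>)" "A' \<in> Obj (opc \<C>)"
    then have "\<exists>S i i' p p'. biproduct \<C> A A' S i i' p p'"
      using \<open>\<forall>A\<in>Obj \<C>. \<forall>A'\<in>Obj \<C>. \<exists>S i i' p p'. biproduct \<C> A A' S i i' p p'\<close> by simp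
    then obtain S i i' p p' where "biproduct \<C> A A' S i i' p p'" by (elim exE)
    then have "biproduct (opc \<C>) A A' S p p' i i'" by simp
    then show "\<exists>S i i' p p'. biproduct (opc \<C>) A A' S i i' p p'" by blast
  next
    show "\<exists>Z. zero_object (opc \<C>) Z" using zero_Zo by auto
  qed (rule is_preadditive_op)
qed

lemma additive_bifunctor_op: "additive_bifunctor (opc \<C>)"
  unfolding additive_bifunctor_def
proof (intro conjI ballI)
  fix C C' C'' A A' A'' c c' a a' \<delta>
  assume *: "C \<in> Obj (opc \<C>)" "C' \<in> Obj (opc \<C>)" "C'' \<in> Obj (opc \<C>)" "A \<in> Obj (opc \<C>)" "A' \<in> Obj (opc \<C>)"
    "A'' \<in> Obj (opc \<C>)" "c \<in> Mor (opc \<C>) C' C" "c' \<in> Mor (opc \<C>) C'' C'" "a \<in> Mor (opc \<C>) A A'"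
    "a' \<in> Mor (opc \<C>) A' A''" "\<delta> \<in> carrier (Ext (opc \<C>) C A)"
  show "EMap (opc \<C>) (Comp (opc \<C>) c c') (Comp (opc \<C>) a' a) \<delta> = EMap (opc \<C>) c' a' (EMap (opc \<C>) c a \<delta>)"
    using * EMap_comp[of a A' A a' A'' c C C' c' C'' \<delta>] by (simp add: arr_def ext_def)
next
  fix C C' A A' c d a b \<delta>
  assume *: "C \<in> Obj (opc \<C>)" "C' \<in> Obj (opc \<C>)" "A \<in> Obj (opc \<C>)" "A' \<in> Obj (opc \<C>)"
    "c \<in> Mor (opc \<C>) C' C" "d \<in> Mor (opc \<C>) C' C" "a \<in> Mor (opc \<C>) A A'"
    "b \<in> Mor (opc \<C>) A A'" "\<delta> \<in> carrier (Ext (opc \<C>) C A)"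
  then show
    "EMap (opc \<C>) (c \<otimes>\<^bsub>Hom (opc \<C>) C' C\<^esub> d) a \<delta> = EMap (opc \<C>) c a \<delta> \<otimes>\<^bsub>Ext (opc \<C>) C' A'\<^esub> EMap (opc \<C>) d a \<delta>"
    "EMap (opc \<C>) c (a \<otimes>\<^bsub>Hom (opc \<C>) A A'\<^esub> b) \<delta> = EMap (opc \<C>) c a \<delta> \<otimes>\<^bsub>Ext (opc \<C>) C' A'\<^esub> EMap (opc \<C>) c b \<delta>"
    using EMap_sum[of a A' A b c C C' d \<delta>] by (simp_all add: arr_def ext_def)
next
  fix C A \<delta> assume "C \<in> Obj (opc \<C>)" "A \<in> Obj (opc \<C>)" "\<delta> \<in> carrier (Ext (opc \<C>) C A)"
  then show "EMap (opc \<C>) (Ident (opc \<C>) C) (Ident (opc \<C>) A) \<delta> = \<delta>"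
    using push_id[of \<delta> A C] by (simp add: push_def ext_def)
qed (use EMap_hom ext_comm_group in \<open>simp_all add: arr_def\<close>)

lemma isomorphism_inverse:
  assumes "isomorphism \<C> A B f" "A \<in> Obj \<C>" "B \<in> Obj \<C>"
  obtains g where "isomorphism \<C> B A g" "arr g B A" "g \<cdot> f = Id A" "f \<cdot> g = Id B"
  using assms unfolding isomorphism_def arr_def by blast

text \<open>The isomorphism of middle terms changes direction under duality, so each implication
  passes to its inverse.\<close>

lemma seq_equiv_op:
  assumes "A \<in> Obj \<C>" "C \<in> Obj \<C>"
  shows "seq_equiv (opc \<C>) A C `` {(B, x, y)} = (\<lambda>(B, x, y). (B, y, x)) ` (seq_equiv \<C> C A `` {(B, y, x)})"
proof -
  have "((B, x, y), (B', x', y')) \<in> seq_equiv (opc \<C>) A C \<longleftrightarrow> ((B, y, x), (B', y', x')) \<in> seq_equiv \<C> C A"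
    (is "?L \<longleftrightarrow> ?R") for B' x' y'
  proof
    assume ?L
    then obtain b where b: "isomorphism \<C> B' B b" "x \<cdot> b = x'" "b \<cdot> y' = y" and
      s: "B \<in> Obj \<C>" "B' \<in> Obj \<C>" "arr x B A" "arr y C B" "arr x' B' A" "arr y' C B'"
      using assms by (auto simp: seq_equiv_def seqs_def arr_def)
    obtain b' where b': "isomorphism \<C> B B' b'" "arr b' B B'" "b' \<cdot> b = Id B'" "b \<cdot> b' = Id B"
      using isomorphism_inverse[OF b(1) s(2,1)] .
    have bb: "arr b B' B" using b(1) s by (simp add: isomorphism_def arr_def)
    have "b' \<cdot> y = y'" unfolding b(3)[symmetric] using b'(2) bb s(6) by (simp add: csimps b'(3)[THEN comp_eq])
    moreover have "x' \<cdot> b' = x" unfolding b(2)[symmetric] using b'(2,4) bb s(3) by (simp add: csimps)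
    ultimately show ?R using b'(1) s by (auto simp: seq_equiv_def seqs_def arr_def)
  next
    assume ?R
    then obtain b where b: "isomorphism \<C> B B' b" "b \<cdot> y = y'" "x' \<cdot> b = x" and
      s: "B \<in> Obj \<C>" "B' \<in> Obj \<C>" "arr x B A" "arr y C B" "arr x' B' A" "arr y' C B'"
      using assms by (auto simp: seq_equiv_def seqs_def arr_def)
    obtain b' where b': "isomorphism \<C> B' B b'" "arr b' B' B" "b' \<cdot> b = Id B" "b \<cdot> b' = Id B'"
      using isomorphism_inverse[OF b(1) s(1,2)] .
    have bb: "arr b B B'" using b(1) s by (simp add: isomorphism_def arr_def)
    have "b' \<cdot> y' = y" unfolding b(2)[symmetric] using b'(2) bb s(4) by (simp add: csimps b'(3)[THEN comp_eq])
    moreover have "x \<cdot> b' = x'" unfolding b(3)[symmetric] using b'(2,4) bb s(5) by (simp add: csimps)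
    ultimately show ?L using b'(1) s by (auto simp: seq_equiv_def seqs_def arr_def)
  qed
  moreover have "(B', x', y') \<in> (\<lambda>(B, x, y). (B, y, x)) ` X \<longleftrightarrow> (B', y', x') \<in> X" for B' x' y' and X :: "('o \<times> 'm \<times> 'm) set"
    by force
  ultimately show ?thesis by (simp only: set_eq_iff split_paired_All Image_singleton_iff simp_thms)
qed

lemma is_realization_op: "is_realization (opc \<C>)"
  unfolding is_realization_def
proof (intro conjI ballI allI impI)
  fix C A \<delta> assume "C \<in> Obj (opc \<C>)" "A \<in> Obj (opc \<C>)" "\<delta> \<in> carrier (Ext (opc \<C>) C A)"
  then have o: "C \<in> Obj \<C>" "A \<in> Obj \<C>" and "Rlz \<C> A C \<delta> \<in> seqs \<C> C A // seq_equiv \<C> C A"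
    using real by (simp_all add: is_realization_def)
  then obtain B x y where s: "(B, y, x) \<in> seqs \<C> C A" "Rlz \<C> A C \<delta> = seq_equiv \<C> C A `` {(B, y, x)}"
    by (auto simp: quotient_def)
  have "(B, x, y) \<in> seqs (opc \<C>) A C" using s(1) by (auto simp: seqs_def)
  moreover have "Rlz (opc \<C>) C A \<delta> = seq_equiv (opc \<C>) A C `` {(B, x, y)}"
    using s(2) seq_equiv_op[OF o(2,1)] by simp
  ultimately show "Rlz (opc \<C>) C A \<delta> \<in> seqs (opc \<C>) A C // seq_equiv (opc \<C>) A C"
    by (auto intro: quotientI)
next
  fix A x B y C \<delta> A' x' B' y' C' \<delta>' a c
  assume "(A, x, B, y, C, \<delta>) \<in> etriangles (opc \<C>) \<and> (A', x', B', y', C', \<delta>') \<in> etriangles (opc \<C>) \<and>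
        ext_morphism (opc \<C>) C A \<delta> C' A' \<delta>' a c"
  then have *: "(C', y', B', x', A', \<delta>') \<in> etriangles \<C> \<and> (C, y, B, x, A, \<delta>) \<in> etriangles \<C> \<and>
        ext_morphism \<C> A' C' \<delta>' A C \<delta> c a" by simp
  have "\<exists>b. etri_morphism \<C> (C', y', B', x', A', \<delta>') (C, y, B, x, A, \<delta>) c b a"
    using conjunct2[OF real[unfolded is_realization_def], rule_format, OF *] .
  then show "\<exists>b. etri_morphism (opc \<C>) (A, x, B, y, C, \<delta>) (A', x', B', y', C', \<delta>') a b c"
    unfolding etri_morphism_op .
qed

text \<open>In the opposite category the triple composites that define a sum are bracketed the other
  way; the two triangle hypotheses supply the typing needed to reassociate them.\<close>

lemma etri_sum_op:
  assumes "etri_sum (opc \<C>) (A, x, B, y, C, \<delta>) (A', x', B', y', C', \<delta>') (A'', x'', B'', y'', C'', \<delta>'')"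
    and "tri C y B x A \<delta>" "tri C' y' B' x' A' \<delta>'"
  shows "etri_sum \<C> (C, y, B, x, A, \<delta>) (C', y', B', x', A', \<delta>') (C'', y'', B'', x'', A'', \<delta>'')"
proof -
  obtain iA iA' pA pA' iB iB' pB pB' iC iC' pC pC' where
    b: "biproduct \<C> A A' A'' pA pA' iA iA'" "biproduct \<C> B B' B'' pB pB' iB iB'"
        "biproduct \<C> C C' C'' pC pC' iC iC'" and
    e: "x'' = ((pA \<cdot> x) \<cdot> iB) \<otimes>\<^bsub>Hom \<C> B'' A''\<^esub> ((pA' \<cdot> x') \<cdot> iB')"
        "y'' = ((pB \<cdot> y) \<cdot> iC) \<otimes>\<^bsub>Hom \<C> C'' B''\<^esub> ((pB' \<cdot> y') \<cdot> iC')"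
        "\<delta>'' = EMap \<C> iA pC \<delta> \<otimes>\<^bsub>Ext \<C> A'' C''\<^esub> EMap \<C> iA' pC' \<delta>'"
    using assms(1) by auto
  have m: "arr pA A A''" "arr pA' A' A''" "arr iA A'' A" "arr iA' A'' A'"
     "arr pB B B''" "arr pB' B' B''" "arr iB B'' B" "arr iB' B'' B'"
     "arr pC C C''" "arr pC' C' C''" "arr iC C'' C" "arr iC' C'' C'"
    using b by (simp_all add: biproduct_def arr_def)
  note t = tri_arr[OF assms(2)] tri_arr[OF assms(3)]
  have e': "x'' = (pA \<cdot> x \<cdot> iB) \<otimes>\<^bsub>Hom \<C> B'' A''\<^esub> (pA' \<cdot> x' \<cdot> iB')"
        "y'' = (pB \<cdot> y \<cdot> iC) \<otimes>\<^bsub>Hom \<C> C'' B''\<^esub> (pB' \<cdot> y' \<cdot> iC')"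
    unfolding e using m t by (simp_all add: csimps)
  show ?thesis unfolding etri_sum.simps using b e' e(3) by blast
qed

lemma is_additive_realization_op: "is_additive_realization (opc \<C>)"
  unfolding is_additive_realization_def
proof (intro conjI allI impI ballI)
  show "is_realization (opc \<C>)" by (rule is_realization_op)
next
  fix A C S i i' p p' assume "biproduct (opc \<C>) A C S i i' p p'"
  then have b: "biproduct \<C> C A S p' p i' i" using biproduct_swap by simp
  then have "Rlz \<C> A C (ze A C) = seq_equiv \<C> C A `` {(S, p', i)}"
    using add_real by (simp add: is_additive_realization_def)
  moreover have "A \<in> Obj \<C>" "C \<in> Obj \<C>" using b by (simp_all add: biproduct_def)
  ultimately show "Rlz (opc \<C>) C A \<one>\<^bsub>Ext (opc \<C>) C A\<^esub> = seq_equiv (opc \<C>) A C `` {(S, i, p')}"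
    by (simp add: seq_equiv_op)
next
  fix t t' t'' assume t: "t \<in> etriangles (opc \<C>)" "t' \<in> etriangles (opc \<C>)" "etri_sum (opc \<C>) t t' t''"
  obtain A x B y C \<delta> A' x' B' y' C' \<delta>' A'' x'' B'' y'' C'' \<delta>'' where
    [simp]: "t = (A, x, B, y, C, \<delta>)" "t' = (A', x', B', y', C', \<delta>')" "t'' = (A'', x'', B'', y'', C'', \<delta>'')"
    by (metis prod.exhaust)
  have tt: "(C, y, B, x, A, \<delta>) \<in> etriangles \<C>" "(C', y', B', x', A', \<delta>') \<in> etriangles \<C>" using t by simp_all
  have "etri_sum \<C> (C, y, B, x, A, \<delta>) (C', y', B', x', A', \<delta>') (C'', y'', B'', x'', A'', \<delta>'')"
    using etri_sum_op[of A x B y C \<delta> A' x' B' y' C' \<delta>' A'' x'' B'' y'' C'' \<delta>''] t(3) tt unfolding tri_def by simp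
  then have "(C'', y'', B'', x'', A'', \<delta>'') \<in> etriangles \<C>"
    using conjunct2[OF conjunct2[OF add_real[unfolded is_additive_realization_def]]] tt by blast
  then show "t'' \<in> etriangles (opc \<C>)" by simp
qed

lemma ET3_opc: "Defs.ET3 (opc \<C>)"
  unfolding ET3_def
proof (intro allI ballI impI)
  fix A x B y C \<delta> A' x' B' y' C' \<delta>' a b
  assume *: "a \<in> Mor (opc \<C>) A A'" "b \<in> Mor (opc \<C>) B B'"
    "(A, x, B, y, C, \<delta>) \<in> etriangles (opc \<C>) \<and> (A', x', B', y', C', \<delta>') \<in> etriangles (opc \<C>) \<and>
     Comp (opc \<C>) b x = Comp (opc \<C>) x' a"
  then have t: "tri C y B x A \<delta>" "tri C' y' B' x' A' \<delta>'" by (simp_all add: tri_def)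
  have ab: "arr a A' A" "arr b B' B" "a \<cdot> x' = x \<cdot> b"
    using * tri_obj[OF t(1)] tri_obj[OF t(2)] by (simp_all add: arr_def)
  obtain c where "arr c C' C" "b \<cdot> y' = y \<cdot> c" "psh A' c \<delta>' = pll C a \<delta>"
    by (rule ET3_op[OF t(2,1) ab])
  then show "\<exists>c\<in>Mor (opc \<C>) C C'. Comp (opc \<C>) c y = Comp (opc \<C>) y' b \<and> push (opc \<C>) C a \<delta> = pull (opc \<C>) A' c \<delta>'"
    by (auto simp: arr_def intro!: bexI[of _ c])
qed

lemma ET3_op_opc: "Defs.ET3_op (opc \<C>)"
  unfolding ET3_op_def
proof (intro allI ballI impI)
  fix A x B y C \<delta> A' x' B' y' C' \<delta>' b c
  assume *: "b \<in> Mor (opc \<C>) B B'" "c \<in> Mor (opc \<C>) C C'"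
    "(A, x, B, y, C, \<delta>) \<in> etriangles (opc \<C>) \<and> (A', x', B', y', C', \<delta>') \<in> etriangles (opc \<C>) \<and>
     Comp (opc \<C>) c y = Comp (opc \<C>) y' b"
  then have t: "tri C y B x A \<delta>" "tri C' y' B' x' A' \<delta>'" by (simp_all add: tri_def)
  have ab: "arr c C' C" "arr b B' B" "b \<cdot> y' = y \<cdot> c"
    using * tri_obj[OF t(1)] tri_obj[OF t(2)] by (simp_all add: arr_def)
  obtain a where "arr a A' A" "a \<cdot> x' = x \<cdot> b" "psh A' c \<delta>' = pll C a \<delta>"
    by (rule ET3[OF t(2,1) ab])
  then show "\<exists>a\<in>Mor (opc \<C>) A A'. Comp (opc \<C>) b x = Comp (opc \<C>) x' a \<and> push (opc \<C>) C a \<delta> = pull (opc \<C>) A' c \<delta>'"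
    by (auto simp: arr_def intro!: bexI[of _ a])
qed

lemma ET4_opc: "Defs.ET4 (opc \<C>)"
  using et4op unfolding ET4_def ET4_op_def by simp

lemma ET4_op_opc: "Defs.ET4_op (opc \<C>)"
  using et4 unfolding ET4_def ET4_op_def by simp

lemma extriangulated_op: "extriangulated (opc \<C>)"
  unfolding extriangulated_def
  by (intro conjI is_additive_op additive_bifunctor_op is_additive_realization_op ET3_opc ET3_op_opc ET4_opc ET4_op_opc)

lemma extri_cat_op: "extri_cat (opc \<C>)"
  by unfold_locales (rule extriangulated_op)

lemma arr_op [simp]: "extri_cat.arr (opc \<C>) f A B \<longleftrightarrow> arr f B A"
  using extri_cat.arr_def[OF extri_cat_op] by (auto simp: arr_def)

lemma tri_op [simp]: "extri_cat.tri (opc \<C>) A x B y C \<delta> \<longleftrightarrow> tri C y B x A \<delta>"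
  using extri_cat.tri_def[OF extri_cat_op] by (auto simp: tri_def)

lemma ext_op [simp]: "extri_cat.ext (opc \<C>) \<delta> C A \<longleftrightarrow> ext \<delta> A C"
  using extri_cat.ext_def[OF extri_cat_op] by (auto simp: ext_def)

end

section \<open>Exactness of \<open>Hom\<close>-sequences in terms of elements\<close>

context extri_cat
begin

text \<open>Exactness in the middle always holds, by \<open>tri_comp\<close> and
  \<open>coker_factor\<close>. What remains are the two ends: extending maps along \<open>x\<close>
  and cancelling \<open>y\<close>.\<close>

lemma hom_into_iff:
  assumes t: "tri A x B y C \<delta>" and W: "W \<in> Obj \<C>"
  shows "hom_into_exact \<C> W (A, x, B, y, C, \<delta>) \<longleftrightarrow>
    (\<forall>u. arr u A W \<longrightarrow> (\<exists>v. arr v B W \<and> v \<cdot> x = u)) \<and>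
    (\<forall>\<psi>. arr \<psi> C W \<and> \<psi> \<cdot> y = zr B W \<longrightarrow> \<psi> = zr C W)" (is "_ \<longleftrightarrow> ?P \<and> ?Q")
proof -
  note a = tri_arr[OF t] and o = tri_obj[OF t]
  have h1: "(\<lambda>\<phi>. \<phi> \<cdot> x) \<in> hom (Hom \<C> B W) (Hom \<C> A W)" and h2: "(\<lambda>\<phi>. \<phi> \<cdot> y) \<in> hom (Hom \<C> C W) (Hom \<C> B W)"
    using pre_hom a W by blast+
  have k: "kernel (Hom \<C> B W) (Hom \<C> A W) (\<lambda>\<phi>. \<phi> \<cdot> x) = (\<lambda>\<phi>. \<phi> \<cdot> y) ` Mor \<C> C W"
  proof (intro equalityI subsetI)
    fix w assume "w \<in> kernel (Hom \<C> B W) (Hom \<C> A W) (\<lambda>\<phi>. \<phi> \<cdot> x)"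
    then have "arr w B W" "w \<cdot> x = zr A W" using o W by (auto simp: kernel_def arr_def)
    then obtain v where "arr v C W" "w = v \<cdot> y" by (rule coker_factor[OF t])
    then show "w \<in> (\<lambda>\<phi>. \<phi> \<cdot> y) ` Mor \<C> C W" by (auto simp: arr_def)
  next
    fix w assume "w \<in> (\<lambda>\<phi>. \<phi> \<cdot> y) ` Mor \<C> C W"
    then obtain v where v: "arr v C W" "w = v \<cdot> y" using o W by (auto simp: arr_def)
    have "w \<cdot> x = zr A W" unfolding v(2) using v(1) a o tri_comp[OF t] by (simp add: csimps)
    moreover have "arr w B W" using v a by (simp add: csimps)
    ultimately show "w \<in> kernel (Hom \<C> B W) (Hom \<C> A W) (\<lambda>\<phi>. \<phi> \<cdot> x)"
      by (simp add: kernel_def arr_def)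
  qed
  have inj: "inj_on (\<lambda>\<phi>. \<phi> \<cdot> y) (Mor \<C> C W) \<longleftrightarrow> ?Q"
    using inj_on_one_iff'[OF h2 hom_group hom_group] o W by (auto simp: arr_def)
  have srj: "(\<lambda>\<phi>. \<phi> \<cdot> x) ` Mor \<C> B W = Mor \<C> A W \<longleftrightarrow> ?P"
  proof
    assume e: "(\<lambda>\<phi>. \<phi> \<cdot> x) ` Mor \<C> B W = Mor \<C> A W"
    show ?P
    proof (intro allI impI)
      fix u assume "arr u A W"
      then have "u \<in> (\<lambda>\<phi>. \<phi> \<cdot> x) ` Mor \<C> B W" unfolding e by (simp add: arr_def)
      then show "\<exists>v. arr v B W \<and> v \<cdot> x = u" using o W by (auto simp: arr_def)
    qed
  next
    assume p: ?P
    show "(\<lambda>\<phi>. \<phi> \<cdot> x) ` Mor \<C> B W = Mor \<C> A W"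
    proof (intro equalityI subsetI)
      fix u assume "u \<in> (\<lambda>\<phi>. \<phi> \<cdot> x) ` Mor \<C> B W"
      then show "u \<in> Mor \<C> A W" using hom_in_carrier[OF h1] by blast
    next
      fix u assume "u \<in> Mor \<C> A W"
      then have "arr u A W" using o W by (simp add: arr_def)
      then obtain v where "arr v B W" "v \<cdot> x = u" using p by blast
      then show "u \<in> (\<lambda>\<phi>. \<phi> \<cdot> x) ` Mor \<C> B W" by (auto simp: arr_def)
    qed
  qed
  show ?thesis
    unfolding hom_into_exact.simps short_exact_sequence_iff
    using inj srj k h1 h2 o W hom_group
    by (auto simp: epi_def mon_def group_hom_def group_hom_axioms_def)
qed

lemma hom_intoD:
  assumes "hom_into_exact \<C> W (A, x, B, y, C, \<delta>)" and t: "tri A x B y C \<delta>" and u: "arr u A W"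
  obtains v where "arr v B W" "v \<cdot> x = u"
proof -
  have W: "W \<in> Obj \<C>" using u by (simp add: arr_def)
  show thesis using that hom_into_iff[OF t W] assms(1) u by metis
qed

lemma hom_into_inj:
  assumes e: "hom_into_exact \<C> W (A, x, B, y, C, \<delta>)" and t: "tri A x B y C \<delta>"
    and u: "arr u C W" "arr v C W" "u \<cdot> y = v \<cdot> y"
  shows "u = v"
proof -
  have "(\<lambda>\<phi>. \<phi> \<cdot> y) \<in> mon (Hom \<C> C W) (Hom \<C> B W)"
    using e by (simp add: short_exact_sequence_iff)
  then show ?thesis using u by (auto simp: mon_def arr_def dest: inj_onD)
qed

lemma hom_from_iff:
  assumes t: "tri A x B y C \<delta>" and W: "W \<in> Obj \<C>"
  shows "hom_from_exact \<C> W (A, x, B, y, C, \<delta>) \<longleftrightarrow>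
    (\<forall>u. arr u W C \<longrightarrow> (\<exists>v. arr v W B \<and> y \<cdot> v = u)) \<and>
    (\<forall>\<psi>. arr \<psi> W A \<and> x \<cdot> \<psi> = zr W B \<longrightarrow> \<psi> = zr W A)"
proof -
  have "extri_cat.tri (opc \<C>) C y B x A \<delta>" "W \<in> Obj (opc \<C>)" using t W by simp_all
  from extri_cat.hom_into_iff[OF extri_cat_op this] show ?thesis unfolding hom_exact_op by simp
qed

lemma hom_fromD:
  assumes "hom_from_exact \<C> W (A, x, B, y, C, \<delta>)" and t: "tri A x B y C \<delta>" and u: "arr u W C"
  obtains v where "arr v W B" "y \<cdot> v = u"
proof -
  have W: "W \<in> Obj \<C>" using u by (simp add: arr_def)
  show thesis using that hom_from_iff[OF t W] assms(1) u by metis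
qed

lemma hom_from_inj:
  assumes e: "hom_from_exact \<C> W (A, x, B, y, C, \<delta>)" and t: "tri A x B y C \<delta>"
    and u: "arr u W A" "arr v W A" "x \<cdot> u = x \<cdot> v"
  shows "u = v"
proof -
  have "(\<lambda>\<phi>. x \<cdot> \<phi>) \<in> mon (Hom \<C> W A) (Hom \<C> W B)"
    using e by (simp add: short_exact_sequence_iff)
  then show ?thesis using u by (auto simp: mon_def arr_def dest: inj_onD)
qed

text \<open>Duality reverses the direction of \<open>etri_iso\<close>, whereas a proper class is
  closed under isomorphism in one stated direction. Inverting all three components reconciles
  them.\<close>

lemma etri_iso_sym:
  assumes i: "etri_iso \<C> (A, x, B, y, C, \<delta>) (A', x', B', y', C', \<delta>')"
    and t: "tri A x B y C \<delta>" "tri A' x' B' y' C' \<delta>'"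
  shows "etri_iso \<C> (A', x', B', y', C', \<delta>') (A, x, B, y, C, \<delta>)"
proof -
  note a = tri_arr[OF t(1)] tri_arr[OF t(2)] and o = tri_obj[OF t(1)] tri_obj[OF t(2)]
  obtain \<alpha> \<beta> \<gamma> where m: "isomorphism \<C> A A' \<alpha>" "isomorphism \<C> B B' \<beta>" "isomorphism \<C> C C' \<gamma>"
    "psh C \<alpha> \<delta> = pll A' \<gamma> \<delta>'" "\<beta> \<cdot> x = x' \<cdot> \<alpha>" "y' \<cdot> \<beta> = \<gamma> \<cdot> y"
    using i by (auto simp: ext_morphism_def)
  have m': "arr \<alpha> A A'" "arr \<beta> B B'" "arr \<gamma> C C'" using m(1-3) o by (simp_all add: isomorphism_def arr_def)
  obtain \<alpha>' where al: "isomorphism \<C> A' A \<alpha>'" "arr \<alpha>' A' A" "\<alpha>' \<cdot> \<alpha> = Id A" "\<alpha> \<cdot> \<alpha>' = Id A'"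
    using isomorphism_inverse[OF m(1) o(1,4)] .
  obtain \<beta>' where be: "isomorphism \<C> B' B \<beta>'" "arr \<beta>' B' B" "\<beta>' \<cdot> \<beta> = Id B" "\<beta> \<cdot> \<beta>' = Id B'"
    using isomorphism_inverse[OF m(2) o(2,5)] .
  obtain \<gamma>' where ga: "isomorphism \<C> C' C \<gamma>'" "arr \<gamma>' C' C" "\<gamma>' \<cdot> \<gamma> = Id C" "\<gamma> \<cdot> \<gamma>' = Id C'"
    using isomorphism_inverse[OF m(3) o(3,6)] .
  have "psh C' \<alpha>' \<delta>' = psh C' \<alpha>' (pll A' \<gamma>' (pll A' \<gamma> \<delta>'))"
    using pull_comp[OF a(6) m'(3) ga(2)] ga(4) pull_id[OF a(6)] by simp
  also have "\<dots> = pll A \<gamma>' (psh C \<alpha>' (psh C \<alpha> \<delta>))"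
    using push_pull[OF pull_ext[OF a(6) m'(3)] ga(2) al(2)] m(4) by simp
  also have "\<dots> = pll A \<gamma>' \<delta>" using push_comp[OF a(3) m'(1) al(2)] al(3) push_id[OF a(3)] by simp
  finally have 1: "psh C' \<alpha>' \<delta>' = pll A \<gamma>' \<delta>" .
  have "\<beta>' \<cdot> x' = \<beta>' \<cdot> ((x' \<cdot> \<alpha>) \<cdot> \<alpha>')" using al(2,4) m'(1) a(4) by (simp add: csimps)
  also have "\<dots> = x \<cdot> \<alpha>'" unfolding m(5)[symmetric] using al(2) be(2) m' a
    by (simp add: csimps be(3)[THEN comp_eq])
  finally have 2: "\<beta>' \<cdot> x' = x \<cdot> \<alpha>'" .
  have "y \<cdot> \<beta>' = \<gamma>' \<cdot> ((\<gamma> \<cdot> y) \<cdot> \<beta>')" using ga(2) be(2) m'(3) a(2) by (simp add: csimps ga(3)[THEN comp_eq])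
  also have "\<dots> = \<gamma>' \<cdot> y'" unfolding m(6)[symmetric] using ga(2) be(2,4) m' a by (simp add: csimps)
  finally have 3: "y \<cdot> \<beta>' = \<gamma>' \<cdot> y'" .
  show ?thesis unfolding etri_iso.simps etri_morphism.simps ext_morphism_def
    using 1 2 3 al(1,2) be(1,2) ga(1,2) by (auto simp: arr_def)
qed

end

section \<open>Proper classes as classes of extensions\<close>

locale proper_cat = extri_cat +
  fixes \<xi> :: "('a, 'b, 'c) etri set"
  assumes proper: "proper_class \<C> \<xi>"
    and enough_proj: "enough_projectives \<C> \<xi>"
    and enough_inj: "enough_injectives \<C> \<xi>"
begin

definition xi :: "'a \<Rightarrow> 'b \<Rightarrow> 'a \<Rightarrow> 'b \<Rightarrow> 'a \<Rightarrow> 'c \<Rightarrow> bool" where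
  "xi A x B y C \<delta> \<longleftrightarrow> (A, x, B, y, C, \<delta>) \<in> \<xi>"

definition xext :: "'c \<Rightarrow> 'a \<Rightarrow> 'a \<Rightarrow> bool" where
  "xext \<delta> C A \<longleftrightarrow> (\<exists>B x y. xi A x B y C \<delta>)"

abbreviation PP :: "'a set" where "PP \<equiv> xi_projectives \<C> \<xi>"
abbreviation II :: "'a set" where "II \<equiv> xi_injectives \<C> \<xi>"

lemmas proper_class_conditions0 = proper[unfolded proper_class_def]
lemmas proper_class_conditions =
  proper_class_conditions0[THEN conjunct1]
  proper_class_conditions0[THEN conjunct2, THEN conjunct1]
  proper_class_conditions0[THEN conjunct2, THEN conjunct2, THEN conjunct1]
  proper_class_conditions0[THEN conjunct2, THEN conjunct2, THEN conjunct2, THEN conjunct1]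
  proper_class_conditions0[THEN conjunct2, THEN conjunct2, THEN conjunct2, THEN conjunct2, THEN conjunct1]
  proper_class_conditions0[THEN conjunct2, THEN conjunct2, THEN conjunct2, THEN conjunct2, THEN conjunct2, THEN conjunct1]
  proper_class_conditions0[THEN conjunct2, THEN conjunct2, THEN conjunct2, THEN conjunct2, THEN conjunct2, THEN conjunct2]

lemma xi_tri: "xi A x B y C \<delta> \<Longrightarrow> tri A x B y C \<delta>"
  using subsetD[OF proper_class_conditions(1)] unfolding xi_def tri_def by simp

lemma xi_pull: "xi A x B y C \<delta> \<Longrightarrow> arr c C' C \<Longrightarrow> tri A x' B' y' C' (pll A c \<delta>) \<Longrightarrow> xi A x' B' y' C' (pll A c \<delta>)"
  using proper_class_conditions(5)[rule_format, OF arr_mor conjI] unfolding xi_def tri_def by simp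

lemma xi_push: "xi A x B y C \<delta> \<Longrightarrow> arr a A A' \<Longrightarrow> tri A' x' B' y' C (psh C a \<delta>) \<Longrightarrow> xi A' x' B' y' C (psh C a \<delta>)"
  using proper_class_conditions(6)[rule_format, OF arr_mor conjI] unfolding xi_def tri_def by simp

lemma xi_split: "tri A x B y C (ze C A) \<Longrightarrow> xi A x B y C (ze C A)"
  using proper_class_conditions(4) unfolding xi_def tri_def by simp

lemma xi_arr:
  assumes "xi A x B y C \<delta>"
  shows "arr x A B" "arr y B C" "ext \<delta> C A"
  using tri_arr[OF xi_tri[OF assms]] .

lemma xi_obj:
  assumes "xi A x B y C \<delta>"
  shows "A \<in> Obj \<C>" "B \<in> Obj \<C>" "C \<in> Obj \<C>"
  using tri_obj[OF xi_tri[OF assms]] .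

text \<open>Base change along the identity fixes \<delta>, so membership in \<xi> depends on the
  extension alone and not on the realization. This justifies working with
  \<open>xext\<close>.\<close>

lemma xext_xi:
  assumes "xext \<delta> C A" "tri A x B y C \<delta>" shows "xi A x B y C \<delta>"
proof -
  obtain B' x' y' where b: "xi A x' B' y' C \<delta>" using assms(1) by (auto simp: xext_def)
  have p: "pll A (Id C) \<delta> = \<delta>" using pull_id[OF xi_arr(3)[OF b]] .
  have "arr (Id C) C C" using xi_obj[OF b] by simp
  from xi_pull[OF b this, unfolded p] show ?thesis using assms(2) by blast
qed

lemma xi_xext: "xi A x B y C \<delta> \<Longrightarrow> xext \<delta> C A"
  by (auto simp: xext_def)

lemma xext_ext: "xext \<delta> C A \<Longrightarrow> ext \<delta> C A"
  using xi_arr(3) by (auto simp: xext_def)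

lemma xext_realize:
  assumes "xext \<delta> C A" obtains B x y where "xi A x B y C \<delta>"
  using assms by (auto simp: xext_def)

lemma xext_pull:
  assumes "xext \<delta> C A" "arr c C' C" shows "xext (pll A c \<delta>) C' A"
proof -
  obtain B x y where b: "xi A x B y C \<delta>" using xext_realize[OF assms(1)] .
  obtain B' x' y' where "tri A x' B' y' C' (pll A c \<delta>)"
    using tri_realize[OF pull_ext[OF xi_arr(3)[OF b] assms(2)]] .
  then show ?thesis using xi_pull[OF b assms(2)] xi_xext by blast
qed

lemma xext_push:
  assumes "xext \<delta> C A" "arr a A A'" shows "xext (psh C a \<delta>) C A'"
proof -
  obtain B x y where b: "xi A x B y C \<delta>" using xext_realize[OF assms(1)] .
  obtain B' x' y' where "tri A' x' B' y' C (psh C a \<delta>)"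
    using tri_realize[OF push_ext[OF xi_arr(3)[OF b] assms(2)]] .
  then show ?thesis using xi_push[OF b assms(2)] xi_xext by blast
qed

lemma xext_saturated:
  assumes "xi A2 x2 B2 y2 C \<delta>2" "ext \<delta> C A" "xext (pll A y2 \<delta>) B2 A"
  shows "xext \<delta> C A"
proof -
  obtain B x y where b: "tri A x B y C \<delta>" using tri_realize[OF assms(2)] .
  obtain M m e where m: "xi A m M e B2 (pll A y2 \<delta>)" using xext_realize[OF assms(3)] .
  have "xi A x B y C \<delta>"
    using proper_class_conditions(7)[unfolded saturated_def, rule_format, OF conjI[OF _ conjI]] b m assms(1)
    unfolding tri_def xi_def by blast
  then show ?thesis by (rule xi_xext)
qed

text \<open>This is the dual of saturation, derived from saturation itself. Pulled back along the
  deflation \<open>z\<close> of the pushed triangle, \<delta> dies under \<open>x2\<close>, hence is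
  a pullback of \<open>\<delta>2\<close> and lies in \<xi>; as \<open>z\<close> belongs to a
  triangle in \<xi>, saturation applies to \<delta>.\<close>

lemma xext_cosaturated:
  assumes t2: "xi A x2 B2 y2 C2 \<delta>2" and d: "ext \<delta> C A" "xext (psh C x2 \<delta>) C B2"
  shows "xext \<delta> C A"
proof -
  obtain M m z where z: "xi B2 m M z C (psh C x2 \<delta>)" using xext_realize[OF d(2)] .
  have e: "ext (pll A z \<delta>) M A" using pull_ext[OF d(1) xi_arr(2)[OF z]] .
  have "psh M x2 (pll A z \<delta>) = ze M B2"
    using push_pull[OF d(1) xi_arr(2)[OF z] xi_arr(1)[OF t2]] tri_pull[OF xi_tri[OF z]] by simp
  then obtain v where "arr v M C2" "pll A v \<delta>2 = pll A z \<delta>"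
    by (rule push_zero_imp_pull[OF xi_tri[OF t2] e])
  then have "xext (pll A z \<delta>) M A" using xext_pull[OF xi_xext[OF t2]] by metis
  then show ?thesis by (rule xext_saturated[OF z d(1)])
qed

lemma proper_op: "proper_class (opc \<C>) (opt \<xi>)"
  unfolding proper_class_def
proof (intro conjI ballI allI impI)
  show "opt \<xi> \<subseteq> etriangles (opc \<C>)" using xi_tri by (auto simp: opt_def xi_def tri_def)
next
  fix t t' assume t: "t \<in> opt \<xi>" "t' \<in> etriangles (opc \<C>)" "etri_iso (opc \<C>) t t'"
  obtain A x B y C \<delta> A' x' B' y' C' \<delta>' where
    tt [simp]: "t = (A, x, B, y, C, \<delta>)" "t' = (A', x', B', y', C', \<delta>')" by (metis prod.exhaust)
  have 1: "xi C y B x A \<delta>" "tri C' y' B' x' A' \<delta>'" using t(1,2) by (simp_all add: xi_def tri_def)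
  have "etri_iso \<C> (C', y', B', x', A', \<delta>') (C, y, B, x, A, \<delta>)" using t(3)[unfolded tt etri_iso_op] .
  from etri_iso_sym[OF this 1(2) xi_tri[OF 1(1)]]
  have "(C', y', B', x', A', \<delta>') \<in> \<xi>" using proper_class_conditions(2) 1 unfolding xi_def tri_def by blast
  then show "t' \<in> opt \<xi>" by simp
next
  fix t t' t'' assume t: "t \<in> opt \<xi>" "t' \<in> opt \<xi>" "etri_sum (opc \<C>) t t' t''"
  obtain A x B y C \<delta> A' x' B' y' C' \<delta>' A'' x'' B'' y'' C'' \<delta>'' where
    [simp]: "t = (A, x, B, y, C, \<delta>)" "t' = (A', x', B', y', C', \<delta>')" "t'' = (A'', x'', B'', y'', C'', \<delta>'')"
    by (metis prod.exhaust)
  have x: "xi C y B x A \<delta>" "xi C' y' B' x' A' \<delta>'" using t(1,2) by (simp_all add: xi_def)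
  have "etri_sum \<C> (C, y, B, x, A, \<delta>) (C', y', B', x', A', \<delta>') (C'', y'', B'', x'', A'', \<delta>'')"
    using etri_sum_op[OF _ xi_tri[OF x(1)] xi_tri[OF x(2)]] t(3) by simp
  then have "(C'', y'', B'', x'', A'', \<delta>'') \<in> \<xi>" using proper_class_conditions(3) x unfolding xi_def by blast
  then show "t'' \<in> opt \<xi>" by simp
next
  fix A x B y C assume "(A, x, B, y, C, \<one>\<^bsub>Ext (opc \<C>) C A\<^esub>) \<in> etriangles (opc \<C>)"
  then show "(A, x, B, y, C, \<one>\<^bsub>Ext (opc \<C>) C A\<^esub>) \<in> opt \<xi>" using xi_split by (simp add: xi_def tri_def)
next
  fix A x B y C \<delta> C' x' B' y' c
  assume c: "c \<in> Mor (opc \<C>) C' C" and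
    *: "(A, x, B, y, C, \<delta>) \<in> opt \<xi> \<and> (A, x', B', y', C', pull (opc \<C>) A c \<delta>) \<in> etriangles (opc \<C>)"
  then have x: "xi C y B x A \<delta>" "tri C' y' B' x' A (psh A c \<delta>)" by (simp_all add: xi_def tri_def)
  have "arr c C C'" using c xi_obj[OF x(1)] tri_obj[OF x(2)] by (simp add: arr_def)
  from xi_push[OF x(1) this x(2)] show "(A, x', B', y', C', pull (opc \<C>) A c \<delta>) \<in> opt \<xi>" by (simp add: xi_def)
next
  fix A x B y C \<delta> A' x' B' y' a
  assume a: "a \<in> Mor (opc \<C>) A A'" and
    *: "(A, x, B, y, C, \<delta>) \<in> opt \<xi> \<and> (A', x', B', y', C, push (opc \<C>) C a \<delta>) \<in> etriangles (opc \<C>)"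
  then have x: "xi C y B x A \<delta>" "tri C y' B' x' A' (pll C a \<delta>)" by (simp_all add: xi_def tri_def)
  have "arr a A' A" using a xi_obj[OF x(1)] tri_obj[OF x(2)] by (simp add: arr_def)
  from xi_pull[OF x(1) this x(2)] show "(A', x', B', y', C, push (opc \<C>) C a \<delta>) \<in> opt \<xi>" by (simp add: xi_def)
next
  show "saturated (opc \<C>) (opt \<xi>)"
    unfolding saturated_def
  proof (intro allI impI)
    fix A1 x1 B1 y1 C \<delta>1 A2 x2 B2 y2 \<delta>2 m M e
    assume "(A1, x1, B1, y1, C, \<delta>1) \<in> etriangles (opc \<C>) \<and> (A2, x2, B2, y2, C, \<delta>2) \<in> opt \<xi> \<and>
     (A1, m, M, e, B2, pull (opc \<C>) A1 y2 \<delta>1) \<in> opt \<xi>"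
    then have x: "tri C y1 B1 x1 A1 \<delta>1" "xi C y2 B2 x2 A2 \<delta>2" "xi B2 e M m A1 (psh A1 y2 \<delta>1)"
      by (simp_all add: xi_def tri_def)
    have "xext \<delta>1 A1 C" by (rule xext_cosaturated[OF x(2) tri_arr(3)[OF x(1)] xi_xext[OF x(3)]])
    from xext_xi[OF this x(1)] show "(A1, x1, B1, y1, C, \<delta>1) \<in> opt \<xi>" by (simp add: xi_def)
  qed
qed

lemma proper_cat_op: "proper_cat (opc \<C>) (opt \<xi>)"
  by (unfold_locales) (use extriangulated_op proper_op enough_proj enough_inj in simp_all)

lemma xi_op [simp]: "proper_cat.xi (opt \<xi>) A x B y C \<delta> \<longleftrightarrow> xi C y B x A \<delta>"
  using proper_cat.xi_def[OF proper_cat_op] by (auto simp: xi_def)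

lemma xext_op [simp]: "proper_cat.xext (opt \<xi>) \<delta> C A \<longleftrightarrow> xext \<delta> A C"
  using proper_cat.xext_def[OF proper_cat_op] by (auto simp: xext_def)

end

section \<open>Ghost maps and orthogonality\<close>

context extri_cat
begin

lemma pull_zero_lift:
  assumes "tri A x B y C \<delta>" "ext \<eta> B D" "pll D x \<eta> = ze A D"
  obtains \<theta> where "ext \<theta> C D" "pll D y \<theta> = \<eta>"
  using extri_cat.push_zero_lift[OF extri_cat_op, of C y B x A \<delta> \<eta> D] assms by auto

end

context proper_cat
begin

lemma PP_obj: "P \<in> PP \<Longrightarrow> P \<in> Obj \<C>"
  by (simp add: xi_projectives_def)

lemma II_obj: "P \<in> II \<Longrightarrow> P \<in> Obj \<C>"
  by (simp add: xi_injectives_def)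

lemma PP_from: "P \<in> PP \<Longrightarrow> xi A x B y C \<delta> \<Longrightarrow> hom_from_exact \<C> P (A, x, B, y, C, \<delta>)"
  unfolding xi_projectives_def xi_def by blast

lemma II_into: "P \<in> II \<Longrightarrow> xi A x B y C \<delta> \<Longrightarrow> hom_into_exact \<C> P (A, x, B, y, C, \<delta>)"
  unfolding xi_injectives_def xi_def by blast

lemma proj_cover:
  assumes "A \<in> Obj \<C>" obtains K x P y \<delta> where "xi K x P y A \<delta>" "P \<in> PP"
  using enough_proj assms unfolding enough_projectives_def xi_def by blast

lemma inj_hull:
  assumes "A \<in> Obj \<C>" obtains K x P y \<delta> where "xi A x P y K \<delta>" "P \<in> II"
  using enough_inj assms unfolding enough_injectives_def xi_def by blast

text \<open>
  Deflations need not be epimorphisms (think of triangulated categories), so exactness at the left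
  end of a \<open>Hom\<close>-sequence is a condition of its own; it is governed by ghost maps.
\<close>

definition ghost :: "'b \<Rightarrow> 'a \<Rightarrow> 'a \<Rightarrow> bool" where
  "ghost \<psi> E C \<longleftrightarrow> arr \<psi> E C \<and> (\<forall>P\<in>PP. \<forall>p. arr p P E \<longrightarrow> \<psi> \<cdot> p = zr P C)"

text \<open>A map from a projective lifts through \<open>y\<close>, and \<psi> vanishes after
  \<open>y\<close>.\<close>

lemma ghost_deflation:
  assumes "arr \<psi> E C" and t: "xi A x B y E \<delta>" and z: "\<psi> \<cdot> y = zr B C"
  shows "ghost \<psi> E C"
  unfolding ghost_def
proof (intro conjI ballI allI impI)
  fix P p assume P: "P \<in> PP" "arr p P E"
  obtain v where v: "arr v P B" "y \<cdot> v = p" by (rule hom_fromD[OF PP_from[OF P(1) t] xi_tri[OF t] P(2)])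
  show "\<psi> \<cdot> p = zr P C"
    unfolding v(2)[symmetric] using v(1) xi_arr(2)[OF t] assms(1) arr_obj(2)[OF assms(1)]
    by (simp add: csimps z z[THEN comp_eq])
qed (rule assms)

text \<open>Composition with \<open>x\<close> is injective on maps from a projective.\<close>

lemma ghost_inflation:
  assumes a: "arr \<psi> E C" and t: "xi C x B y D \<delta>" and z: "x \<cdot> \<psi> = zr E B"
  shows "ghost \<psi> E C"
  unfolding ghost_def
proof (intro conjI ballI allI impI)
  fix P p assume P: "P \<in> PP" "arr p P E"
  have o: "P \<in> Obj \<C>" "C \<in> Obj \<C>" using PP_obj P(1) xi_obj(1)[OF t] .
  have 1: "arr (\<psi> \<cdot> p) P C" "arr (zr P C) P C" using a P(2) o by (simp_all add: csimps)
  have "x \<cdot> (\<psi> \<cdot> p) = x \<cdot> zr P C"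
    using P(2) xi_arr(1)[OF t] a o xi_obj(2)[OF t] by (simp add: csimps z z[THEN comp_eq])
  then show "\<psi> \<cdot> p = zr P C" by (rule hom_from_inj[OF PP_from[OF P(1) t] xi_tri[OF t] 1])
qed (rule a)

text \<open>A ghost vanishes on a projective cover of \<open>E\<close>, and maps into an injective
  are determined by their restriction to that cover.\<close>

lemma ghost_to_inj:
  assumes g: "ghost \<psi> E C" and I: "I \<in> II" "arr j C I" shows "j \<cdot> \<psi> = zr E I"
proof -
  have a: "arr \<psi> E C" using g by (simp add: ghost_def)
  obtain K x P y \<delta> where P: "xi K x P y E \<delta>" "P \<in> PP" using proj_cover[OF arr_obj(1)[OF a]] .
  have o: "E \<in> Obj \<C>" "I \<in> Obj \<C>" using arr_obj[OF a] II_obj[OF I(1)] by auto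
  have z: "\<psi> \<cdot> y = zr P C" using g P(2) xi_arr(2)[OF P(1)] by (simp add: ghost_def)
  have 1: "arr (j \<cdot> \<psi>) E I" "arr (zr E I) E I" using a I(2) o by (simp_all add: csimps)
  have "(j \<cdot> \<psi>) \<cdot> y = zr E I \<cdot> y" using a I(2) o xi_arr(2)[OF P(1)] xi_obj(2)[OF P(1)] by (simp add: csimps z)
  then show ?thesis by (rule hom_into_inj[OF II_into[OF I(1) P(1)] xi_tri[OF P(1)] 1])
qed

text \<open>For the converse, the ghost condition is tested on a single injective hull of
  \<open>C\<close>. This equivalence is what makes \<open>ghost\<close> self-dual.\<close>

lemma ghost_iff_inj:
  "ghost \<psi> E C \<longleftrightarrow> arr \<psi> E C \<and> (\<forall>I\<in>II. \<forall>j. arr j C I \<longrightarrow> j \<cdot> \<psi> = zr E I)"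
proof
  assume *: "arr \<psi> E C \<and> (\<forall>I\<in>II. \<forall>j. arr j C I \<longrightarrow> j \<cdot> \<psi> = zr E I)"
  obtain K x P y \<delta> where P: "xi C x P y K \<delta>" "P \<in> II" using inj_hull[OF arr_obj(2)[OF conjunct1[OF *]]] .
  have "x \<cdot> \<psi> = zr E P" using * P(2) xi_arr(1)[OF P(1)] by blast
  then show "ghost \<psi> E C" by (rule ghost_inflation[OF conjunct1[OF *] P(1)])
qed (auto simp: ghost_to_inj ghost_def)

lemma ghost_op [simp]: "proper_cat.ghost (opc \<C>) (opt \<xi>) \<psi> E C \<longleftrightarrow> ghost \<psi> C E"
  unfolding proper_cat.ghost_def[OF proper_cat_op] ghost_iff_inj[of \<psi> C E] by simp

definition orth :: "'a \<Rightarrow> 'a \<Rightarrow> bool" where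
  "orth E C \<longleftrightarrow> E \<in> Obj \<C> \<and> C \<in> Obj \<C> \<and>
     (\<forall>\<delta>. xext \<delta> E C \<longrightarrow> \<delta> = ze E C) \<and> (\<forall>\<psi>. ghost \<psi> E C \<longrightarrow> \<psi> = zr E C)"

lemma orth_op [simp]: "proper_cat.orth (opc \<C>) (opt \<xi>) E C \<longleftrightarrow> orth C E"
  unfolding proper_cat.orth_def[OF proper_cat_op] orth_def by auto

lemma orthD: "orth E C \<Longrightarrow> xext \<delta> E C \<Longrightarrow> \<delta> = ze E C"
    "orth E C \<Longrightarrow> ghost \<psi> E C \<Longrightarrow> \<psi> = zr E C"
    "orth E C \<Longrightarrow> E \<in> Obj \<C>" "orth E C \<Longrightarrow> C \<in> Obj \<C>"
  by (simp_all add: orth_def)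

text \<open>The obstruction to extending \<open>u\<close> is the pushed extension, which lies in
  \<xi>; the maps that vanish after \<open>y\<close> are ghosts. Orthogonality kills both.\<close>

lemma orth_into:
  assumes o: "orth C W" and t: "xi A x B y C \<delta>"
  shows "hom_into_exact \<C> W (A, x, B, y, C, \<delta>)"
  unfolding hom_into_iff[OF xi_tri[OF t] orthD(4)[OF o]]
proof (intro conjI allI impI)
  fix u assume u: "arr u A W"
  have "psh C u \<delta> = ze C W" by (rule orthD(1)[OF o xext_push[OF xi_xext[OF t] u]])
  then show "\<exists>v. arr v B W \<and> v \<cdot> x = u" using extend[OF xi_tri[OF t] u] by metis
next
  fix \<psi> assume "arr \<psi> C W \<and> \<psi> \<cdot> y = zr B W"
  then show "\<psi> = zr C W" using orthD(2)[OF o ghost_deflation[OF _ t]] by blast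
qed

lemma orth_from:
  assumes o: "orth W A" and t: "xi A x B y C \<delta>"
  shows "hom_from_exact \<C> W (A, x, B, y, C, \<delta>)"
  using proper_cat.orth_into[OF proper_cat_op, of A W C y B x \<delta>] assms unfolding hom_exact_op by simp

lemma proj_xext:
  assumes P: "P \<in> PP" and d: "xext \<delta> P A" shows "\<delta> = ze P A"
proof -
  obtain B x y where t: "xi A x B y P \<delta>" using xext_realize[OF d] .
  obtain v where v: "arr v P B" "y \<cdot> v = Id P"
    by (rule hom_fromD[OF PP_from[OF P t] xi_tri[OF t] id_arr[OF PP_obj[OF P]]])
  show ?thesis using lift_pull[OF xi_tri[OF t] v(1)] v(2) pull_id[OF xext_ext[OF d]] by simp
qed

text \<open>A converse of \<open>orth_into\<close> for a projective middle term. Extensions in \<xi>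
  become zero on \<open>P\<close>, so they are pushed from \<delta> along some \<open>u\<close>, and
  \<open>u\<close> extends over \<open>P\<close>; ghosts vanish on \<open>P\<close>, so they are
  cancelled with \<open>y\<close>.\<close>

lemma into_orth:
  assumes t: "xi A x P y C \<delta>" and P: "P \<in> PP" and W: "W \<in> Obj \<C>"
    and h: "hom_into_exact \<C> W (A, x, P, y, C, \<delta>)"
  shows "orth C W"
  unfolding orth_def
proof (intro conjI allI impI)
  show "C \<in> Obj \<C>" using xi_obj[OF t] by blast
next
  fix \<eta> assume e: "xext \<eta> C W"
  have "pll W y \<eta> = ze P W" by (rule proj_xext[OF P xext_pull[OF e xi_arr(2)[OF t]]])
  then obtain u where u: "arr u A W" "psh C u \<delta> = \<eta>" by (rule pull_zero_imp_push[OF xi_tri[OF t] xext_ext[OF e]])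
  obtain v where v: "arr v P W" "v \<cdot> x = u" by (rule hom_intoD[OF h xi_tri[OF t] u(1)])
  show "\<eta> = ze C W" using extend_push[OF xi_tri[OF t] v(1)] v(2) u(2) by simp
next
  fix \<psi> assume g: "ghost \<psi> C W"
  then have "arr \<psi> C W" "\<psi> \<cdot> y = zr P W" using P xi_arr(2)[OF t] by (auto simp: ghost_def)
  then show "\<psi> = zr C W" using h unfolding hom_into_iff[OF xi_tri[OF t] W] by blast
qed (rule W)

lemma from_orth:
  assumes "xi A x I y C \<delta>" "I \<in> II" "W \<in> Obj \<C>" "hom_from_exact \<C> W (A, x, I, y, C, \<delta>)"
  shows "orth W A"
  using proper_cat.into_orth[OF proper_cat_op, of C y I x A \<delta> W] assms unfolding hom_exact_op by simp

lemma proj_orth: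
  assumes P: "P \<in> PP" and D: "D \<in> Obj \<C>" shows "orth P D"
  unfolding orth_def
proof (intro conjI allI impI)
  fix \<psi> assume g: "ghost \<psi> P D"
  then have "\<psi> \<cdot> Id P = zr P D" using P id_arr[OF PP_obj[OF P]] by (simp add: ghost_def)
  then show "\<psi> = zr P D" using id_right[of \<psi> P D] g by (simp add: ghost_def)
qed (use PP_obj[OF P] D proj_xext[OF P] in auto)

text \<open>With \<open>proj_orth\<close> this describes projectives as the objects orthogonal to
  everything, so that closure properties of \<open>orth\<close> pass to them.\<close>

lemma orth_proj:
  assumes "P \<in> Obj \<C>" "\<And>D. D \<in> Obj \<C> \<Longrightarrow> orth P D" shows "P \<in> PP"
proof -
  have "hom_from_exact \<C> P t" if "t \<in> \<xi>" for t
  proof -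
    obtain A x B y C \<delta> where [simp]: "t = (A, x, B, y, C, \<delta>)" by (metis prod.exhaust)
    have "xi A x B y C \<delta>" using that by (simp add: xi_def)
    from orth_from[OF assms(2)[OF xi_obj(1)[OF this]] this] show ?thesis by simp
  qed
  then show ?thesis using assms(1) by (simp add: xi_projectives_def)
qed

lemma ghost_comp: assumes "ghost \<psi> E C" "arr b G E" shows "ghost (\<psi> \<cdot> b) G C"
proof -
  have a: "arr \<psi> E C" using assms(1) by (simp add: ghost_def)
  have "(\<psi> \<cdot> b) \<cdot> p = zr P C" if "P \<in> PP" "arr p P G" for P p
  proof -
    have "(\<psi> \<cdot> b) \<cdot> p = \<psi> \<cdot> (b \<cdot> p)" by (rule assoc[OF that(2) assms(2) a])
    also have "\<dots> = zr P C" using assms(1) that(1) comp_arr[OF that(2) assms(2)] unfolding ghost_def by blast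
    finally show ?thesis .
  qed
  then show ?thesis using comp_arr[OF assms(2) a] by (simp add: ghost_def)
qed

text \<open>An extension that vanishes on \<open>G\<close> comes from some \<theta> on
  \<open>H\<close>, and saturation puts \<theta> back into \<xi>. A ghost that vanishes on
  \<open>G\<close> factors through \<open>c\<close>, and the factor is again a ghost because maps
  from projectives lift along \<open>c\<close>.\<close>

lemma orth_extension:
  assumes t: "xi G b E c H \<delta>" and G: "orth G C" and H: "orth H C"
  shows "orth E C"
  unfolding orth_def
proof (intro conjI allI impI)
  show "E \<in> Obj \<C>" "C \<in> Obj \<C>" using xi_obj[OF t] orthD(4)[OF G] by blast+
next
  fix \<eta> assume e: "xext \<eta> E C"
  have "pll C b \<eta> = ze G C" by (rule orthD(1)[OF G xext_pull[OF e xi_arr(1)[OF t]]])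
  then obtain \<theta> where th: "ext \<theta> H C" "pll C c \<theta> = \<eta>" by (rule pull_zero_lift[OF xi_tri[OF t] xext_ext[OF e]])
  have "xext \<theta> H C" using xext_saturated[OF t th(1)] th(2) e by simp
  then have "\<theta> = ze H C" by (rule orthD(1)[OF H])
  then show "\<eta> = ze E C" using th(2) pull_ze[OF orthD(4)[OF G] xi_arr(2)[OF t]] by simp
next
  fix \<psi> assume g: "ghost \<psi> E C"
  have a: "arr \<psi> E C" using g by (simp add: ghost_def)
  have "\<psi> \<cdot> b = zr G C" by (rule orthD(2)[OF G ghost_comp[OF g xi_arr(1)[OF t]]])
  then obtain \<theta> where th: "arr \<theta> H C" "\<psi> = \<theta> \<cdot> c" by (rule coker_factor[OF xi_tri[OF t] a])
  have "ghost \<theta> H C"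
    unfolding ghost_def
  proof (intro conjI ballI allI impI)
    fix P p assume P: "P \<in> PP" "arr p P H"
    obtain v where v: "arr v P E" "c \<cdot> v = p" by (rule hom_fromD[OF PP_from[OF P(1) t] xi_tri[OF t] P(2)])
    have "\<theta> \<cdot> p = \<psi> \<cdot> v" unfolding th(2) v(2)[symmetric] by (rule assoc[OF v(1) xi_arr(2)[OF t] th(1), symmetric])
    then show "\<theta> \<cdot> p = zr P C" using g P(1) v(1) by (simp add: ghost_def)
  qed (rule th)
  then have "\<theta> = zr H C" by (rule orthD(2)[OF H])
  then show "\<psi> = zr E C" using th(2) comp_zr_left[OF xi_arr(2)[OF t]] orthD(4)[OF G] by simp
qed

lemma orth_retract:
  assumes s: "arr s E E'" and r: "arr r E' E" and i: "r \<cdot> s = Id E" and o: "orth E' C"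
  shows "orth E C"
  unfolding orth_def
proof (intro conjI allI impI)
  show "E \<in> Obj \<C>" "C \<in> Obj \<C>" using arr_obj[OF s] orthD(4)[OF o] by auto
next
  fix \<eta> assume e: "xext \<eta> E C"
  have "\<eta> = pll C s (pll C r \<eta>)" using pull_comp[OF xext_ext[OF e] r s] i pull_id[OF xext_ext[OF e]] by simp
  also have "pll C r \<eta> = ze E' C" by (rule orthD(1)[OF o xext_pull[OF e r]])
  finally show "\<eta> = ze E C" using pull_ze[OF orthD(4)[OF o] s] by simp
next
  fix \<psi> assume g: "ghost \<psi> E C"
  have a: "arr \<psi> E C" using g by (simp add: ghost_def)
  have "\<psi> = (\<psi> \<cdot> r) \<cdot> s" using assoc[OF s r a] i id_right[OF a] by simp
  also have "\<psi> \<cdot> r = zr E' C" by (rule orthD(2)[OF o ghost_comp[OF g r]])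
  finally show "\<psi> = zr E C" using comp_zr_left[OF s] orthD(4)[OF o] by simp
qed

lemma proj_extension:
  assumes t: "xi G b E c H \<delta>" and "G \<in> PP" "H \<in> PP" shows "E \<in> PP"
  by (rule orth_proj[OF xi_obj(2)[OF t] orth_extension[OF t proj_orth[OF assms(2)] proj_orth[OF assms(3)]]])

text \<open>Two realizations of one extension have isomorphic middle terms; \<open>pushout\<close>
  makes this transport necessary.\<close>

lemma proj_iso:
  assumes "tri A x B y C \<delta>" "tri A x' B' y' C \<delta>" "B \<in> PP" shows "B' \<in> PP"
proof -
  obtain b b' where b: "arr b B' B" "arr b' B B'" "b' \<cdot> b = Id B'" using tri_equiv[OF assms(2,1)] .
  show ?thesis by (rule orth_proj[OF arr_obj(1)[OF b(1)] orth_retract[OF b proj_orth[OF assms(3)]]])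
qed

text \<open>
  Surjectivity is the usual dimension shift.  For injectivity, \<open>ET3_op\<close> turns a map \<open>\<psi>\<close> with
  \<open>\<psi> \<cdot> y = 0\<close> into a ghost \<open>A \<rightarrow> A'\<close>: this is dimension shifting one degree below \<open>Hom\<close>.
\<close>

lemma shift_into:
  assumes t: "xi A x B y C \<delta>" and t': "xi A' x' B' y' C' \<delta>'"
    and o: "orth A A'" and h: "hom_into_exact \<C> B' (A, x, B, y, C, \<delta>)"
  shows "hom_into_exact \<C> C' (A, x, B, y, C, \<delta>)"
  unfolding hom_into_iff[OF xi_tri[OF t] xi_obj(3)[OF t']]
proof (intro conjI allI impI)
  note a = xi_arr[OF t] xi_arr[OF t'] and ob = xi_obj[OF t] xi_obj[OF t']
  fix u assume u: "arr u A C'"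
  have "pll A' u \<delta>' = ze A A'" by (rule orthD(1)[OF o xext_pull[OF xi_xext[OF t'] u]])
  then obtain e where e: "arr e A B'" "y' \<cdot> e = u" by (rule lift[OF xi_tri[OF t'] u])
  obtain v where v: "arr v B B'" "v \<cdot> x = e" by (rule hom_intoD[OF h xi_tri[OF t] e(1)])
  have "(y' \<cdot> v) \<cdot> x = u" using a v e by (simp add: csimps)
  moreover have "arr (y' \<cdot> v) B C'" using a v by (simp add: csimps)
  ultimately show "\<exists>v. arr v B C' \<and> v \<cdot> x = u" by blast
next
  note a = xi_arr[OF t] xi_arr[OF t'] and ob = xi_obj[OF t] xi_obj[OF t']
  fix \<psi> assume p: "arr \<psi> C C' \<and> \<psi> \<cdot> y = zr B C'"
  have z: "arr (zr B B') B B'" using ob by simp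
  have "\<psi> \<cdot> y = y' \<cdot> zr B B'" using p comp_zr_right[OF a(5) ob(2)] by simp
  then obtain \<alpha> where al: "arr \<alpha> A A'" "zr B B' \<cdot> x = x' \<cdot> \<alpha>" "psh C \<alpha> \<delta> = pll A' \<psi> \<delta>'"
    by (rule ET3_op[OF xi_tri[OF t] xi_tri[OF t'] conjunct1[OF p] z])
  have "x' \<cdot> \<alpha> = zr A B'" using al(2) comp_zr_left[OF a(1) ob(5)] by simp
  then have "\<alpha> = zr A A'" by (rule orthD(2)[OF o ghost_inflation[OF al(1) t']])
  then have "pll A' \<psi> \<delta>' = ze C A'" using al(3) push_zr[OF a(3) ob(4)] by simp
  \<comment> \<open>Now \<psi> lifts to \<open>v\<close>, and it suffices that \<open>v\<close>
    factor through \<open>x'\<close>. Its restriction along \<open>y\<close> does, by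
    \<open>w\<close>; the composite \<open>w \<cdot> x\<close> is a second ghost from
    \<open>A\<close> to \<open>A'\<close>, so \<open>w\<close> descends to \<open>C\<close>, and
    injectivity into \<open>B'\<close> cancels \<open>y\<close>.\<close>
  then obtain v where v: "arr v C B'" "y' \<cdot> v = \<psi>" by (rule lift[OF xi_tri[OF t'] conjunct1[OF p]])
  have "y' \<cdot> (v \<cdot> y) = zr B C'" using a v p by (simp add: csimps v(2)[THEN comp_eq])
  then obtain w where w: "arr w B A'" "v \<cdot> y = x' \<cdot> w" by (rule ker_factor[OF xi_tri[OF t'] comp_arr[OF a(2) v(1)]])
  have wx: "arr (w \<cdot> x) A A'" using w a by (simp add: csimps)
  have "x' \<cdot> (w \<cdot> x) = v \<cdot> (y \<cdot> x)" using assoc[OF a(1) w(1) a(4)] w(2) assoc[OF a(1,2) v(1)] by simp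
  also have "\<dots> = zr A B'" using tri_comp[OF xi_tri[OF t]] comp_zr_right[OF v(1) ob(1)] by simp
  finally have "w \<cdot> x = zr A A'" by (rule orthD(2)[OF o ghost_inflation[OF wx t']])
  then obtain w' where w': "arr w' C A'" "w = w' \<cdot> y" by (rule coker_factor[OF xi_tri[OF t] w(1)])
  have "v \<cdot> y = (x' \<cdot> w') \<cdot> y" using w(2) w'(2) assoc[OF a(2) w'(1) a(4)] by simp
  then have "v = x' \<cdot> w'" by (rule hom_into_inj[OF h xi_tri[OF t] v(1) comp_arr[OF w'(1) a(4)]])
  then have "\<psi> = (y' \<cdot> x') \<cdot> w'" using v(2) assoc[OF w'(1) a(4,5)] by simp
  then show "\<psi> = zr C C'" using tri_comp[OF xi_tri[OF t']] comp_zr_left[OF w'(1) ob(6)] by simp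
qed

lemma shift_from:
  assumes "xi A x B y C \<delta>" "xi A' x' B' y' C' \<delta>'"
    and "orth C' C" "hom_from_exact \<C> B' (A, x, B, y, C, \<delta>)"
  shows "hom_from_exact \<C> A' (A, x, B, y, C, \<delta>)"
  using proper_cat.shift_into[OF proper_cat_op, of C y B x A \<delta> C' y' B' x' A' \<delta>'] assms
  unfolding hom_exact_op by simp

text \<open>In \<open>ET4\<close> the push of \<open>\<delta>''\<close> along \<open>f\<close> is a
  base change of \<open>\<delta>'\<close>, hence in \<xi>; cosaturation along the first triangle
  then puts \<open>\<delta>''\<close> itself into \<xi>.\<close>

lemma xi_inflation_comp:
  assumes t: "xi A f B f' D \<delta>" "xi B g C g' F \<delta>'"
  obtains E h' d e \<delta>'' where "xi A (g \<cdot> f) C h' E \<delta>''" "xi D d E e F (psh F f' \<delta>')"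
proof -
  obtain E h' d e \<delta>'' where E: "arr e E F" "ext \<delta>'' E A" "tri A (g \<cdot> f) C h' E \<delta>''" "tri D d E e F (psh F f' \<delta>')"
    "psh E f \<delta>'' = pll B e \<delta>'"
    by (rule ET4[OF xi_tri[OF t(1)] xi_tri[OF t(2)]])
  have "xext (psh E f \<delta>'') E B" using E(5) xext_pull[OF xi_xext[OF t(2)] E(1)] by simp
  then have "xext \<delta>'' E A" by (rule xext_cosaturated[OF t(1) E(2)])
  then have 1: "xi A (g \<cdot> f) C h' E \<delta>''" using xext_xi E(3) by blast
  have "xi D d E e F (psh F f' \<delta>')"
    using xext_xi[OF xext_push[OF xi_xext[OF t(2)] xi_arr(2)[OF t(1)]] E(4)] .
  with 1 show thesis using that by blast
qed

lemma xi_deflation_comp: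
  assumes t: "xi D f' B f A \<delta>" "xi F g' C g B \<delta>'"
  obtains E h' d e \<delta>'' where "xi E h' C (f \<cdot> g) A \<delta>''" "xi F e E d D (pll F f' \<delta>')"
proof -
  have t': "proper_cat.xi (opt \<xi>) A f B f' D \<delta>" "proper_cat.xi (opt \<xi>) B g C g' F \<delta>'" using t by simp_all
  show thesis
    by (rule proper_cat.xi_inflation_comp[OF proper_cat_op t']) (rule that, simp_all)
qed

lemma xi_pushout:
  assumes t1: "xi A x1 B1 y1 C1 \<delta>1" and t2: "xi A x2 B2 y2 C2 \<delta>2"
  obtains M m m' F e d h k where "xi B1 m M m' C2 (psh C2 x1 \<delta>2)" "xi A e F d C2 \<delta>2"
    "xi F h M k C1 (psh C1 e \<delta>1)"
proof -
  obtain M m m' F e d h k where *: "tri B1 m M m' C2 (psh C2 x1 \<delta>2)" "tri A e F d C2 \<delta>2"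
    "tri F h M k C1 (psh C1 e \<delta>1)"
    by (rule pushout[OF xi_tri[OF t1] xi_tri[OF t2]])
  show thesis
    by (rule that[OF xext_xi[OF xext_push[OF xi_xext[OF t2] xi_arr(1)[OF t1]] *(1)] xext_xi[OF xi_xext[OF t2] *(2)]
       xext_xi[OF xext_push[OF xi_xext[OF t1] tri_arr(1)[OF *(2)]] *(3)]])
qed

lemma Zo_proj: "Zo \<in> PP"
proof (rule orth_proj[OF Zo_obj])
  fix D assume "D \<in> Obj \<C>"
  then show "orth Zo D"
    unfolding orth_def using ext_from_Zo[OF xext_ext] from_Zo by (auto simp: ghost_def)
qed

section \<open>Finite projective dimension and cosyzygies of projectives\<close>

inductive fin_proj_dim :: "'a \<Rightarrow> bool" where
  proj: "P \<in> PP \<Longrightarrow> fin_proj_dim P"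
| step: "xi L' x P y L \<delta> \<Longrightarrow> P \<in> PP \<Longrightarrow> fin_proj_dim L' \<Longrightarrow> fin_proj_dim L"

text \<open>A projective is covered by itself with kernel zero, which is again projective. Thus
  covering can be continued forever, as an unbounded resolution requires.\<close>

lemma fin_proj_dim_cover:
  assumes "fin_proj_dim L" obtains L' x P y \<delta> where "xi L' x P y L \<delta>" "P \<in> PP" "fin_proj_dim L'"
  using assms
proof cases
  case proj
  then show thesis using that[OF xi_split[OF id_tri'[OF PP_obj[OF proj]]] proj fin_proj_dim.proj[OF Zo_proj]] by blast
qed (rule that)

inductive proj_cosyzygy :: "'a \<Rightarrow> bool" where
  proj: "P \<in> PP \<Longrightarrow> proj_cosyzygy P"
| step: "xi C x I y C' \<delta> \<Longrightarrow> I \<in> II \<Longrightarrow> proj_cosyzygy C \<Longrightarrow> proj_cosyzygy C'"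

lemma proj_cosyzygy_obj: "proj_cosyzygy C \<Longrightarrow> C \<in> Obj \<C>"
  by (cases rule: proj_cosyzygy.cases) (auto dest: PP_obj xi_obj)

text \<open>
  This stands for the vanishing of all higher extension groups from \<open>E\<close> to projectives: the
  \<open>(i + 1)\<close>-st extension group with values in \<open>P\<close> is the first one with values in the \<open>i\<close>-th
  cosyzygy of \<open>P\<close>.
\<close>

definition cosyzygy_orth :: "'a \<Rightarrow> bool" where
  "cosyzygy_orth E \<longleftrightarrow> E \<in> Obj \<C> \<and> (\<forall>C. proj_cosyzygy C \<longrightarrow> orth E C)"

text \<open>Orthogonality of the syzygy \<open>E1\<close> to \<open>C\<close> is shifted from that
  of \<open>E\<close> to the cosyzygy \<open>C'\<close> of \<open>C\<close>. The class of cosyzygies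
  is closed under this step, so the property passes to all syzygies.\<close>

lemma cosyzygy_orth_syzygy:
  assumes t: "xi E1 x P y E \<delta>" and P: "P \<in> PP" and E: "cosyzygy_orth E" shows "cosyzygy_orth E1"
  unfolding cosyzygy_orth_def
proof (intro conjI allI impI)
  show o: "E1 \<in> Obj \<C>" using xi_obj[OF t] by blast
  fix C assume C: "proj_cosyzygy C"
  obtain C' i I q \<epsilon> where s: "xi C i I q C' \<epsilon>" "I \<in> II" using inj_hull[OF proj_cosyzygy_obj[OF C]] .
  have "orth E C'" using E proj_cosyzygy.step[OF s C] by (simp add: cosyzygy_orth_def)
  from shift_from[OF s(1) t this PP_from[OF P s(1)]] show "orth E1 C" by (rule from_orth[OF s o])
qed

end

context extri_cat
begin

text \<open>Trades complexes indexed by the integers for a set \<open>S\<close> closed under one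
  step to the left and one step to the right, a coinductive description in which membership is easy
  to prove. Complexes are recovered by iterating choice functions for both steps.\<close>

lemma spliced_iff:
  assumes T: "T \<subseteq> etriangles \<C>"
  shows "(\<exists>X d K n. (\<forall>k. X k \<in> P) \<and> spliced \<C> T X d K \<and> G = K n) \<longleftrightarrow>
    (\<exists>S. G \<in> S \<and> (\<forall>H\<in>S. (\<exists>H' x X y \<delta>. (H', x, X, y, H, \<delta>) \<in> T \<and> X \<in> P \<and> H' \<in> S) \<and>
       (\<exists>H' x X y \<delta>. (H, x, X, y, H', \<delta>) \<in> T \<and> X \<in> P \<and> H' \<in> S)))" (is "?L \<longleftrightarrow> ?R")
proof
  assume ?L
  then obtain X d K and n :: int and g f \<delta> where *: "\<forall>k. X k \<in> P" "G = K n"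
    "\<forall>n::int. (K (n + 1), g n, X n, f n, K n, \<delta> n) \<in> T \<and> d n = g (n - 1) \<cdot> f n"
    unfolding spliced_def by blast
  have "(\<exists>H' x X y \<delta>. (H', x, X, y, H, \<delta>) \<in> T \<and> X \<in> P \<and> H' \<in> range K) \<and>
       (\<exists>H' x X y \<delta>. (H, x, X, y, H', \<delta>) \<in> T \<and> X \<in> P \<and> H' \<in> range K)" if "H \<in> range K" for H
  proof -
    from that obtain k where k: "H = K k" by blast
    have "(K (k + 1), g k, X k, f k, H, \<delta> k) \<in> T" "(H, g (k - 1), X (k - 1), f (k - 1), K (k - 1), \<delta> (k - 1)) \<in> T"
      using *(3)[rule_format, of k] *(3)[rule_format, of "k - 1"] by (simp_all add: k)
    then show ?thesis using *(1) by blast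
  qed
  then show ?R using *(2) by (intro exI[of _ "range K"]) blast
next
  assume ?R
  then obtain S where GS: "G \<in> S" and
    SS: "\<forall>H\<in>S. (\<exists>H' x X y \<delta>. (H', x, X, y, H, \<delta>) \<in> T \<and> X \<in> P \<and> H' \<in> S) \<and>
       (\<exists>H' x X y \<delta>. (H, x, X, y, H', \<delta>) \<in> T \<and> X \<in> P \<and> H' \<in> S)" by (elim exE conjE)
  have S: "\<forall>H\<in>S. \<exists>H' x X y \<delta>. (H', x, X, y, H, \<delta>) \<in> T \<and> X \<in> P \<and> H' \<in> S"
      "\<forall>H\<in>S. \<exists>H' x X y \<delta>. (H, x, X, y, H', \<delta>) \<in> T \<and> X \<in> P \<and> H' \<in> S"
    by (intro ballI, drule SS[THEN bspec], elim conjE, assumption)+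
  obtain lo lx lX ly ld where L: "\<And>H. H \<in> S \<Longrightarrow> (lo H, lx H, lX H, ly H, H, ld H) \<in> T \<and> lX H \<in> P \<and> lo H \<in> S"
    using S(1) by metis
  obtain ro rx rX ry rd where R: "\<And>H. H \<in> S \<Longrightarrow> (H, rx H, rX H, ry H, ro H, rd H) \<in> T \<and> rX H \<in> P \<and> ro H \<in> S"
    using S(2) by metis
  define kl where "kl = (\<lambda>i. (lo ^^ i) G)"
  define kr where "kr = (\<lambda>i. (ro ^^ i) G)"
  have klS: "kl i \<in> S" for i by (induction i) (use GS L in \<open>auto simp: kl_def\<close>)
  have krS: "kr i \<in> S" for i by (induction i) (use GS R in \<open>auto simp: kr_def\<close>)
  \<comment> \<open>Left steps from \<open>G\<close> fill the indices from 0 up and right steps the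
    negative ones. The triangle at a negative index \<open>n\<close> starts at
    \<open>K (n + 1)\<close>, which is reached by \<open>- n - 1\<close> right steps; this explains
    the shift in the four definitions below.\<close>
  define K where "K = (\<lambda>n::int. if n \<ge> 0 then kl (nat n) else kr (nat (- n)))"
  define g where "g = (\<lambda>n::int. if n \<ge> 0 then lx (kl (nat n)) else rx (kr (nat (- n - 1))))"
  define X where "X = (\<lambda>n::int. if n \<ge> 0 then lX (kl (nat n)) else rX (kr (nat (- n - 1))))"
  define f where "f = (\<lambda>n::int. if n \<ge> 0 then ly (kl (nat n)) else ry (kr (nat (- n - 1))))"
  define \<delta> where "\<delta> = (\<lambda>n::int. if n \<ge> 0 then ld (kl (nat n)) else rd (kr (nat (- n - 1))))"
  have t: "(K (n + 1), g n, X n, f n, K n, \<delta> n) \<in> T" and XP: "X n \<in> P" for n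
  proof -
    consider m where "n = int m" | m where "n = - int (Suc m)"
      by (metis int_cases)
    then have "(K (n + 1), g n, X n, f n, K n, \<delta> n) \<in> T \<and> X n \<in> P"
    proof cases
      case 1
      have "K (n + 1) = lo (kl m)" by (simp add: K_def 1 kl_def nat_add_distrib)
      then show ?thesis using L[OF klS[of m]] by (simp add: K_def g_def X_def f_def \<delta>_def 1)
    next
      case 2
      have m: "nat (- n - 1) = m" "nat (- n) = Suc m" "\<not> n \<ge> 0" using 2 by auto
      have "n + 1 = - int m" using 2 by simp
      \<comment> \<open>For \<open>m = 0\<close> the index \<open>n + 1\<close> falls into the
        nonnegative branch; both iterations start at \<open>G\<close>, so they agree there.\<close>
      then have "K (n + 1) = kr m" by (cases "m = 0") (auto simp: K_def kr_def kl_def)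
      moreover have "K n = ro (kr m)" using m by (simp add: K_def kr_def)
      ultimately show ?thesis using R[OF krS[of m]] m by (simp add: g_def X_def f_def \<delta>_def)
    qed
    then show "(K (n + 1), g n, X n, f n, K n, \<delta> n) \<in> T" "X n \<in> P" by auto
  qed
  have tr: "tri (K (n + 1)) (g n) (X n) (f n) (K n) (\<delta> n)" for n using t T by (auto simp: tri_def)
  define d where "d = (\<lambda>n. g (n - 1) \<cdot> f n)"
  have ag: "arr (g (n - 1)) (K n) (X (n - 1))" for n using tri_arr(1)[OF tr[of "n - 1"]] by simp
  have af: "arr (f n) (X n) (K n)" for n using tri_arr(2)[OF tr] .
  have ad: "arr (d n) (X n) (X (n - 1))" for n unfolding d_def by (rule comp_arr[OF af ag])
  have z: "f (n - 1) \<cdot> g (n - 1) = zr (K n) (K (n - 1))" for n using tri_comp[OF tr[of "n - 1"]] by simp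
  have "d (n - 1) \<cdot> d n = zr (X n) (X (n - 2))" for n
  proof -
    have "d (n - 1) \<cdot> d n = g (n - 1 - 1) \<cdot> ((f (n - 1) \<cdot> g (n - 1)) \<cdot> f n)"
      unfolding d_def using af[of n] ag[of n] af[of "n - 1"] ag[of "n - 1"] by (simp add: csimps)
    also have "\<dots> = zr (X n) (X (n - 2))"
      unfolding z using af[of n] ag[of "n - 1"] tri_obj[OF tr[of n]] tri_obj[OF tr[of "n - 1"]]
        tri_obj[OF tr[of "n - 2"]] by (simp add: csimps)
    finally show ?thesis .
  qed
  then have "is_complex \<C> X d"
    unfolding is_complex_def using ad by (simp add: arr_def)
  then have "spliced \<C> T X d K"
    unfolding spliced_def using t by (intro conjI exI[of _ g] exI[of _ f] exI[of _ \<delta>]) (simp_all add: d_def)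
  moreover have "G = K 0" by (simp add: K_def kl_def)
  ultimately show ?L using XP by blast
qed

end

section \<open>Gorenstein projective objects\<close>

context proper_cat
begin

abbreviation GPs :: "'a set" where "GPs \<equiv> GP \<C> \<xi>"
abbreviation GIs :: "'a set" where "GIs \<equiv> GI \<C> \<xi>"

lemma contra_exact_iff: "(A, x, B, y, C, \<delta>) \<in> contra_exact \<C> \<xi> W \<longleftrightarrow>
    xi A x B y C \<delta> \<and> (\<forall>w\<in>W. hom_into_exact \<C> w (A, x, B, y, C, \<delta>))"
  unfolding contra_exact_def xi_def mem_Collect_eq by blast

lemma cov_exact_iff: "(A, x, B, y, C, \<delta>) \<in> cov_exact \<C> \<xi> W \<longleftrightarrow>
    xi A x B y C \<delta> \<and> (\<forall>w\<in>W. hom_from_exact \<C> w (A, x, B, y, C, \<delta>))"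
  unfolding cov_exact_def xi_def mem_Collect_eq by blast

lemma contra_exact_etriangles: "contra_exact \<C> \<xi> W \<subseteq> etriangles \<C>"
  and cov_exact_etriangles: "cov_exact \<C> \<xi> W \<subseteq> etriangles \<C>"
  using proper_class_conditions(1) unfolding contra_exact_def cov_exact_def by blast+

lemmas GP_iff = spliced_iff[OF contra_exact_etriangles[of PP], where P = PP]
lemmas GI_iff = spliced_iff[OF cov_exact_etriangles[of II], where P = II]

text \<open>The description by a set closed under both steps is symmetric, so no reindexing of
  complexes is needed and only the two conjuncts change places.\<close>

lemma GP_op [simp]: "GP (opc \<C>) (opt \<xi>) = GIs"
proof (rule Set.set_eqI)
  fix G
  let ?T = "cov_exact \<C> \<xi> II"
  have T: "opt ?T \<subseteq> etriangles (opc \<C>)" using cov_exact_etriangles by (auto simp: opt_def)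
  have q: "((\<exists>H' x X y \<delta>. (H, y, X, x, H', \<delta>) \<in> ?T \<and> X \<in> II \<and> H' \<in> S) \<and>
       (\<exists>H' x X y \<delta>. (H', y, X, x, H, \<delta>) \<in> ?T \<and> X \<in> II \<and> H' \<in> S)) \<longleftrightarrow>
    (\<exists>H' x X y \<delta>. (H', x, X, y, H, \<delta>) \<in> ?T \<and> X \<in> II \<and> H' \<in> S) \<and>
       (\<exists>H' x X y \<delta>. (H, x, X, y, H', \<delta>) \<in> ?T \<and> X \<in> II \<and> H' \<in> S)" for H S
    by blast
  have "G \<in> GP (opc \<C>) (opt \<xi>) \<longleftrightarrow> (\<exists>X d K n. (\<forall>k. X k \<in> II) \<and>
     spliced (opc \<C>) (opt (cov_exact \<C> \<xi> II)) X d K \<and> G = K n)"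
    unfolding GP_def by simp
  also have "\<dots> \<longleftrightarrow> (\<exists>X d K n. (\<forall>k. X k \<in> II) \<and> spliced \<C> ?T X d K \<and> G = K n)"
    unfolding GI_iff extri_cat.spliced_iff[OF extri_cat_op T] opt_iff by (simp only: q)
  also have "\<dots> \<longleftrightarrow> G \<in> GIs" unfolding GI_def by simp
  finally show "G \<in> GP (opc \<C>) (opt \<xi>) \<longleftrightarrow> G \<in> GIs" .
qed

lemma GP_unfold:
  assumes "G \<in> GPs"
  shows "\<exists>H x X y \<delta>. (H, x, X, y, G, \<delta>) \<in> contra_exact \<C> \<xi> PP \<and> X \<in> PP \<and> H \<in> GPs"
    and "\<exists>H x X y \<delta>. (G, x, X, y, H, \<delta>) \<in> contra_exact \<C> \<xi> PP \<and> X \<in> PP \<and> H \<in> GPs"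
proof -
  have "\<exists>X d K n. (\<forall>k. X k \<in> PP) \<and> spliced \<C> (contra_exact \<C> \<xi> PP) X d K \<and> G = K n"
    using assms by (simp add: GP_def)
  then obtain S where S: "G \<in> S" and *: "\<forall>H\<in>S. (\<exists>H' x X y \<delta>. (H', x, X, y, H, \<delta>) \<in> contra_exact \<C> \<xi> PP \<and> X \<in> PP \<and> H' \<in> S) \<and>
       (\<exists>H' x X y \<delta>. (H, x, X, y, H', \<delta>) \<in> contra_exact \<C> \<xi> PP \<and> X \<in> PP \<and> H' \<in> S)"
    unfolding GP_iff by (elim exE conjE)
  have SG: "H \<in> GPs" if "H \<in> S" for H
    unfolding GP_def mem_Collect_eq GP_iff using that * by (intro exI[of _ S] conjI)
  from bspec[OF * S] obtain H x X y \<delta> H' x' X' y' \<delta>' where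
    1: "(H, x, X, y, G, \<delta>) \<in> contra_exact \<C> \<xi> PP" "X \<in> PP" "H \<in> S" and
    2: "(G, x', X', y', H', \<delta>') \<in> contra_exact \<C> \<xi> PP" "X' \<in> PP" "H' \<in> S" by (elim conjE exE)
  show "\<exists>H x X y \<delta>. (H, x, X, y, G, \<delta>) \<in> contra_exact \<C> \<xi> PP \<and> X \<in> PP \<and> H \<in> GPs"
    using 1 SG by blast
  show "\<exists>H x X y \<delta>. (G, x, X, y, H, \<delta>) \<in> contra_exact \<C> \<xi> PP \<and> X \<in> PP \<and> H \<in> GPs"
    using 2 SG by blast
qed

lemma GP_left:
  assumes "G \<in> GPs"
  obtains H x X y \<delta> where "xi H x X y G \<delta>" "X \<in> PP" "H \<in> GPs"
    "\<forall>W\<in>PP. hom_into_exact \<C> W (H, x, X, y, G, \<delta>)"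
  using GP_unfold(1)[OF assms] unfolding contra_exact_iff by blast

lemma GP_right:
  assumes "G \<in> GPs"
  obtains H x X y \<delta> where "xi G x X y H \<delta>" "X \<in> PP" "H \<in> GPs"
  using GP_unfold(2)[OF assms] unfolding contra_exact_iff by blast

lemma GI_left:
  assumes "G \<in> GIs"
  obtains H x X y \<delta> where "xi H x X y G \<delta>" "X \<in> II" "H \<in> GIs"
proof -
  have "G \<in> GP (opc \<C>) (opt \<xi>)" using assms by simp
  then show thesis
    by (rule proper_cat.GP_right[OF proper_cat_op]) (simp only: xi_op xi_projectives_op GP_op, rule that)
qed

text \<open>Closes \<open>S\<close> under syzygies. A right step of a new member is the triangle
  that introduced it, and left steps are projective covers.\<close>

inductive iterated_syzygy :: "'a set \<Rightarrow> 'a \<Rightarrow> bool" for S where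
  base: "E \<in> S \<Longrightarrow> iterated_syzygy S E"
| step: "xi E x X y E' \<delta> \<Longrightarrow> X \<in> PP \<Longrightarrow> iterated_syzygy S E' \<Longrightarrow> iterated_syzygy S E"

text \<open>Only embeddings into projectives have to be exhibited. The left half of the complete
  resolution consists of projective covers, and exactness into projectives is automatic since every
  member is orthogonal to all of them by \<open>cosyzygy_orth\<close>.\<close>

lemma GP_coinduct:
  assumes S: "\<And>E. E \<in> S \<Longrightarrow> cosyzygy_orth E"
      "\<And>E. E \<in> S \<Longrightarrow> \<exists>x X y E' \<delta>. xi E x X y E' \<delta> \<and> X \<in> PP \<and> E' \<in> S"
    and G: "iterated_syzygy S G"
  shows "G \<in> GPs"
proof -
  have p: "cosyzygy_orth E" if "iterated_syzygy S E" for E using that by induction (use S(1) cosyzygy_orth_syzygy in blast)+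
  have "(\<exists>H' x X y \<delta>. (H', x, X, y, E, \<delta>) \<in> contra_exact \<C> \<xi> PP \<and> X \<in> PP \<and> H' \<in> Collect (iterated_syzygy S)) \<and>
       (\<exists>H' x X y \<delta>. (E, x, X, y, H', \<delta>) \<in> contra_exact \<C> \<xi> PP \<and> X \<in> PP \<and> H' \<in> Collect (iterated_syzygy S))"
    if E: "iterated_syzygy S E" for E
  proof
    have c: "(A, x, B, y, D, \<delta>) \<in> contra_exact \<C> \<xi> PP" if "xi A x B y D \<delta>" "iterated_syzygy S D" for A x B y D \<delta>
      unfolding contra_exact_iff
    proof (intro conjI ballI)
      fix W assume "W \<in> PP"
      then have "orth D W" using p[OF that(2)] proj_cosyzygy.proj by (simp add: cosyzygy_orth_def)
      then show "hom_into_exact \<C> W (A, x, B, y, D, \<delta>)" using orth_into[OF _ that(1)] by blast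
    qed (rule that)
    have "E \<in> Obj \<C>" using p[OF E] by (simp add: cosyzygy_orth_def)
    then obtain K x P y \<delta> where t: "xi K x P y E \<delta>" "P \<in> PP" by (rule proj_cover)
    show "\<exists>H' x X y \<delta>. (H', x, X, y, E, \<delta>) \<in> contra_exact \<C> \<xi> PP \<and> X \<in> PP \<and> H' \<in> Collect (iterated_syzygy S)"
      using c[OF t(1) E] t(2) iterated_syzygy.step[OF t E] by blast
    obtain x X y E' \<delta> where "xi E x X y E' \<delta>" "X \<in> PP" "iterated_syzygy S E'"
      using E
    proof cases
      case base
      from S(2)[OF base] show thesis using that iterated_syzygy.base by blast
    qed (rule that)
    then show "\<exists>H' x X y \<delta>. (E, x, X, y, H', \<delta>) \<in> contra_exact \<C> \<xi> PP \<and> X \<in> PP \<and> H' \<in> Collect (iterated_syzygy S)"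
      using c by blast
  qed
  then show ?thesis
    unfolding GP_def mem_Collect_eq GP_iff using G by (intro exI[of _ "Collect (iterated_syzygy S)"]) simp
qed

lemma PP_GP: assumes "P \<in> PP" shows "P \<in> GPs"
proof (rule GP_coinduct[OF _ _ iterated_syzygy.base[OF assms]])
  fix E assume E: "E \<in> PP"
  show "cosyzygy_orth E" unfolding cosyzygy_orth_def using PP_obj[OF E] proj_orth[OF E] proj_cosyzygy_obj by blast
  show "\<exists>x X y E' \<delta>. xi E x X y E' \<delta> \<and> X \<in> PP \<and> E' \<in> PP"
    using xi_split[OF id_tri[OF PP_obj[OF E]]] E Zo_proj by blast
qed

text \<open>For a projective this is the exactness built into the definition of \<open>GP\<close>.
  Each further cosyzygy is reached by \<open>shift_into\<close> at the price of replacing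
  \<open>G\<close> by its syzygy, so the induction is over all \<open>G\<close>.\<close>

lemma GP_orth_cosyzygy: assumes "proj_cosyzygy C" "G \<in> GPs" shows "orth G C"
  using assms
proof (induction arbitrary: G)
  case (proj P)
  obtain H x X y \<delta> where "xi H x X y G \<delta>" "X \<in> PP" "H \<in> GPs"
    "\<forall>W\<in>PP. hom_into_exact \<C> W (H, x, X, y, G, \<delta>)"
    using GP_left[OF proj(2)] .
  then show ?case using into_orth[OF _ _ PP_obj[OF proj(1)]] proj(1) by blast
next
  case (step C i I q C' \<epsilon>)
  obtain H x X y \<delta> where t: "xi H x X y G \<delta>" "X \<in> PP" "H \<in> GPs" using GP_left[OF step(5)] .
  show ?case
    by (rule into_orth[OF t(1,2) xi_obj(3)[OF step(1)] shift_into[OF t(1) step(1) step(4)[OF t(3)] II_into[OF step(2) t(1)]]])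
qed

lemma GP_cosyzygy_orth: assumes "G \<in> GPs" shows "cosyzygy_orth G"
proof -
  have "orth G Zo" by (rule GP_orth_cosyzygy[OF proj_cosyzygy.proj[OF Zo_proj] assms])
  then show ?thesis unfolding cosyzygy_orth_def using GP_orth_cosyzygy[OF _ assms] orthD(3) by blast
qed

lemma GP_syzygy: assumes "xi E x P y G \<delta>" "P \<in> PP" "G \<in> GPs" shows "E \<in> GPs"
proof (rule GP_coinduct[OF GP_cosyzygy_orth _ iterated_syzygy.step[OF assms(1,2) iterated_syzygy.base[OF assms(3)]]])
  fix E assume E: "E \<in> GPs"
  obtain H x X y \<delta> where "xi E x X y H \<delta>" "X \<in> PP" "H \<in> GPs" using GP_right[OF E] .
  then show "\<exists>x X y E' \<delta>. xi E x X y E' \<delta> \<and> X \<in> PP \<and> E' \<in> GPs" by blast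
qed

text \<open>Coinduction on the class of all such extensions. The point is a horseshoe on the right:
  \<open>E\<close> must embed into a projective so that the cokernel is again an extension of
  Gorenstein projectives. It is built by two pushouts, along \<open>G \<rightarrow> X\<close> and
  then along \<open>H \<rightarrow> Y\<close>.\<close>

lemma GP_extension:
  assumes "xi G b E c H \<delta>" "G \<in> GPs" "H \<in> GPs" shows "E \<in> GPs"
proof -
  define S where "S = {E. \<exists>G b c H \<delta>. xi G b E c H \<delta> \<and> G \<in> GPs \<and> H \<in> GPs}"
  show ?thesis
  proof (rule GP_coinduct[of S, OF _ _ iterated_syzygy.base])
    show "E \<in> S" using assms unfolding S_def by blast
  next
    fix E assume "E \<in> S"
    then obtain G b c H \<delta> where t: "xi G b E c H \<delta>" "G \<in> GPs" "H \<in> GPs" unfolding S_def by blast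
    show "cosyzygy_orth E"
      using orth_extension[OF t(1)] GP_cosyzygy_orth[OF t(2)] GP_cosyzygy_orth[OF t(3)] xi_obj(2)[OF t(1)]
      unfolding cosyzygy_orth_def by blast
    obtain G' x X y \<epsilon> where g: "xi G x X y G' \<epsilon>" "X \<in> PP" "G' \<in> GPs" using GP_right[OF t(2)] .
    obtain H' x1 Y y1 \<eta> where h: "xi H x1 Y y1 H' \<eta>" "Y \<in> PP" "H' \<in> GPs" using GP_right[OF t(3)] .
    obtain M m m' F e d u k where M: "xi E m M m' G' (psh G' b \<epsilon>)" "xi G e F d G' \<epsilon>" "xi F u M k H (psh H e \<delta>)"
      using xi_pushout[OF t(1) g(1)] .
    have F: "F \<in> PP" by (rule proj_iso[OF xi_tri[OF g(1)] xi_tri[OF M(2)] g(2)])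
    \<comment> \<open>\<open>M\<close> is an extension of \<open>H\<close> by the projective
      \<open>F\<close>; it splits by orthogonality, so \<open>H\<close> becomes the first term of a
      triangle on \<open>M\<close> and can be pushed into \<open>Y\<close>.\<close>
    have "orth H F" by (rule GP_orth_cosyzygy[OF proj_cosyzygy.proj[OF F] t(3)])
    then have z: "psh H e \<delta> = ze H F" by (rule orthD(1)[OF _ xi_xext[OF M(3)]])
    have o: "H \<in> Obj \<C>" using xi_obj(3)[OF M(3)] .
    have tz: "tri F u M k H (ze H F)" using xi_tri[OF M(3)] z by simp
    have "pll F (Id H) (ze H F) = ze H F" using pull_id[OF ze_ext] o PP_obj[OF F] by blast
    then obtain s where s: "arr s H M" "k \<cdot> s = Id H" by (rule lift[OF tz id_arr[OF o]])
    obtain p where p: "arr p M F" "biproduct \<C> F H M u s p k" by (rule split_biproduct[OF tz s])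
    have ts: "xi H s M p F (ze F H)" using xi_split[OF biprod_tri[OF biproduct_swap[OF p(2)]]] .
    obtain N n n' F2 e2 d2 u2 k2 where N: "xi M n N n' H' (psh H' s \<eta>)" "xi H e2 F2 d2 H' \<eta>"
      "xi F2 u2 N k2 F (psh F e2 (ze F H))"
      using xi_pushout[OF ts h(1)] .
    have F2: "F2 \<in> PP" by (rule proj_iso[OF xi_tri[OF h(1)] xi_tri[OF N(2)] h(2)])
    have Np: "N \<in> PP" by (rule proj_extension[OF N(3) F2 F])
    \<comment> \<open>The cokernels \<open>G'\<close> and \<open>H'\<close> of the two inflations
      \<open>E \<rightarrow> M \<rightarrow> N\<close> are the outer terms of the cokernel of their
      composite.\<close>
    obtain E' h' dd ee \<delta>' where E': "xi E (n \<cdot> m) N h' E' \<delta>'" "xi G' dd E' ee H' (psh H' m' (psh H' s \<eta>))"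
      using xi_inflation_comp[OF M(1) N(1)] .
    have "E' \<in> S" unfolding S_def using E'(2) g(3) h(3) by blast
    then show "\<exists>x X y E' \<delta>. xi E x X y E' \<delta> \<and> X \<in> PP \<and> E' \<in> S" using E'(1) Np by blast
  qed
qed

text \<open>Isomorphism invariance is a degenerate case of closure under extensions, with zero as
  third term.\<close>

lemma GP_iso:
  assumes "tri A x G y C \<delta>" "tri A x' G' y' C \<delta>" "G \<in> GPs" shows "G' \<in> GPs"
proof -
  obtain b b' where b: "arr b G G'" "arr b' G' G" "b' \<cdot> b = Id G" "b \<cdot> b' = Id G'" using tri_equiv[OF assms(1,2)] .
  show ?thesis by (rule GP_extension[OF xi_split[OF iso_tri[OF b]] assms(3) PP_GP[OF Zo_proj]])
qed

text \<open>The shift runs along projective covers of \<open>L\<close>, where exactness into the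
  middle term is the condition contained in the definition of \<open>GP\<close>.\<close>

lemma GP_orth_fin_proj_dim: assumes "fin_proj_dim L" "G \<in> GPs" shows "orth G L"
  using assms
proof (induction arbitrary: G)
  case (proj P)
  then show ?case using GP_orth_cosyzygy proj_cosyzygy.proj by blast
next
  case (step L' l P p L \<epsilon>)
  obtain H x X y \<delta> where t: "xi H x X y G \<delta>" "X \<in> PP" "H \<in> GPs"
    "\<forall>W\<in>PP. hom_into_exact \<C> W (H, x, X, y, G, \<delta>)" using GP_left[OF step(5)] .
  show ?case
    by (rule into_orth[OF t(1,2) xi_obj(3)[OF step(1)] shift_into[OF t(1) step(1) step(4)[OF t(3)] bspec[OF t(4) step(2)]]])
qed

lemma GI_obj: "I \<in> GIs \<Longrightarrow> I \<in> Obj \<C>"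
  by (erule GI_left) (rule xi_obj(3))

text \<open>\<open>L\<close> and \<open>I\<close> are shifted together: the syzygy of
  \<open>L\<close> is compared with the term \<open>J\<close> to the left of \<open>I\<close> in its
  complete coresolution, so \<open>I\<close> varies in the induction.\<close>

lemma fin_proj_dim_orth_GI: assumes "fin_proj_dim L" "I \<in> GIs" shows "orth L I"
  using assms
proof (induction arbitrary: I)
  case (proj P)
  then show ?case using proj_orth GI_obj by blast
next
  case (step L' l P p L \<epsilon>)
  obtain J x E y \<delta> where t: "xi J x E y I \<delta>" "E \<in> II" "J \<in> GIs" using GI_left[OF step(5)] .
  show ?case
    by (rule into_orth[OF step(1,2) xi_obj(3)[OF t(1)] shift_into[OF step(1) t(1) step(4)[OF t(3)] II_into[OF t(2) step(1)]]])
qed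

section \<open>Approximation of objects of finite Gorenstein projective dimension, in the style of
  Auslander and Buchweitz\<close>

definition fpd_embedding :: "'a \<Rightarrow> bool" where
  "fpd_embedding M \<longleftrightarrow> (\<exists>x L y G \<delta>. xi M x L y G \<delta> \<and> fin_proj_dim L \<and> G \<in> GPs)"

definition special_precover :: "'a \<Rightarrow> bool" where
  "special_precover M \<longleftrightarrow> (\<exists>L x E y \<delta>. xi L x E y M \<delta> \<and> fin_proj_dim L \<and> E \<in> GPs)"

text \<open>Compose a projective cover of \<open>L\<close> with \<open>L \<rightarrow> G\<close>.
  The kernel of the composite is a syzygy of \<open>G\<close>, hence Gorenstein projective, and
  \<open>ET4_op\<close> presents it as an extension of \<open>M\<close> by the syzygy of
  \<open>L\<close>.\<close>

lemma fpd_embedding_precover: assumes "fpd_embedding M" shows "special_precover M"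
proof -
  obtain x L y G \<delta> where t: "xi M x L y G \<delta>" "fin_proj_dim L" "G \<in> GPs" using assms unfolding fpd_embedding_def by blast
  obtain L' f P g \<epsilon> where s: "xi L' f P g L \<epsilon>" "P \<in> PP" "fin_proj_dim L'" using fin_proj_dim_cover[OF t(2)] .
  obtain E h' d e \<delta>'' where "xi E h' P (y \<cdot> g) G \<delta>''" "xi L' e E d M (pll L' x \<epsilon>)"
    using xi_deflation_comp[OF t(1) s(1)] .
  then show ?thesis unfolding special_precover_def using GP_syzygy s t by blast
qed

text \<open>Embed \<open>E\<close> into a projective \<open>X\<close>. The cokernel of
  \<open>L \<rightarrow> X\<close> has finite projective dimension, and it contains \<open>M\<close>
  with cokernel \<open>E'\<close>.\<close>

lemma special_precover_embedding: assumes "special_precover M" shows "fpd_embedding M"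
proof -
  obtain L x E y \<delta> where t: "xi L x E y M \<delta>" "fin_proj_dim L" "E \<in> GPs" using assms unfolding special_precover_def by blast
  obtain E' f X g \<epsilon> where s: "xi E f X g E' \<epsilon>" "X \<in> PP" "E' \<in> GPs" using GP_right[OF t(3)] .
  obtain T h' d e \<delta>'' where "xi L (f \<cdot> x) X h' T \<delta>''" "xi M d T e E' (psh E' y \<epsilon>)"
    using xi_inflation_comp[OF t(1) s(1)] .
  then show ?thesis unfolding fpd_embedding_def using fin_proj_dim.step s t by blast
qed

text \<open>The induction carries the embedding form since this is what can be pushed out: pushing
  \<open>K \<rightarrow> L\<close> against \<open>K \<rightarrow> G\<close> gives an object that is
  an extension of \<open>M\<close> by \<open>L\<close> and also one of \<open>G1\<close> by a copy
  of \<open>G\<close>, hence a precover of \<open>M\<close>.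
  \<open>special_precover_embedding\<close> restores the form of the hypothesis.\<close>

lemma Gpd_le_embedding: "Gpd_le \<C> \<xi> M n \<Longrightarrow> fpd_embedding M"
proof (induction n arbitrary: M)
  case 0
  then have M: "M \<in> GPs" by simp
  obtain H x X y \<delta> where "xi M x X y H \<delta>" "X \<in> PP" "H \<in> GPs" using GP_right[OF M] .
  then show ?case unfolding fpd_embedding_def using fin_proj_dim.proj by blast
next
  case (Suc n)
  then obtain K x G y \<delta> where t: "xi K x G y M \<delta>" "G \<in> GPs" "Gpd_le \<C> \<xi> K n" unfolding xi_def by auto
  obtain l L q G1 \<epsilon> where s: "xi K l L q G1 \<epsilon>" "fin_proj_dim L" "G1 \<in> GPs" using Suc.IH[OF t(3)] unfolding fpd_embedding_def by blast
  obtain E m m' F e d u k where E: "xi L m E m' M (psh M l \<delta>)" "xi K e F d M \<delta>" "xi F u E k G1 (psh G1 e \<epsilon>)"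
    using xi_pushout[OF s(1) t(1)] .
  have "F \<in> GPs" by (rule GP_iso[OF xi_tri[OF t(1)] xi_tri[OF E(2)] t(2)])
  then have "E \<in> GPs" using GP_extension[OF E(3) _ s(3)] by blast
  then have "special_precover M" unfolding special_precover_def using E(1) s(2) by blast
  then show ?case by (rule special_precover_embedding)
qed

lemma GP_finite_precover: assumes "M \<in> GP_finite \<C> \<xi>" shows "special_precover M"
proof -
  have 1: "Gpd \<C> \<xi> M \<noteq> \<infinity>" using assms by (auto simp: GP_finite_def)
  \<comment> \<open>The infimum of the empty set in the extended naturals is the top element, so a
    finite dimension provides an actual bound.\<close>
  have 2: "Gpd \<C> \<xi> M = \<infinity>" if e: "{n. Gpd_le \<C> \<xi> M n} = {}"
    unfolding Gpd_def e by (simp add: top_enat_def)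
  have "{n. Gpd_le \<C> \<xi> M n} \<noteq> {}" using 1 by (rule contrapos_nn) (rule 2)
  then obtain n where "Gpd_le \<C> \<xi> M n" by auto
  then show ?thesis by (rule fpd_embedding_precover[OF Gpd_le_embedding])
qed

end

section \<open>Gorenstein resolutions\<close>

context proper_cat
begin

lemma fin_proj_dim_cov_exact:
  assumes "xi L x E y M \<delta>" "fin_proj_dim L" shows "(L, x, E, y, M, \<delta>) \<in> cov_exact \<C> \<xi> GPs"
  unfolding cov_exact_iff using assms orth_from[OF GP_orth_fin_proj_dim[OF assms(2)] assms(1)] by blast

text \<open>Continue the special precover with projective covers of its kernel. All later syzygies
  have finite projective dimension, which gives exactness under maps from Gorenstein projectives at
  every stage.\<close>

lemma GP_resolution_exists:
  assumes "special_precover M" shows "\<exists>G d. GP_resolution \<C> \<xi> M G d"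
proof -
  obtain L x E y \<delta> where t: "xi L x E y M \<delta>" "fin_proj_dim L" "E \<in> GPs" using assms unfolding special_precover_def by blast
  have "\<forall>L\<in>Collect fin_proj_dim. \<exists>L' x P y \<delta>. xi L' x P y L \<delta> \<and> P \<in> PP \<and> fin_proj_dim L'"
  proof
    fix L assume "L \<in> Collect fin_proj_dim"
    then have "fin_proj_dim L" by simp
    then obtain L' x P y \<delta> where "xi L' x P y L \<delta>" "P \<in> PP" "fin_proj_dim L'" by (rule fin_proj_dim_cover)
    then show "\<exists>L' x P y \<delta>. xi L' x P y L \<delta> \<and> P \<in> PP \<and> fin_proj_dim L'" by blast
  qed
  then obtain cl cx cP cy cd where
    c: "\<forall>L\<in>Collect fin_proj_dim. xi (cl L) (cx L) (cP L) (cy L) L (cd L) \<and> cP L \<in> PP \<and> fin_proj_dim (cl L)" by metis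
  define \<Omega> where "\<Omega> = (\<lambda>i::nat. (cl ^^ i) L)"
  have f: "fin_proj_dim (\<Omega> i)" for i by (induction i) (use t(2) c in \<open>auto simp: \<Omega>_def\<close>)
  have c': "xi (\<Omega> (Suc i)) (cx (\<Omega> i)) (cP (\<Omega> i)) (cy (\<Omega> i)) (\<Omega> i) (cd (\<Omega> i))" "cP (\<Omega> i) \<in> GPs" for i
    using c f[of i] PP_GP by (auto simp: \<Omega>_def)
  define K where "K = case_nat M \<Omega>"
  define G where "G = case_nat E (\<lambda>i. cP (\<Omega> i))"
  define g where "g = case_nat x (\<lambda>i. cx (\<Omega> i))"
  define h where "h = case_nat y (\<lambda>i. cy (\<Omega> i))"
  define D where "D = case_nat \<delta> (\<lambda>i. cd (\<Omega> i))"
  define d where "d = case_nat (h 0) (\<lambda>i. g i \<cdot> h (Suc i))"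
  have "(K (Suc i), g i, G i, h i, K i, D i) \<in> cov_exact \<C> \<xi> GPs" for i
  proof (cases i)
    case 0
    have "\<Omega> 0 = L" by (simp add: \<Omega>_def)
    then show ?thesis using fin_proj_dim_cov_exact[OF t(1,2)] by (simp add: 0 K_def g_def G_def h_def D_def)
  next
    case (Suc j)
    then show ?thesis using fin_proj_dim_cov_exact[OF c'(1) f] by (simp add: K_def g_def G_def h_def D_def)
  qed
  moreover have "G i \<in> GPs" for i using t(3) c'(2) by (cases i) (simp_all add: G_def)
  moreover have "K 0 = M" "d 0 = h 0" "\<And>i. d (Suc i) = g i \<cdot> h (Suc i)" by (simp_all add: K_def d_def)
  ultimately have "GP_resolution \<C> \<xi> M G d"
    unfolding GP_resolution_def by blast
  then show ?thesis by blast
qed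

text \<open>
  Syzygies in an arbitrary resolution of \<open>M\<close> agree with those of a special one only up to Gorenstein
  projective summands.  Factoring the identity through \<open>L \<oplus> H\<close> is all that is needed of this.
\<close>

definition fpd_GP_summand :: "'a \<Rightarrow> bool" where
  "fpd_GP_summand K \<longleftrightarrow> (\<exists>L H r s r' s'. fin_proj_dim L \<and> H \<in> GPs \<and> arr s K L \<and> arr r L K \<and> arr s' K H \<and> arr r' H K \<and>
     Id K = (r' \<cdot> s') \<otimes>\<^bsub>Hom \<C> K K\<^esub> (r \<cdot> s))"

text \<open>If \<beta> after \<beta>' fixes \<delta>, its difference from the identity kills
  \<delta> and so extends along \<open>g\<close>: it factors through the Gorenstein projective
  \<open>G\<close>.\<close>

lemma fpd_GP_summandI:
  assumes t: "tri K g G f C \<delta>" and b: "arr \<beta> L K" "arr \<beta>' K L" "psh C (\<beta> \<cdot> \<beta>') \<delta> = \<delta>"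
    and "fin_proj_dim L" "G \<in> GPs"
  shows "fpd_GP_summand K"
proof -
  have bb: "arr (\<beta> \<cdot> \<beta>') K K" by (rule comp_arr[OF b(2,1)])
  obtain w where w: "arr w K K" "Id K = w \<otimes>\<^bsub>Hom \<C> K K\<^esub> (\<beta> \<cdot> \<beta>')"
    using diff_arr[OF id_arr[OF tri_obj(1)[OF t]] bb] .
  have "\<delta> = psh C w \<delta> \<otimes>\<^bsub>Ext \<C> C K\<^esub> \<delta>"
    using push_sum[OF tri_arr(3)[OF t] w(1) bb] b(3) w(2) push_id[OF tri_arr(3)[OF t]] by simp
  then have "psh C w \<delta> = ze C K" by (rule ext_cancel[OF push_ext[OF tri_arr(3)[OF t] w(1)] tri_arr(3)[OF t]])
  then obtain h where "arr h G K" "h \<cdot> g = w" by (rule extend[OF t w(1)])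
  then have "fin_proj_dim L \<and> G \<in> GPs \<and> arr \<beta>' K L \<and> arr \<beta> L K \<and> arr g K G \<and> arr h G K \<and>
     Id K = (h \<cdot> g) \<otimes>\<^bsub>Hom \<C> K K\<^esub> (\<beta> \<cdot> \<beta>')" using assms(5,6) b(1,2) w(2) tri_arr(1)[OF t] by simp
  then show ?thesis unfolding fpd_GP_summand_def by blast
qed

lemma cov_exactD:
  assumes "(A, x, B, y, C, \<delta>) \<in> cov_exact \<C> \<xi> GPs"
  shows "xi A x B y C \<delta>" "G \<in> GPs \<Longrightarrow> hom_from_exact \<C> G (A, x, B, y, C, \<delta>)"
  using assms unfolding cov_exact_iff by blast+

text \<open>\<open>E\<close> is Gorenstein projective, so \<open>c \<cdot> y\<close> lifts through
  \<open>f\<close>; \<open>ET3_op\<close> completes the square to a map of kernels.\<close>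

lemma cov_comparison:
  assumes t0: "xi L x E y M \<delta>0" "E \<in> GPs" and t: "(K, g, G, f, C, \<delta>) \<in> cov_exact \<C> \<xi> GPs"
    and c: "arr c M C"
  obtains \<alpha> \<beta> where "arr \<alpha> E G" "arr \<beta> L K" "f \<cdot> \<alpha> = c \<cdot> y" "psh M \<beta> \<delta>0 = pll K c \<delta>"
proof -
  note x = cov_exactD(1)[OF t]
  have "arr (c \<cdot> y) E C" by (rule comp_arr[OF xi_arr(2)[OF t0(1)] c])
  then obtain \<alpha> where a: "arr \<alpha> E G" "f \<cdot> \<alpha> = c \<cdot> y" by (rule hom_fromD[OF cov_exactD(2)[OF t t0(2)] xi_tri[OF x]])
  obtain \<beta> where "arr \<beta> L K" "psh M \<beta> \<delta>0 = pll K c \<delta>"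
    by (rule ET3_op[OF xi_tri[OF t0(1)] xi_tri[OF x] c a(1) a(2)[symmetric]])
  with a show thesis using that by blast
qed

text \<open>The special triangle is exact by dimension shifting, and the comparison pushes its
  extension to \<delta>. Hence the obstruction to extending \<open>u\<close> equals the one for
  \<open>u\<close> after \<beta>, which vanishes, and injectivity is inherited through
  \<alpha>.\<close>

lemma special_precover_into:
  assumes "special_precover M" and t: "(K, g, G, f, M, \<delta>) \<in> cov_exact \<C> \<xi> GPs" and W: "W \<in> GIs"
  shows "hom_into_exact \<C> W (K, g, G, f, M, \<delta>)"
proof -
  note x = cov_exactD(1)[OF t]
  obtain L x0 E y0 \<delta>0 where t0: "xi L x0 E y0 M \<delta>0" "fin_proj_dim L" "E \<in> GPs" using assms(1) unfolding special_precover_def by blast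
  obtain J j I q \<epsilon> where s: "xi J j I q W \<epsilon>" "I \<in> II" "J \<in> GIs" using GI_left[OF W] .
  have h0: "hom_into_exact \<C> W (L, x0, E, y0, M, \<delta>0)"
    by (rule shift_into[OF t0(1) s(1) fin_proj_dim_orth_GI[OF t0(2) s(3)] II_into[OF s(2) t0(1)]])
  have o: "M \<in> Obj \<C>" using xi_obj[OF x] by blast
  obtain \<alpha> \<beta> where ab: "arr \<alpha> E G" "arr \<beta> L K" "f \<cdot> \<alpha> = Id M \<cdot> y0" "psh M \<beta> \<delta>0 = pll K (Id M) \<delta>"
    by (rule cov_comparison[OF t0(1,3) t id_arr[OF o]])
  have b: "psh M \<beta> \<delta>0 = \<delta>" using ab(4) pull_id[OF xi_arr(3)[OF x]] by simp
  have a: "f \<cdot> \<alpha> = y0" using ab(3) id_left[OF xi_arr(2)[OF t0(1)]] by simp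
  show ?thesis
    unfolding hom_into_iff[OF xi_tri[OF x] GI_obj[OF W]]
  proof (intro conjI allI impI)
    fix u assume u: "arr u K W"
    obtain v where v: "arr v E W" "v \<cdot> x0 = u \<cdot> \<beta>" by (rule hom_intoD[OF h0 xi_tri[OF t0(1)] comp_arr[OF ab(2) u]])
    have "psh M u \<delta> = psh M (u \<cdot> \<beta>) \<delta>0" using push_comp[OF xi_arr(3)[OF t0(1)] ab(2) u] b by simp
    also have "\<dots> = ze M W" using extend_push[OF xi_tri[OF t0(1)] v(1)] v(2) by simp
    finally obtain v where "arr v G W" "v \<cdot> g = u" by (rule extend[OF xi_tri[OF x] u])
    then show "\<exists>v. arr v G W \<and> v \<cdot> g = u" by blast
  next
    fix \<psi> assume p: "arr \<psi> M W \<and> \<psi> \<cdot> f = zr G W"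
    have "\<psi> \<cdot> y0 = (\<psi> \<cdot> f) \<cdot> \<alpha>" using assoc[OF ab(1) xi_arr(2)[OF x] conjunct1[OF p]] a by simp
    also have "\<dots> = zr E W" using p comp_zr_left[OF ab(1) GI_obj[OF W]] by simp
    finally show "\<psi> = zr M W" using h0 p unfolding hom_into_iff[OF xi_tri[OF t0(1)] GI_obj[OF W]] by blast
  qed
qed

text \<open>Both triangles are exact under maps from Gorenstein projectives, so comparisons exist in
  both directions, and the round trip fixes \<delta>.\<close>

lemma special_precover_summand:
  assumes "special_precover M" and t: "(K, g, G, f, M, \<delta>) \<in> cov_exact \<C> \<xi> GPs" and G: "G \<in> GPs"
  shows "fpd_GP_summand K"
proof -
  note x = cov_exactD(1)[OF t]
  obtain L x0 E y0 \<delta>0 where t0: "xi L x0 E y0 M \<delta>0" "fin_proj_dim L" "E \<in> GPs" using assms(1) unfolding special_precover_def by blast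
  have o: "M \<in> Obj \<C>" using xi_obj[OF x] by blast
  obtain \<beta> where b: "arr \<beta> L K" "psh M \<beta> \<delta>0 = pll K (Id M) \<delta>"
    by (rule cov_comparison[OF t0(1,3) t id_arr[OF o]])
  obtain \<beta>' where b': "arr \<beta>' K L" "psh M \<beta>' \<delta> = pll L (Id M) \<delta>0"
    by (rule cov_comparison[OF x G fin_proj_dim_cov_exact[OF t0(1,2)] id_arr[OF o]])
  have "psh M (\<beta> \<cdot> \<beta>') \<delta> = \<delta>"
    using push_comp[OF xi_arr(3)[OF x] b'(1) b(1)] b(2) b'(2) pull_id[OF xi_arr(3)[OF t0(1)]] pull_id[OF xi_arr(3)[OF x]]
    by simp
  then show ?thesis by (rule fpd_GP_summandI[OF xi_tri[OF x] b(1) b'(1) _ t0(2) G])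
qed

text \<open>The part of the identity through \<open>H\<close> contributes nothing: \<open>r'\<close>
  lifts through \<open>f\<close>, so \<delta> vanishes on \<open>H\<close>. Thus \<delta> is seen
  entirely on \<open>L\<close>.\<close>

lemma fpd_GP_summand_pull:
  assumes t: "(K1, g, G, f, K, \<delta>) \<in> cov_exact \<C> \<xi> GPs" and H: "H \<in> GPs" "arr r' H K" "arr s' K H"
    and rs: "arr r L K" "arr s K L" "Id K = (r' \<cdot> s') \<otimes>\<^bsub>Hom \<C> K K\<^esub> (r \<cdot> s)"
  shows "\<delta> = pll K1 s (pll K1 r \<delta>)"
proof -
  note x = cov_exactD(1)[OF t]
  note e = xi_arr(3)[OF x]
  have o: "K1 \<in> Obj \<C>" using xi_obj[OF x] by blast
  obtain v where v: "arr v H G" "f \<cdot> v = r'" by (rule hom_fromD[OF cov_exactD(2)[OF t H(1)] xi_tri[OF x] H(2)])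
  have z: "pll K1 r' \<delta> = ze H K1" using lift_pull[OF xi_tri[OF x] v(1)] v(2) by simp
  have "\<delta> = pll K1 (Id K) \<delta>" using pull_id[OF e] by simp
  also have "\<dots> = pll K1 (r' \<cdot> s') \<delta> \<otimes>\<^bsub>Ext \<C> K K1\<^esub> pll K1 (r \<cdot> s) \<delta>"
    unfolding rs(3) by (rule pull_sum[OF e comp_arr[OF H(3,2)] comp_arr[OF rs(2,1)]])
  also have "pll K1 (r' \<cdot> s') \<delta> = ze K K1" using pull_comp[OF e H(2,3)] z pull_ze[OF o H(3)] by simp
  also have "pll K1 (r \<cdot> s) \<delta> = pll K1 s (pll K1 r \<delta>)" by (rule pull_comp[OF e rs(1,2)])
  finally show ?thesis using sum_ze(2)[OF pull_ext[OF pull_ext[OF e rs(1)] rs(2)]] by simp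
qed

text \<open>Both obstructions are detected on \<open>L\<close>: the pushed extension passes through
  one of \<open>L\<close> by \<open>W\<close>, and a map killed by \<open>f\<close> vanishes on
  \<open>H\<close> and restricts to a ghost on \<open>L\<close>. Orthogonality of \<open>L\<close>
  and \<open>W\<close> removes them.\<close>

lemma fpd_GP_summand_into:
  assumes "fpd_GP_summand K" and t: "(K1, g, G, f, K, \<delta>) \<in> cov_exact \<C> \<xi> GPs" and W: "W \<in> GIs"
  shows "hom_into_exact \<C> W (K1, g, G, f, K, \<delta>)"
proof -
  note x = cov_exactD(1)[OF t]
  obtain L H r s r' s' where a: "fin_proj_dim L" "H \<in> GPs" "arr s K L" "arr r L K" "arr s' K H" "arr r' H K"
     "Id K = (r' \<cdot> s') \<otimes>\<^bsub>Hom \<C> K K\<^esub> (r \<cdot> s)" using assms(1) unfolding fpd_GP_summand_def by blast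
  have o: "orth L W" by (rule fin_proj_dim_orth_GI[OF a(1) W])
  note WO = GI_obj[OF W]
  note d = fpd_GP_summand_pull[OF t a(2,6,5,4,3,7)]
  show ?thesis
    unfolding hom_into_iff[OF xi_tri[OF x] WO]
  proof (intro conjI allI impI)
    fix u assume u: "arr u K1 W"
    note e = xi_arr(3)[OF x]
    have "psh K u \<delta> = pll W s (pll W r (psh K u \<delta>))"
      using d push_pull[OF pull_ext[OF e a(4)] a(3) u] push_pull[OF e a(4) u] by simp
    also have "pll W r (psh K u \<delta>) = ze L W" by (rule orthD(1)[OF o xext_pull[OF xext_push[OF xi_xext[OF x] u] a(4)]])
    also have "pll W s (ze L W) = ze K W" by (rule pull_ze[OF WO a(3)])
    finally obtain v where "arr v G W" "v \<cdot> g = u" by (rule extend[OF xi_tri[OF x] u])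
    then show "\<exists>v. arr v G W \<and> v \<cdot> g = u" by blast
  next
    fix \<psi> assume p: "arr \<psi> K W \<and> \<psi> \<cdot> f = zr G W"
    note pa = conjunct1[OF p]
    obtain v where v: "arr v H G" "f \<cdot> v = r'" by (rule hom_fromD[OF cov_exactD(2)[OF t a(2)] xi_tri[OF x] a(6)])
    have "\<psi> \<cdot> r' = (\<psi> \<cdot> f) \<cdot> v" using assoc[OF v(1) xi_arr(2)[OF x] pa] v(2) by simp
    then have 1: "\<psi> \<cdot> r' = zr H W" using p comp_zr_left[OF v(1) WO] by simp
    have 2: "\<psi> \<cdot> r = zr L W" by (rule orthD(2)[OF o ghost_comp[OF ghost_deflation[OF pa x conjunct2[OF p]] a(4)]])
    have "\<psi> = \<psi> \<cdot> Id K" using id_right[OF pa] by simp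
    also have "\<dots> = (\<psi> \<cdot> (r' \<cdot> s')) \<otimes>\<^bsub>Hom \<C> K W\<^esub> (\<psi> \<cdot> (r \<cdot> s))"
      unfolding a(7) by (rule comp_sum_right[OF comp_arr[OF a(5,6)] comp_arr[OF a(3,4)] pa])
    also have "\<psi> \<cdot> (r' \<cdot> s') = zr K W" using assoc[OF a(5,6) pa] 1 comp_zr_left[OF a(5) WO] by simp
    also have "\<psi> \<cdot> (r \<cdot> s) = zr K W" using assoc[OF a(3,4) pa] 2 comp_zr_left[OF a(3) WO] by simp
    also have "zr K W \<otimes>\<^bsub>Hom \<C> K W\<^esub> zr K W = zr K W" by (rule sum_zr(1)[OF zr_arr[OF xi_obj(3)[OF x] WO]])
    finally show "\<psi> = zr K W" .
  qed
qed

text \<open>Compare with a projective cover of \<open>L\<close>, along \<open>r\<close> in one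
  direction and along \<open>s\<close> in the other. The round trip fixes \<delta> because \<delta>
  is recovered from its restriction to \<open>L\<close>.\<close>

lemma fpd_GP_summand_syzygy:
  assumes "fpd_GP_summand K" and t: "(K1, g, G, f, K, \<delta>) \<in> cov_exact \<C> \<xi> GPs" and G: "G \<in> GPs"
  shows "fpd_GP_summand K1"
proof -
  note x = cov_exactD(1)[OF t]
  note e = xi_arr(3)[OF x]
  obtain L H r s r' s' where a: "fin_proj_dim L" "H \<in> GPs" "arr s K L" "arr r L K" "arr s' K H" "arr r' H K"
     "Id K = (r' \<cdot> s') \<otimes>\<^bsub>Hom \<C> K K\<^esub> (r \<cdot> s)" using assms(1) unfolding fpd_GP_summand_def by blast
  obtain L' l P p \<epsilon> where c: "xi L' l P p L \<epsilon>" "P \<in> PP" "fin_proj_dim L'" using fin_proj_dim_cover[OF a(1)] .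
  obtain \<beta> where b: "arr \<beta> L' K1" "psh L \<beta> \<epsilon> = pll K1 r \<delta>"
    by (rule cov_comparison[OF c(1) PP_GP[OF c(2)] t a(4)])
  obtain \<beta>' where b': "arr \<beta>' K1 L'" "psh K \<beta>' \<delta> = pll L' s \<epsilon>"
    by (rule cov_comparison[OF x G fin_proj_dim_cov_exact[OF c(1,3)] a(3)])
  have "psh K (\<beta> \<cdot> \<beta>') \<delta> = psh K \<beta> (pll L' s \<epsilon>)" using push_comp[OF e b'(1) b(1)] b'(2) by simp
  also have "\<dots> = pll K1 s (psh L \<beta> \<epsilon>)" by (rule push_pull[OF xi_arr(3)[OF c(1)] a(3) b(1)])
  also have "\<dots> = \<delta>" using b(2) fpd_GP_summand_pull[OF t a(2,6,5,4,3,7)] by simp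
  finally show ?thesis by (rule fpd_GP_summandI[OF xi_tri[OF x] b(1) b'(1) _ c(3) G])
qed

lemma GP_resolution_triangles:
  assumes M: "M \<in> GP_finite \<C> \<xi>" and r: "GP_resolution \<C> \<xi> M G d"
  obtains K g f \<delta> where "K 0 = M" "\<And>i. tri (K (Suc i)) (g i) (G i) (f i) (K i) (\<delta> i)"
    "\<And>i. d (Suc i) = g i \<cdot> f (Suc i)" "\<And>i. G i \<in> GPs"
    "\<And>i W. W \<in> GIs \<Longrightarrow> hom_into_exact \<C> W (K (Suc i), g i, G i, f i, K i, \<delta> i)"
proof -
  obtain K g f \<delta> where *: "\<forall>i. G i \<in> GPs" "K 0 = M"
    "\<forall>i. (K (Suc i), g i, G i, f i, K i, \<delta> i) \<in> cov_exact \<C> \<xi> GPs"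
    "\<forall>i. d (Suc i) = g i \<cdot> f (Suc i)"
    using r unfolding GP_resolution_def by blast
  have s: "special_precover M" by (rule GP_finite_precover[OF M])
  have c: "(K (Suc i), g i, G i, f i, K i, \<delta> i) \<in> cov_exact \<C> \<xi> GPs" for i using *(3) by blast
  have G: "G i \<in> GPs" for i using *(1) by blast
  \<comment> \<open>The summand property is established from the first syzygy on. The triangle that
    ends in \<open>M\<close> itself is handled by \<open>special_precover_into\<close>.\<close>
  have st: "fpd_GP_summand (K (Suc i))" for i
  proof (induction i)
    case 0
    show ?case using special_precover_summand[OF s c[of 0, unfolded *(2)] G] .
  next
    case (Suc i)
    show ?case using fpd_GP_summand_syzygy[OF Suc c G] .
  qed
  show thesis
  proof (rule that[of K g f \<delta>, OF *(2)])
    fix i W assume W: "W \<in> GIs"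
    show "hom_into_exact \<C> W (K (Suc i), g i, G i, f i, K i, \<delta> i)"
    proof (cases i)
      case 0
      then show ?thesis using special_precover_into[OF s c[of 0, unfolded *(2)] W] *(2) by simp
    next
      case (Suc j)
      show ?thesis unfolding Suc by (rule fpd_GP_summand_into[OF st c W])
    qed
  qed (use xi_tri[OF cov_exactD(1)[OF c]] *(4) G in blast)+
qed

lemma Gpd_le_op [simp]: "Gpd_le (opc \<C>) (opt \<xi>) A n \<longleftrightarrow> Gid_le \<C> \<xi> A n"
  by (induction n arbitrary: A) (simp_all, blast)

lemma GP_finite_op [simp]: "GP_finite (opc \<C>) (opt \<xi>) = GI_finite \<C> \<xi>"
  by (simp add: GP_finite_def GI_finite_def Gpd_def Gid_def)

text \<open>Duality is an involution, so this is \<open>GP_op\<close> read in the opposite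
  category.\<close>

lemma GI_op [simp]: "GI (opc \<C>) (opt \<xi>) = GPs"
proof -
  have "opc (opc \<C>) = \<C>" by (simp add: opc_def image_image case_prod_unfold)
  moreover have "opt (opt \<xi>) = \<xi>" by (auto simp: opt_def)
  ultimately show ?thesis using proper_cat.GP_op[OF proper_cat_op] by simp
qed

lemma GP_resolution_op [simp]: "GP_resolution (opc \<C>) (opt \<xi>) N E d \<longleftrightarrow> GI_coresolution \<C> \<xi> N E d"
  unfolding GP_resolution_def GI_coresolution_def GP_op exact_op opt_iff opc_simps by blast

lemma GI_coresolution_exists:
  assumes "N \<in> GI_finite \<C> \<xi>" shows "\<exists>E d. GI_coresolution \<C> \<xi> N E d"
  using proper_cat.GP_resolution_exists[OF proper_cat_op proper_cat.GP_finite_precover[OF proper_cat_op]] assms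
  by simp

lemma GI_coresolution_triangles:
  assumes N: "N \<in> GI_finite \<C> \<xi>" and r: "GI_coresolution \<C> \<xi> N E d"
  obtains L a b \<delta> where "L 0 = N" "\<And>i. tri (L i) (a i) (E i) (b i) (L (Suc i)) (\<delta> i)"
    "\<And>i. d (Suc i) = a (Suc i) \<cdot> b i" "\<And>i. E i \<in> GIs"
    "\<And>i W. W \<in> GPs \<Longrightarrow> hom_from_exact \<C> W (L i, a i, E i, b i, L (Suc i), \<delta> i)"
proof -
  have N': "N \<in> GP_finite (opc \<C>) (opt \<xi>)" and r': "GP_resolution (opc \<C>) (opt \<xi>) N E d" using N r by simp_all
  show thesis
    by (rule proper_cat.GP_resolution_triangles[OF proper_cat_op N' r'])
      (unfold tri_op GP_op GI_op hom_exact_op opc_simps, rule that)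
qed

end

section \<open>Balance of the two cohomologies\<close>

text \<open>Connecting maps are given by zigzags that depend on choices. Working with a relation
  avoids choosing: totality, surjectivity, additivity and compatibility with the two subgroups
  already determine an isomorphism of the quotients.\<close>

lemma quotient_iso_relation:
  assumes "comm_group G" "comm_group H" "subgroup U G" "subgroup V H"
    and R: "\<And>x y. R x y \<Longrightarrow> x \<in> carrier G \<and> y \<in> carrier H"
    and total: "\<And>x. x \<in> carrier G \<Longrightarrow> \<exists>y. R x y"
    and onto: "\<And>y. y \<in> carrier H \<Longrightarrow> \<exists>x. R x y"
    and mult: "\<And>x y x' y'. R x y \<Longrightarrow> R x' y' \<Longrightarrow> R (x \<otimes>\<^bsub>G\<^esub> x') (y \<otimes>\<^bsub>H\<^esub> y')"
    and sub: "\<And>x y. R x y \<Longrightarrow> x \<in> U \<longleftrightarrow> y \<in> V"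
  shows "G Mod U \<cong> H Mod V"
proof -
  interpret G: comm_group G by fact
  interpret H: comm_group H by fact
  interpret U: subgroup U G by fact
  interpret V: normal V H using H.normal_iff_subgroup assms(4) by blast
  have uniq: "V #>\<^bsub>H\<^esub> y = V #>\<^bsub>H\<^esub> y'" if "R x y" "R x y'" for x y y'
  proof -
    have c: "x \<in> carrier G" "y \<in> carrier H" "y' \<in> carrier H" using R that by blast+
    \<comment> \<open>\<open>R\<close> is not assumed closed under inverses. A partner
      \<open>w\<close> of the inverse of \<open>x\<close> takes over: multiplied by it,
      \<open>y\<close> and \<open>y'\<close> both become partners of the unit, hence lie in
      \<open>V\<close>.\<close>
    obtain w where w: "R (inv\<^bsub>G\<^esub> x) w" using total[OF G.inv_closed[OF c(1)]] by blast
    have wc: "w \<in> carrier H" using R w by blast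
    have one: "x \<otimes>\<^bsub>G\<^esub> inv\<^bsub>G\<^esub> x \<in> U" using c(1) by simp
    have v: "y \<otimes>\<^bsub>H\<^esub> w \<in> V" "y' \<otimes>\<^bsub>H\<^esub> w \<in> V" using sub[OF mult[OF that(1) w]] sub[OF mult[OF that(2) w]] one by blast+
    have "w \<otimes>\<^bsub>H\<^esub> (inv\<^bsub>H\<^esub> w \<otimes>\<^bsub>H\<^esub> inv\<^bsub>H\<^esub> y') = inv\<^bsub>H\<^esub> y'"
      using H.m_assoc[of w "inv\<^bsub>H\<^esub> w" "inv\<^bsub>H\<^esub> y'"] c wc by simp
    then have "y \<otimes>\<^bsub>H\<^esub> inv\<^bsub>H\<^esub> y' = (y \<otimes>\<^bsub>H\<^esub> w) \<otimes>\<^bsub>H\<^esub> inv\<^bsub>H\<^esub> (y' \<otimes>\<^bsub>H\<^esub> w)"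
      using c wc by (simp add: H.inv_mult_group H.m_assoc)
    then have "y \<otimes>\<^bsub>H\<^esub> inv\<^bsub>H\<^esub> y' \<in> V" using v by simp
    then have "V #>\<^bsub>H\<^esub> (y \<otimes>\<^bsub>H\<^esub> inv\<^bsub>H\<^esub> y') = V"
      using H.coset_join2[OF _ assms(4)] c by blast
    then show ?thesis by (rule H.coset_mult_inv1[OF _ c(2,3) V.subset])
  qed
  define h where "h x = V #>\<^bsub>H\<^esub> (SOME y. R x y)" for x
  have h: "h x = V #>\<^bsub>H\<^esub> y" if "R x y" for x y
    unfolding h_def by (rule uniq[OF someI[of "R x", OF that] that])
  have hom: "h \<in> hom G (H Mod V)"
  proof (rule homI)
    fix x assume x: "x \<in> carrier G"
    then obtain y where y: "R x y" using total by blast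
    then have "y \<in> carrier H" using R by blast
    then show "h x \<in> carrier (H Mod V)" unfolding h[OF y] by (simp add: FactGroup_def H.rcosetsI V.subset)
  next
    fix x x' assume x: "x \<in> carrier G" "x' \<in> carrier G"
    then obtain y y' where y: "R x y" "R x' y'" using total by blast
    then have c: "y \<in> carrier H" "y' \<in> carrier H" using R by blast+
    show "h (x \<otimes>\<^bsub>G\<^esub> x') = h x \<otimes>\<^bsub>H Mod V\<^esub> h x'"
      unfolding h[OF y(1)] h[OF y(2)] h[OF mult[OF y]] using V.rcos_sum[OF c] by (simp add: FactGroup_def)
  qed
  interpret h: group_hom G "H Mod V" h
    by (simp add: group_hom_def group_hom_axioms_def hom V.factorgroup_is_group)
  have ker: "kernel G (H Mod V) h = U"
  proof (intro equalityI subsetI)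
    fix x assume x: "x \<in> kernel G (H Mod V) h"
    then have "x \<in> carrier G" by (simp add: kernel_def)
    then obtain y where y: "R x y" using total by blast
    then have c: "y \<in> carrier H" using R by blast
    have "V #>\<^bsub>H\<^esub> y = V" using x h[OF y] by (simp add: kernel_def FactGroup_def)
    then have "y \<in> V" by (rule H.coset_join1[OF _ c assms(4)])
    then show "x \<in> U" using sub[OF y] by blast
  next
    fix x assume x: "x \<in> U"
    then have xc: "x \<in> carrier G" by (rule U.mem_carrier)
    then obtain y where y: "R x y" using total by blast
    then have c: "y \<in> carrier H" using R by blast
    have "y \<in> V" using sub[OF y] x by blast
    then have "h x = V" unfolding h[OF y] by (rule H.coset_join2[OF c assms(4)])
    then show "x \<in> kernel G (H Mod V) h" using xc by (simp add: kernel_def FactGroup_def)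
  qed
  have "h ` carrier G = carrier (H Mod V)"
  proof (intro equalityI subsetI)
    fix Y assume "Y \<in> h ` carrier G" then show "Y \<in> carrier (H Mod V)" using h.hom_closed by blast
  next
    fix Y assume "Y \<in> carrier (H Mod V)"
    then obtain y where y: "y \<in> carrier H" "Y = V #>\<^bsub>H\<^esub> y" by (auto simp: FactGroup_def RCOSETS_def)
    obtain x where x: "R x y" using onto[OF y(1)] by blast
    show "Y \<in> h ` carrier G" using h[OF x] y(2) R[OF x] by blast
  qed
  from h.FactGroup_iso[OF this] show ?thesis unfolding ker .
qed

lemma cocycle_group:
  fixes A :: "nat \<Rightarrow> 'a monoid"
  assumes A: "\<And>i. comm_group (A i)" "\<And>i. d i \<in> hom (A i) (A (Suc i))"
    "\<And>i x. x \<in> carrier (A i) \<Longrightarrow> d (Suc i) (d i x) = \<one>\<^bsub>A (Suc (Suc i))\<^esub>"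
  defines "Z \<equiv> \<lambda>m. (A (Suc m))\<lparr>carrier := kernel (A (Suc m)) (A (Suc (Suc m))) (d (Suc m))\<rparr>"
  shows "comm_group (Z m)" "subgroup (d m ` carrier (A m)) (Z m)"
proof -
  have gh: "group_hom (A i) (A (Suc i)) (d i)" for i
    by (simp add: group_hom_def group_hom_axioms_def A(2) comm_group.axioms(2)[OF A(1)])
  interpret S: comm_group "A (Suc m)" by (rule A)
  let ?Z = "kernel (A (Suc m)) (A (Suc (Suc m))) (d (Suc m))"
  have k: "subgroup ?Z (A (Suc m))" by (rule group_hom.subgroup_kernel[OF gh])
  show "comm_group (Z m)"
    unfolding Z_def
    by (rule group.group_comm_groupI[OF subgroup.subgroup_is_group[OF k S.is_group]])
      (use S.m_comm in \<open>auto simp: kernel_def\<close>)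
  have "d m ` carrier (A m) \<subseteq> ?Z" using A(3) hom_in_carrier[OF A(2)] by (auto simp: kernel_def)
  then show "subgroup (d m ` carrier (A m)) (Z m)"
    unfolding Z_def by (rule S.subgroup_incl[OF group_hom.img_is_subgroup[OF gh] k])
qed

lemma cochain_cohomology_iso:
  fixes A B :: "nat \<Rightarrow> 'a monoid"
  assumes A: "\<And>i. comm_group (A i)" "\<And>i. d i \<in> hom (A i) (A (Suc i))"
      "\<And>i x. x \<in> carrier (A i) \<Longrightarrow> d (Suc i) (d i x) = \<one>\<^bsub>A (Suc (Suc i))\<^esub>"
    and B: "\<And>i. comm_group (B i)" "\<And>i. e i \<in> hom (B i) (B (Suc i))"
      "\<And>i x. x \<in> carrier (B i) \<Longrightarrow> e (Suc i) (e i x) = \<one>\<^bsub>B (Suc (Suc i))\<^esub>"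
    and R: "\<And>x y. R x y \<Longrightarrow> x \<in> kernel (A (Suc m)) (A (Suc (Suc m))) (d (Suc m)) \<and>
        y \<in> kernel (B (Suc k)) (B (Suc (Suc k))) (e (Suc k))"
    and total: "\<And>x. x \<in> kernel (A (Suc m)) (A (Suc (Suc m))) (d (Suc m)) \<Longrightarrow> \<exists>y. R x y"
    and onto: "\<And>y. y \<in> kernel (B (Suc k)) (B (Suc (Suc k))) (e (Suc k)) \<Longrightarrow> \<exists>x. R x y"
    and mult: "\<And>x y x' y'. R x y \<Longrightarrow> R x' y' \<Longrightarrow> R (x \<otimes>\<^bsub>A (Suc m)\<^esub> x') (y \<otimes>\<^bsub>B (Suc k)\<^esub> y')"
    and sub: "\<And>x y. R x y \<Longrightarrow> x \<in> d m ` carrier (A m) \<longleftrightarrow> y \<in> e k ` carrier (B k)"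
  shows "cochain_cohomology A d (Suc m) \<cong> cochain_cohomology B e (Suc k)"
proof -
  show ?thesis
    unfolding cochain_cohomology_def nat.case
    by (rule quotient_iso_relation[where R = R, OF cocycle_group(1)[of A d, OF A] cocycle_group(1)[of B e, OF B]
        cocycle_group(2)[of A d, OF A] cocycle_group(2)[of B e, OF B]])
      (simp_all add: R total onto mult sub)
qed

text \<open>What the comparison needs of the category and the resolutions: two towers of triangles,
  resolving \<open>K 0\<close> on one side and coresolving \<open>N 0\<close> on the other, each
  exact with respect to the middle terms of the other.\<close>

locale balanced = extri_cat \<C> for \<C> :: "('o, 'm, 'e) ext_cat" (structure) +
  fixes K G N E :: "nat \<Rightarrow> 'o" and g f a b :: "nat \<Rightarrow> 'm" and \<delta> \<epsilon> :: "nat \<Rightarrow> 'e"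
  assumes tri_K: "\<And>i. tri (K (Suc i)) (g i) (G i) (f i) (K i) (\<delta> i)"
    and tri_N: "\<And>j. tri (N j) (a j) (E j) (b j) (N (Suc j)) (\<epsilon> j)"
    and into_exact: "\<And>i j. hom_into_exact \<C> (E j) (K (Suc i), g i, G i, f i, K i, \<delta> i)"
    and from_exact: "\<And>i j. hom_from_exact \<C> (G i) (N j, a j, E j, b j, N (Suc j), \<epsilon> j)"
begin

definition dG :: "nat \<Rightarrow> 'm" where "dG i = g i \<cdot> f (Suc i)"
definition dE :: "nat \<Rightarrow> 'm" where "dE j = a (Suc j) \<cdot> b j"

lemma arr_facts: "arr (g i) (K (Suc i)) (G i)" "arr (f i) (G i) (K i)"
    "arr (a i) (N i) (E i)" "arr (b i) (E i) (N (Suc i))"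
  using tri_arr[OF tri_K] tri_arr[OF tri_N] by blast+

lemma obj_facts [simp]: "K i \<in> Obj \<C>" "G i \<in> Obj \<C>" "N i \<in> Obj \<C>" "E i \<in> Obj \<C>"
  using arr_obj[OF arr_facts(2)] arr_obj[OF arr_facts(3)] by blast+

lemma mor_facts [simp]: "mor (g i)" "src (g i) = K (Suc i)" "tgt (g i) = G i"
  "mor (f i)" "src (f i) = G i" "tgt (f i) = K i" "mor (a i)" "src (a i) = N i" "tgt (a i) = E i"
  "mor (b i)" "src (b i) = E i" "tgt (b i) = N (Suc i)"
  using arr_facts[of i] by (simp_all add: arr_iff)

lemma dG_arr: "arr (dG i) (G (Suc i)) (G i)" and dE_arr: "arr (dE j) (E j) (E (Suc j))"
  by (simp_all add: dG_def dE_def csimps)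

lemma f_g_zero: "f i \<cdot> g i = zr (K (Suc i)) (K i)" and b_a_zero: "b j \<cdot> a j = zr (N j) (N (Suc j))"
  using tri_comp[OF tri_K] tri_comp[OF tri_N] by blast+

lemma dG_dG: "dG i \<cdot> dG (Suc i) = zr (G (Suc (Suc i))) (G i)"
  by (simp add: dG_def csimps f_g_zero[THEN comp_eq])

lemma dE_dE: "dE (Suc j) \<cdot> dE j = zr (E j) (E (Suc (Suc j)))"
  by (simp add: dE_def csimps b_a_zero[THEN comp_eq])

text \<open>\<open>f\<close> can be cancelled only in front of the objects \<open>E j\<close>, and
  below \<open>a\<close> only behind the objects \<open>G i\<close>; neither is an epimorphism or
  monomorphism outright.\<close>

lemma f_epi: "arr u (K i) (E j) \<Longrightarrow> arr v (K i) (E j) \<Longrightarrow> u \<cdot> f i = v \<cdot> f i \<Longrightarrow> u = v"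
  by (rule hom_into_inj[OF into_exact tri_K])

lemma a_mono: "arr u (G i) (N j) \<Longrightarrow> arr v (G i) (N j) \<Longrightarrow> a j \<cdot> u = a j \<cdot> v \<Longrightarrow> u = v"
  by (rule hom_from_inj[OF from_exact tri_N])

lemma lift_b: assumes "arr u (G i) (N (Suc j))" obtains v where "arr v (G i) (E j)" "b j \<cdot> v = u"
  by (rule hom_fromD[OF from_exact tri_N assms])

lemma ker_b: assumes "arr u (G i) (E j)" "b j \<cdot> u = zr (G i) (N (Suc j))"
  obtains w where "arr w (G i) (N j)" "u = a j \<cdot> w"
  by (rule ker_factor[OF tri_N assms])

lemma ker_dG:
  assumes u: "arr u (G i) (E j)" and z: "u \<cdot> dG i = zr (G (Suc i)) (E j)"
  obtains v where "arr v (K i) (E j)" "u = v \<cdot> f i"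
proof -
  have ug: "arr (u \<cdot> g i) (K (Suc i)) (E j)" by (rule comp_arr[OF arr_facts(1) u])
  have "(u \<cdot> g i) \<cdot> f (Suc i) = zr (K (Suc i)) (E j) \<cdot> f (Suc i)"
    using z u by (simp add: dG_def csimps)
  then have "u \<cdot> g i = zr (K (Suc i)) (E j)" by (rule f_epi[OF ug zr_arr[OF obj_facts(1,4)]])
  then show thesis by (rule coker_factor[OF tri_K u]) (rule that)
qed

lemma ker_dG_Suc:
  assumes u: "arr u (G (Suc i)) (E j)" and z: "u \<cdot> dG (Suc i) = zr (G (Suc (Suc i))) (E j)"
  obtains e where "arr e (G i) (E j)" "u = e \<cdot> dG i"
proof -
  obtain v where v: "arr v (K (Suc i)) (E j)" "u = v \<cdot> f (Suc i)" by (rule ker_dG[OF u z])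
  obtain e where e: "arr e (G i) (E j)" "e \<cdot> g i = v" by (rule hom_intoD[OF into_exact tri_K v(1)])
  have "u = e \<cdot> dG i" unfolding v(2) e(2)[symmetric] using e(1) by (simp add: dG_def csimps)
  then show thesis by (rule that[OF e(1)])
qed

text \<open>\<open>HG l\<close> is the complex of maps from the resolution to the
  \<open>l\<close>-th cosyzygy of \<open>N 0\<close>; the parameter \<open>l\<close> absorbs the
  lost degrees while shifting.\<close>

abbreviation HG :: "nat \<Rightarrow> nat \<Rightarrow> 'm monoid" where "HG l j \<equiv> Hom \<C> (G j) (N l)"
abbreviation HE :: "nat \<Rightarrow> 'm monoid" where "HE j \<equiv> Hom \<C> (K 0) (E j)"
abbreviation dHG :: "nat \<Rightarrow> 'm \<Rightarrow> 'm" where "dHG j \<phi> \<equiv> \<phi> \<cdot> dG j"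
abbreviation dHE :: "nat \<Rightarrow> 'm \<Rightarrow> 'm" where "dHE j \<phi> \<equiv> dE j \<cdot> \<phi>"

lemma HG_complex: "comm_group (HG l i)" "dHG i \<in> hom (HG l i) (HG l (Suc i))"
  "x \<in> carrier (HG l i) \<Longrightarrow> dHG (Suc i) (dHG i x) = \<one>\<^bsub>HG l (Suc (Suc i))\<^esub>"
proof -
  show "comm_group (HG l i)" by (simp add: hom_comm_group)
  show "dHG i \<in> hom (HG l i) (HG l (Suc i))" by (rule pre_hom[OF dG_arr]) simp
  assume "x \<in> carrier (HG l i)"
  then have x: "arr x (G i) (N l)" by (simp add: arr_def)
  show "dHG (Suc i) (dHG i x) = \<one>\<^bsub>HG l (Suc (Suc i))\<^esub>"
    using assoc[OF dG_arr dG_arr x] dG_dG comp_zr_right[OF x] by simp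
qed

lemma HE_complex: "comm_group (HE i)" "dHE i \<in> hom (HE i) (HE (Suc i))"
  "x \<in> carrier (HE i) \<Longrightarrow> dHE (Suc i) (dHE i x) = \<one>\<^bsub>HE (Suc (Suc i))\<^esub>"
proof -
  show "comm_group (HE i)" by (simp add: hom_comm_group)
  show "dHE i \<in> hom (HE i) (HE (Suc i))" by (rule post_hom[OF dE_arr]) simp
  assume "x \<in> carrier (HE i)"
  then have x: "arr x (K 0) (E i)" by (simp add: arr_def)
  show "dHE (Suc i) (dHE i x) = \<one>\<^bsub>HE (Suc (Suc i))\<^esub>"
    using assoc[OF x dE_arr dE_arr] dE_dE comp_zr_left[OF x] by simp
qed

lemma HG_kernel: "x \<in> kernel (HG l (Suc m)) (HG l (Suc (Suc m))) (dHG (Suc m)) \<longleftrightarrow>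
    arr x (G (Suc m)) (N l) \<and> x \<cdot> dG (Suc m) = zr (G (Suc (Suc m))) (N l)"
  by (simp add: kernel_def arr_def)

lemma HE_kernel: "x \<in> kernel (HE (Suc m)) (HE (Suc (Suc m))) (dHE (Suc m)) \<longleftrightarrow>
    arr x (K 0) (E (Suc m)) \<and> dE (Suc m) \<cdot> x = zr (K 0) (E (Suc (Suc m)))"
  by (simp add: kernel_def arr_def)

lemma HG_image: "x \<in> dHG m ` carrier (HG l m) \<longleftrightarrow> (\<exists>y. arr y (G m) (N l) \<and> x = y \<cdot> dG m)"
  by (auto simp: arr_def)

lemma HE_image: "x \<in> dHE m ` carrier (HE m) \<longleftrightarrow> (\<exists>y. arr y (K 0) (E m) \<and> x = dE m \<cdot> y)"
  by (auto simp: arr_def)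

lemma diff_right:
  assumes "arr u A B" "arr v A B" "arr q D A" "u \<cdot> q = v \<cdot> q"
  obtains w where "arr w A B" "u = w \<otimes>\<^bsub>Hom \<C> A B\<^esub> v" "w \<cdot> q = zr D B"
proof -
  obtain w where w: "arr w A B" "u = w \<otimes>\<^bsub>Hom \<C> A B\<^esub> v" using diff_arr[OF assms(1,2)] .
  have "v \<cdot> q = w \<cdot> q \<otimes>\<^bsub>Hom \<C> D B\<^esub> v \<cdot> q" using comp_sum_left[OF assms(3) w(1) assms(2)] w(2) assms(4) by simp
  then have "w \<cdot> q = zr D B" by (rule arr_cancel[OF comp_arr[OF assms(3) w(1)] comp_arr[OF assms(3,2)]])
  then show thesis by (rule that[OF w])
qed

lemma diff_left:
  assumes "arr u A B" "arr v A B" "arr q B D" "q \<cdot> u = q \<cdot> v"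
  obtains w where "arr w A B" "u = w \<otimes>\<^bsub>Hom \<C> A B\<^esub> v" "q \<cdot> w = zr A D"
proof -
  obtain w where w: "arr w A B" "u = w \<otimes>\<^bsub>Hom \<C> A B\<^esub> v" using diff_arr[OF assms(1,2)] .
  have "q \<cdot> v = (q \<cdot> w) \<otimes>\<^bsub>Hom \<C> A D\<^esub> (q \<cdot> v)" using comp_sum_right[OF w(1) assms(2,3)] w(2) assms(4) by simp
  then have "q \<cdot> w = zr A D" by (rule arr_cancel[OF comp_arr[OF w(1) assms(3)] comp_arr[OF assms(2,3)]])
  then show thesis by (rule that[OF w])
qed

text \<open>Followed by \<open>a l\<close>, the cocycle lives in \<open>\<C>(G, E l)\<close>, which
  is exact in positive degrees.\<close>

lemma cocycle_lift:
  assumes x: "arr x (G (Suc m)) (N l)" and z: "x \<cdot> dG (Suc m) = zr (G (Suc (Suc m))) (N l)"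
  obtains e where "arr e (G m) (E l)" "a l \<cdot> x = e \<cdot> dG m"
proof -
  have ax: "arr (a l \<cdot> x) (G (Suc m)) (E l)" by (rule comp_arr[OF x arr_facts(3)])
  have "(a l \<cdot> x) \<cdot> dG (Suc m) = zr (G (Suc (Suc m))) (E l)"
    using assoc[OF dG_arr x arr_facts(3)] z comp_zr_right[OF arr_facts(3)] by simp
  then obtain e where "arr e (G m) (E l)" "a l \<cdot> x = e \<cdot> dG m" by (rule ker_dG_Suc[OF ax])
  then show thesis by (rule that)
qed

text \<open>The coboundary of \<open>e\<close> is killed by \<open>b l\<close>, so it comes from
  \<open>N l\<close>; cancelling \<open>a l\<close> shows that the resulting map is a
  cocycle.\<close>

lemma cocycle_descend:
  assumes e: "arr e (G m) (E l)" and z: "(b l \<cdot> e) \<cdot> dG m = zr (G (Suc m)) (N (Suc l))"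
  obtains x where "arr x (G (Suc m)) (N l)" "a l \<cdot> x = e \<cdot> dG m" "x \<cdot> dG (Suc m) = zr (G (Suc (Suc m))) (N l)"
proof -
  have ed: "arr (e \<cdot> dG m) (G (Suc m)) (E l)" by (rule comp_arr[OF dG_arr e])
  have "b l \<cdot> (e \<cdot> dG m) = zr (G (Suc m)) (N (Suc l))" using z assoc[OF dG_arr e arr_facts(4)] by simp
  then obtain x where x: "arr x (G (Suc m)) (N l)" "e \<cdot> dG m = a l \<cdot> x" by (rule ker_b[OF ed])
  have xd: "arr (x \<cdot> dG (Suc m)) (G (Suc (Suc m))) (N l)" by (rule comp_arr[OF dG_arr x(1)])
  have "a l \<cdot> (x \<cdot> dG (Suc m)) = e \<cdot> (dG m \<cdot> dG (Suc m))"
    using assoc[OF dG_arr x(1) arr_facts(3)] x(2) assoc[OF dG_arr dG_arr e] by simp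
  also have "\<dots> = a l \<cdot> zr (G (Suc (Suc m))) (N l)"
    unfolding dG_dG using comp_zr_right[OF e] comp_zr_right[OF arr_facts(3)] by simp
  finally have "x \<cdot> dG (Suc m) = zr (G (Suc (Suc m))) (N l)" by (rule a_mono[OF xd zr_arr[OF obj_facts(2,3)]])
  then show thesis by (rule that[OF x(1) x(2)[symmetric]])
qed

lemma b_e_dG:
  assumes x: "arr x (G (Suc m)) (N l)" and e: "arr e (G m) (E l)" and q: "a l \<cdot> x = e \<cdot> dG m"
  shows "(b l \<cdot> e) \<cdot> dG m = zr (G (Suc m)) (N (Suc l))"
proof -
  have "(b l \<cdot> e) \<cdot> dG m = (b l \<cdot> a l) \<cdot> x" using assoc[OF dG_arr e arr_facts(4)] q assoc[OF x arr_facts(3,4)] by simp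
  then show ?thesis unfolding b_a_zero using comp_zr_left[OF x] by simp
qed

text \<open>The relation in the next two proofs is the graph of the connecting map, resp. the zigzag through \<open>\<C>(G\<^sub>0, E\<^sub>l)\<close>.\<close>

lemma row_shift:
  "cochain_cohomology (HG l) dHG (Suc (Suc m)) \<cong> cochain_cohomology (HG (Suc l)) dHG (Suc m)"
proof (rule cochain_cohomology_iso[where A = "HG l" and B = "HG (Suc l)" and d = dHG and e = dHG and
    R = "\<lambda>x y. arr x (G (Suc (Suc m))) (N l) \<and> x \<cdot> dG (Suc (Suc m)) = zr (G (Suc (Suc (Suc m)))) (N l) \<and>
      (\<exists>e. arr e (G (Suc m)) (E l) \<and> a l \<cdot> x = e \<cdot> dG (Suc m) \<and> y = b l \<cdot> e)",
    OF HG_complex HG_complex], assumption, assumption, unfold HG_kernel HG_image)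
  fix x y
  assume *: "arr x (G (Suc (Suc m))) (N l) \<and> x \<cdot> dG (Suc (Suc m)) = zr (G (Suc (Suc (Suc m)))) (N l) \<and>
      (\<exists>e. arr e (G (Suc m)) (E l) \<and> a l \<cdot> x = e \<cdot> dG (Suc m) \<and> y = b l \<cdot> e)"
  then obtain e where x: "arr x (G (Suc (Suc m))) (N l)" and
    e: "arr e (G (Suc m)) (E l)" "a l \<cdot> x = e \<cdot> dG (Suc m)" "y = b l \<cdot> e" by blast
  have y: "arr y (G (Suc m)) (N (Suc l))" unfolding e(3) by (rule comp_arr[OF e(1) arr_facts(4)])
  show "(arr x (G (Suc (Suc m))) (N l) \<and> x \<cdot> dG (Suc (Suc m)) = zr (G (Suc (Suc (Suc m)))) (N l)) \<and>
     arr y (G (Suc m)) (N (Suc l)) \<and> y \<cdot> dG (Suc m) = zr (G (Suc (Suc m))) (N (Suc l))"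
    using * y b_e_dG[OF x e(1,2)] e(3) by simp
  show "(\<exists>y. arr y (G (Suc m)) (N l) \<and> x = y \<cdot> dG (Suc m)) \<longleftrightarrow> (\<exists>z. arr z (G m) (N (Suc l)) \<and> y = z \<cdot> dG m)"
  proof
    assume "\<exists>y. arr y (G (Suc m)) (N l) \<and> x = y \<cdot> dG (Suc m)"
    then obtain u where u: "arr u (G (Suc m)) (N l)" "x = u \<cdot> dG (Suc m)" by blast
    have au: "arr (a l \<cdot> u) (G (Suc m)) (E l)" by (rule comp_arr[OF u(1) arr_facts(3)])
    have "e \<cdot> dG (Suc m) = (a l \<cdot> u) \<cdot> dG (Suc m)" using e(2) u(2) assoc[OF dG_arr u(1) arr_facts(3)] by simp
    \<comment> \<open>The difference of \<open>e\<close> and \<open>a l \<cdot> u\<close> is a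
      cocycle with values in \<open>E l\<close>, hence a coboundary, and \<open>b l\<close> does not
      see \<open>a l \<cdot> u\<close>.\<close>
    then obtain w where w: "arr w (G (Suc m)) (E l)" "e = w \<otimes>\<^bsub>Hom \<C> (G (Suc m)) (E l)\<^esub> (a l \<cdot> u)"
      "w \<cdot> dG (Suc m) = zr (G (Suc (Suc m))) (E l)" by (rule diff_right[OF e(1) au dG_arr])
    obtain v where v: "arr v (G m) (E l)" "w = v \<cdot> dG m" by (rule ker_dG_Suc[OF w(1,3)])
    have "b l \<cdot> (a l \<cdot> u) = zr (G (Suc m)) (N (Suc l))"
      using assoc[OF u(1) arr_facts(3,4)] b_a_zero comp_zr_left[OF u(1)] by simp
    then have "y = b l \<cdot> w" unfolding e(3) w(2)
      using comp_sum_right[OF w(1) au arr_facts(4)] sum_zr(1)[OF comp_arr[OF w(1) arr_facts(4)]] by simp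
    then have "y = (b l \<cdot> v) \<cdot> dG m" using v(2) assoc[OF dG_arr v(1) arr_facts(4)] by simp
    then show "\<exists>z. arr z (G m) (N (Suc l)) \<and> y = z \<cdot> dG m" using comp_arr[OF v(1) arr_facts(4)] by blast
  next
    assume "\<exists>z. arr z (G m) (N (Suc l)) \<and> y = z \<cdot> dG m"
    then obtain z where z: "arr z (G m) (N (Suc l))" "y = z \<cdot> dG m" by blast
    obtain v where v: "arr v (G m) (E l)" "b l \<cdot> v = z" by (rule lift_b[OF z(1)])
    have vd: "arr (v \<cdot> dG m) (G (Suc m)) (E l)" by (rule comp_arr[OF dG_arr v(1)])
    have "b l \<cdot> e = b l \<cdot> (v \<cdot> dG m)" using e(3) z(2) v(2) assoc[OF dG_arr v(1) arr_facts(4)] by simp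
    \<comment> \<open>After subtraction of the coboundary \<open>v \<cdot> dG m\<close>, the rest of
      \<open>e\<close> is killed by \<open>b l\<close> and comes from \<open>u\<close>; the
      subtracted term does not affect \<open>e \<cdot> dG (Suc m)\<close>.\<close>
    then obtain w where w: "arr w (G (Suc m)) (E l)" "e = w \<otimes>\<^bsub>Hom \<C> (G (Suc m)) (E l)\<^esub> (v \<cdot> dG m)"
      "b l \<cdot> w = zr (G (Suc m)) (N (Suc l))" by (rule diff_left[OF e(1) vd arr_facts(4)])
    obtain u where u: "arr u (G (Suc m)) (N l)" "w = a l \<cdot> u" by (rule ker_b[OF w(1,3)])
    have "(v \<cdot> dG m) \<cdot> dG (Suc m) = zr (G (Suc (Suc m))) (E l)"
      using assoc[OF dG_arr dG_arr v(1)] dG_dG comp_zr_right[OF v(1)] by simp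
    then have "e \<cdot> dG (Suc m) = w \<cdot> dG (Suc m)" unfolding w(2)
      using comp_sum_left[OF dG_arr w(1) vd] sum_zr(1)[OF comp_arr[OF dG_arr w(1)]] by simp
    then have "a l \<cdot> x = a l \<cdot> (u \<cdot> dG (Suc m))" using e(2) u(2) assoc[OF dG_arr u(1) arr_facts(3)] by simp
    then have "x = u \<cdot> dG (Suc m)" by (rule a_mono[OF x comp_arr[OF dG_arr u(1)]])
    then show "\<exists>y. arr y (G (Suc m)) (N l) \<and> x = y \<cdot> dG (Suc m)" using u(1) by blast
  qed
next
  fix x assume x: "arr x (G (Suc (Suc m))) (N l) \<and> x \<cdot> dG (Suc (Suc m)) = zr (G (Suc (Suc (Suc m)))) (N l)"
  obtain e where "arr e (G (Suc m)) (E l)" "a l \<cdot> x = e \<cdot> dG (Suc m)"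
    by (rule cocycle_lift[OF conjunct1[OF x] conjunct2[OF x]])
  then show "\<exists>y. arr x (G (Suc (Suc m))) (N l) \<and> x \<cdot> dG (Suc (Suc m)) = zr (G (Suc (Suc (Suc m)))) (N l) \<and>
      (\<exists>e. arr e (G (Suc m)) (E l) \<and> a l \<cdot> x = e \<cdot> dG (Suc m) \<and> y = b l \<cdot> e)" using x by blast
next
  fix y assume y: "arr y (G (Suc m)) (N (Suc l)) \<and> y \<cdot> dG (Suc m) = zr (G (Suc (Suc m))) (N (Suc l))"
  obtain e where e: "arr e (G (Suc m)) (E l)" "b l \<cdot> e = y" by (rule lift_b[OF conjunct1[OF y]])
  have "(b l \<cdot> e) \<cdot> dG (Suc m) = zr (G (Suc (Suc m))) (N (Suc l))" using e(2) y by simp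
  then obtain x where "arr x (G (Suc (Suc m))) (N l)" "a l \<cdot> x = e \<cdot> dG (Suc m)"
    "x \<cdot> dG (Suc (Suc m)) = zr (G (Suc (Suc (Suc m)))) (N l)" by (rule cocycle_descend[OF e(1)])
  then show "\<exists>x. arr x (G (Suc (Suc m))) (N l) \<and> x \<cdot> dG (Suc (Suc m)) = zr (G (Suc (Suc (Suc m)))) (N l) \<and>
      (\<exists>e. arr e (G (Suc m)) (E l) \<and> a l \<cdot> x = e \<cdot> dG (Suc m) \<and> y = b l \<cdot> e)" using e by blast
next
  fix x y x' y'
  assume "arr x (G (Suc (Suc m))) (N l) \<and> x \<cdot> dG (Suc (Suc m)) = zr (G (Suc (Suc (Suc m)))) (N l) \<and>
      (\<exists>e. arr e (G (Suc m)) (E l) \<and> a l \<cdot> x = e \<cdot> dG (Suc m) \<and> y = b l \<cdot> e)"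
   "arr x' (G (Suc (Suc m))) (N l) \<and> x' \<cdot> dG (Suc (Suc m)) = zr (G (Suc (Suc (Suc m)))) (N l) \<and>
      (\<exists>e. arr e (G (Suc m)) (E l) \<and> a l \<cdot> x' = e \<cdot> dG (Suc m) \<and> y' = b l \<cdot> e)"
  then obtain e e' where
    x: "arr x (G (Suc (Suc m))) (N l)" "x \<cdot> dG (Suc (Suc m)) = zr (G (Suc (Suc (Suc m)))) (N l)"
    "arr x' (G (Suc (Suc m))) (N l)" "x' \<cdot> dG (Suc (Suc m)) = zr (G (Suc (Suc (Suc m)))) (N l)" and
    e: "arr e (G (Suc m)) (E l)" "a l \<cdot> x = e \<cdot> dG (Suc m)" "y = b l \<cdot> e"
      "arr e' (G (Suc m)) (E l)" "a l \<cdot> x' = e' \<cdot> dG (Suc m)" "y' = b l \<cdot> e'" by blast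
  show "arr (x \<otimes>\<^bsub>HG l (Suc (Suc m))\<^esub> x') (G (Suc (Suc m))) (N l) \<and>
      (x \<otimes>\<^bsub>HG l (Suc (Suc m))\<^esub> x') \<cdot> dG (Suc (Suc m)) = zr (G (Suc (Suc (Suc m)))) (N l) \<and>
      (\<exists>e. arr e (G (Suc m)) (E l) \<and> a l \<cdot> (x \<otimes>\<^bsub>HG l (Suc (Suc m))\<^esub> x') = e \<cdot> dG (Suc m) \<and>
        y \<otimes>\<^bsub>HG (Suc l) (Suc m)\<^esub> y' = b l \<cdot> e)"
  proof (intro conjI exI[of _ "e \<otimes>\<^bsub>Hom \<C> (G (Suc m)) (E l)\<^esub> e'"])
    show "(x \<otimes>\<^bsub>HG l (Suc (Suc m))\<^esub> x') \<cdot> dG (Suc (Suc m)) = zr (G (Suc (Suc (Suc m)))) (N l)"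
      using comp_sum_left[OF dG_arr x(1,3)] x(2,4) sum_zr(1)[OF zr_arr] by simp
    show "a l \<cdot> (x \<otimes>\<^bsub>HG l (Suc (Suc m))\<^esub> x') = (e \<otimes>\<^bsub>Hom \<C> (G (Suc m)) (E l)\<^esub> e') \<cdot> dG (Suc m)"
      using comp_sum_right[OF x(1,3) arr_facts(3)] comp_sum_left[OF dG_arr e(1,4)] e(2,5) by simp
    show "y \<otimes>\<^bsub>HG (Suc l) (Suc m)\<^esub> y' = b l \<cdot> (e \<otimes>\<^bsub>Hom \<C> (G (Suc m)) (E l)\<^esub> e')"
      using comp_sum_right[OF e(1,4) arr_facts(4)] e(3,6) by simp
  qed (rule sum_arr x e)+
qed

lemma corner:
  "cochain_cohomology (HG l) dHG (Suc 0) \<cong> cochain_cohomology HE dHE (Suc l)"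
proof (rule cochain_cohomology_iso[where A = "HG l" and B = HE and d = dHG and e = dHE and
    R = "\<lambda>x y. (arr x (G (Suc 0)) (N l) \<and> x \<cdot> dG (Suc 0) = zr (G (Suc (Suc 0))) (N l)) \<and>
      (arr y (K 0) (E (Suc l)) \<and> dE (Suc l) \<cdot> y = zr (K 0) (E (Suc (Suc l)))) \<and>
      (\<exists>e. arr e (G 0) (E l) \<and> a l \<cdot> x = e \<cdot> dG 0 \<and> dE l \<cdot> e = y \<cdot> f 0)",
    OF HG_complex HE_complex], assumption, assumption, unfold HG_kernel HE_kernel HG_image HE_image)
  fix x y
  assume *: "(arr x (G (Suc 0)) (N l) \<and> x \<cdot> dG (Suc 0) = zr (G (Suc (Suc 0))) (N l)) \<and>
      (arr y (K 0) (E (Suc l)) \<and> dE (Suc l) \<cdot> y = zr (K 0) (E (Suc (Suc l)))) \<and>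
      (\<exists>e. arr e (G 0) (E l) \<and> a l \<cdot> x = e \<cdot> dG 0 \<and> dE l \<cdot> e = y \<cdot> f 0)"
  then show "(arr x (G (Suc 0)) (N l) \<and> x \<cdot> dG (Suc 0) = zr (G (Suc (Suc 0))) (N l)) \<and>
      arr y (K 0) (E (Suc l)) \<and> dE (Suc l) \<cdot> y = zr (K 0) (E (Suc (Suc l)))" by blast
  from * obtain e where x: "arr x (G (Suc 0)) (N l)" and y: "arr y (K 0) (E (Suc l))" and
    e: "arr e (G 0) (E l)" "a l \<cdot> x = e \<cdot> dG 0" "dE l \<cdot> e = y \<cdot> f 0" by blast
  show "(\<exists>y. arr y (G 0) (N l) \<and> x = y \<cdot> dG 0) \<longleftrightarrow> (\<exists>z. arr z (K 0) (E l) \<and> y = dE l \<cdot> z)"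
  proof
    assume "\<exists>y. arr y (G 0) (N l) \<and> x = y \<cdot> dG 0"
    then obtain u where u: "arr u (G 0) (N l)" "x = u \<cdot> dG 0" by blast
    have au: "arr (a l \<cdot> u) (G 0) (E l)" by (rule comp_arr[OF u(1) arr_facts(3)])
    have "e \<cdot> dG 0 = (a l \<cdot> u) \<cdot> dG 0" using e(2) u(2) assoc[OF dG_arr u(1) arr_facts(3)] by simp
    then obtain w where w: "arr w (G 0) (E l)" "e = w \<otimes>\<^bsub>Hom \<C> (G 0) (E l)\<^esub> (a l \<cdot> u)"
      "w \<cdot> dG 0 = zr (G (Suc 0)) (E l)" by (rule diff_right[OF e(1) au dG_arr])
    obtain v where v: "arr v (K 0) (E l)" "w = v \<cdot> f 0" by (rule ker_dG[OF w(1,3)])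
    have "dE l \<cdot> (a l \<cdot> u) = zr (G 0) (E (Suc l))"
      using u(1) by (simp add: dE_def csimps b_a_zero[THEN comp_eq])
    then have "y \<cdot> f 0 = dE l \<cdot> w" unfolding e(3)[symmetric] w(2)
      using comp_sum_right[OF w(1) au dE_arr] sum_zr(1)[OF comp_arr[OF w(1) dE_arr]] by simp
    then have "y \<cdot> f 0 = (dE l \<cdot> v) \<cdot> f 0" using v(2) assoc[OF arr_facts(2) v(1) dE_arr] by simp
    then have "y = dE l \<cdot> v" by (rule f_epi[OF y comp_arr[OF v(1) dE_arr]])
    then show "\<exists>z. arr z (K 0) (E l) \<and> y = dE l \<cdot> z" using v(1) by blast
  next
    assume "\<exists>z. arr z (K 0) (E l) \<and> y = dE l \<cdot> z"
    then obtain z where z: "arr z (K 0) (E l)" "y = dE l \<cdot> z" by blast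
    have zf: "arr (z \<cdot> f 0) (G 0) (E l)" by (rule comp_arr[OF arr_facts(2) z(1)])
    have be: "arr (b l \<cdot> e) (G 0) (N (Suc l))" "arr (b l \<cdot> (z \<cdot> f 0)) (G 0) (N (Suc l))"
      using comp_arr[OF e(1) arr_facts(4)] comp_arr[OF zf arr_facts(4)] by blast+
    \<comment> \<open>The hypothesis concerns \<open>dE l\<close>, whose outer factor
      \<open>a (Suc l)\<close> can be cancelled on maps out of \<open>G 0\<close>. This leaves an
      equation under \<open>b l\<close> alone.\<close>
    have "a (Suc l) \<cdot> (b l \<cdot> e) = a (Suc l) \<cdot> (b l \<cdot> (z \<cdot> f 0))"
      using e(3) unfolding z(2) dE_def using e(1) z(1) by (simp add: csimps)
    then have "b l \<cdot> e = b l \<cdot> (z \<cdot> f 0)" by (rule a_mono[OF be])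
    then obtain w where w: "arr w (G 0) (E l)" "e = w \<otimes>\<^bsub>Hom \<C> (G 0) (E l)\<^esub> (z \<cdot> f 0)"
      "b l \<cdot> w = zr (G 0) (N (Suc l))" by (rule diff_left[OF e(1) zf arr_facts(4)])
    obtain u where u: "arr u (G 0) (N l)" "w = a l \<cdot> u" by (rule ker_b[OF w(1,3)])
    have "(z \<cdot> f 0) \<cdot> dG 0 = zr (G (Suc 0)) (E l)"
      using z(1) by (simp add: dG_def csimps f_g_zero[THEN comp_eq])
    then have "e \<cdot> dG 0 = w \<cdot> dG 0" unfolding w(2)
      using comp_sum_left[OF dG_arr w(1) zf] sum_zr(1)[OF comp_arr[OF dG_arr w(1)]] by simp
    then have "a l \<cdot> x = a l \<cdot> (u \<cdot> dG 0)" using e(2) u(2) assoc[OF dG_arr u(1) arr_facts(3)] by simp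
    then have "x = u \<cdot> dG 0" by (rule a_mono[OF x comp_arr[OF dG_arr u(1)]])
    then show "\<exists>y. arr y (G 0) (N l) \<and> x = y \<cdot> dG 0" using u(1) by blast
  qed
next
  fix x assume x: "arr x (G (Suc 0)) (N l) \<and> x \<cdot> dG (Suc 0) = zr (G (Suc (Suc 0))) (N l)"
  obtain e where e: "arr e (G 0) (E l)" "a l \<cdot> x = e \<cdot> dG 0"
    by (rule cocycle_lift[OF conjunct1[OF x] conjunct2[OF x]])
  have de: "arr (dE l \<cdot> e) (G 0) (E (Suc l))" by (rule comp_arr[OF e(1) dE_arr])
  \<comment> \<open>As a cocycle of degree zero with values in \<open>E (Suc l)\<close>,
    \<open>dE l \<cdot> e\<close> descends along \<open>f 0\<close> to a map on \<open>K 0\<close>;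
    this map is the required \<open>y\<close>.\<close>
  have "(dE l \<cdot> e) \<cdot> dG 0 = a (Suc l) \<cdot> ((b l \<cdot> e) \<cdot> dG 0)"
    using e(1) mor_arr dG_arr[of 0] by (simp add: dE_def csimps)
  also have "\<dots> = zr (G (Suc 0)) (E (Suc l))"
    unfolding b_e_dG[OF conjunct1[OF x] e] using comp_zr_right[OF arr_facts(3)] by simp
  finally obtain y where y: "arr y (K 0) (E (Suc l))" "dE l \<cdot> e = y \<cdot> f 0" by (rule ker_dG[OF de])
  have "(dE (Suc l) \<cdot> y) \<cdot> f 0 = zr (K 0) (E (Suc (Suc l))) \<cdot> f 0"
    using assoc[OF arr_facts(2) y(1) dE_arr] y(2)[symmetric] assoc[OF e(1) dE_arr dE_arr] dE_dE
      comp_zr_left[OF e(1)] comp_zr_left[OF arr_facts(2)] by simp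
  then have "dE (Suc l) \<cdot> y = zr (K 0) (E (Suc (Suc l)))"
    by (rule f_epi[OF comp_arr[OF y(1) dE_arr] zr_arr[OF obj_facts(1,4)]])
  then show "\<exists>y. (arr x (G (Suc 0)) (N l) \<and> x \<cdot> dG (Suc 0) = zr (G (Suc (Suc 0))) (N l)) \<and>
      (arr y (K 0) (E (Suc l)) \<and> dE (Suc l) \<cdot> y = zr (K 0) (E (Suc (Suc l)))) \<and>
      (\<exists>e. arr e (G 0) (E l) \<and> a l \<cdot> x = e \<cdot> dG 0 \<and> dE l \<cdot> e = y \<cdot> f 0)"
    using x y e by blast
next
  fix y assume y: "arr y (K 0) (E (Suc l)) \<and> dE (Suc l) \<cdot> y = zr (K 0) (E (Suc (Suc l)))"
  note ya = conjunct1[OF y]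
  have yf: "arr (y \<cdot> f 0) (G 0) (E (Suc l))" by (rule comp_arr[OF arr_facts(2) ya])
  have byf: "arr (b (Suc l) \<cdot> (y \<cdot> f 0)) (G 0) (N (Suc (Suc l)))" by (rule comp_arr[OF yf arr_facts(4)])
  \<comment> \<open>The factor \<open>f 0\<close> moves the computation from \<open>K 0\<close> to
    \<open>G 0\<close>, where \<open>a\<close> can be cancelled.\<close>
  have "a (Suc (Suc l)) \<cdot> (b (Suc l) \<cdot> (y \<cdot> f 0)) = (dE (Suc l) \<cdot> y) \<cdot> f 0"
    using ya by (simp add: dE_def csimps)
  also have "\<dots> = a (Suc (Suc l)) \<cdot> zr (G 0) (N (Suc (Suc l)))"
    using y comp_zr_left[OF arr_facts(2)] comp_zr_right[OF arr_facts(3)] by simp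
  finally have "b (Suc l) \<cdot> (y \<cdot> f 0) = zr (G 0) (N (Suc (Suc l)))" by (rule a_mono[OF byf zr_arr[OF obj_facts(2,3)]])
  then obtain \<theta> where th: "arr \<theta> (G 0) (N (Suc l))" "y \<cdot> f 0 = a (Suc l) \<cdot> \<theta>" by (rule ker_b[OF yf])
  obtain e where e: "arr e (G 0) (E l)" "b l \<cdot> e = \<theta>" by (rule lift_b[OF th(1)])
  have de: "dE l \<cdot> e = y \<cdot> f 0" using th(2) e(2) assoc[OF e(1) arr_facts(4,3)] by (simp add: dE_def)
  have td: "arr (\<theta> \<cdot> dG 0) (G (Suc 0)) (N (Suc l))" by (rule comp_arr[OF dG_arr th(1)])
  have "a (Suc l) \<cdot> (\<theta> \<cdot> dG 0) = (y \<cdot> f 0) \<cdot> dG 0" using assoc[OF dG_arr th(1) arr_facts(3)] th(2) by simp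
  also have "\<dots> = a (Suc l) \<cdot> zr (G (Suc 0)) (N (Suc l))"
    using ya by (simp add: dG_def csimps f_g_zero[THEN comp_eq])
  finally have "\<theta> \<cdot> dG 0 = zr (G (Suc 0)) (N (Suc l))" by (rule a_mono[OF td zr_arr[OF obj_facts(2,3)]])
  then have "(b l \<cdot> e) \<cdot> dG 0 = zr (G (Suc 0)) (N (Suc l))" using e(2) by simp
  then obtain x where "arr x (G (Suc 0)) (N l)" "a l \<cdot> x = e \<cdot> dG 0" "x \<cdot> dG (Suc 0) = zr (G (Suc (Suc 0))) (N l)"
    by (rule cocycle_descend[OF e(1)])
  then show "\<exists>x. (arr x (G (Suc 0)) (N l) \<and> x \<cdot> dG (Suc 0) = zr (G (Suc (Suc 0))) (N l)) \<and>
      (arr y (K 0) (E (Suc l)) \<and> dE (Suc l) \<cdot> y = zr (K 0) (E (Suc (Suc l)))) \<and>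
      (\<exists>e. arr e (G 0) (E l) \<and> a l \<cdot> x = e \<cdot> dG 0 \<and> dE l \<cdot> e = y \<cdot> f 0)"
    using y e(1) de by blast
next
  fix x y x' y'
  assume "(arr x (G (Suc 0)) (N l) \<and> x \<cdot> dG (Suc 0) = zr (G (Suc (Suc 0))) (N l)) \<and>
      (arr y (K 0) (E (Suc l)) \<and> dE (Suc l) \<cdot> y = zr (K 0) (E (Suc (Suc l)))) \<and>
      (\<exists>e. arr e (G 0) (E l) \<and> a l \<cdot> x = e \<cdot> dG 0 \<and> dE l \<cdot> e = y \<cdot> f 0)"
    "(arr x' (G (Suc 0)) (N l) \<and> x' \<cdot> dG (Suc 0) = zr (G (Suc (Suc 0))) (N l)) \<and>
      (arr y' (K 0) (E (Suc l)) \<and> dE (Suc l) \<cdot> y' = zr (K 0) (E (Suc (Suc l)))) \<and>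
      (\<exists>e. arr e (G 0) (E l) \<and> a l \<cdot> x' = e \<cdot> dG 0 \<and> dE l \<cdot> e = y' \<cdot> f 0)"
  then obtain e e' where
    x: "arr x (G (Suc 0)) (N l)" "x \<cdot> dG (Suc 0) = zr (G (Suc (Suc 0))) (N l)"
      "arr x' (G (Suc 0)) (N l)" "x' \<cdot> dG (Suc 0) = zr (G (Suc (Suc 0))) (N l)" and
    y: "arr y (K 0) (E (Suc l))" "dE (Suc l) \<cdot> y = zr (K 0) (E (Suc (Suc l)))"
      "arr y' (K 0) (E (Suc l))" "dE (Suc l) \<cdot> y' = zr (K 0) (E (Suc (Suc l)))" and
    e: "arr e (G 0) (E l)" "a l \<cdot> x = e \<cdot> dG 0" "dE l \<cdot> e = y \<cdot> f 0"
      "arr e' (G 0) (E l)" "a l \<cdot> x' = e' \<cdot> dG 0" "dE l \<cdot> e' = y' \<cdot> f 0" by blast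
  show "(arr (x \<otimes>\<^bsub>HG l (Suc 0)\<^esub> x') (G (Suc 0)) (N l) \<and>
       (x \<otimes>\<^bsub>HG l (Suc 0)\<^esub> x') \<cdot> dG (Suc 0) = zr (G (Suc (Suc 0))) (N l)) \<and>
      (arr (y \<otimes>\<^bsub>HE (Suc l)\<^esub> y') (K 0) (E (Suc l)) \<and>
       dE (Suc l) \<cdot> (y \<otimes>\<^bsub>HE (Suc l)\<^esub> y') = zr (K 0) (E (Suc (Suc l)))) \<and>
      (\<exists>e. arr e (G 0) (E l) \<and> a l \<cdot> (x \<otimes>\<^bsub>HG l (Suc 0)\<^esub> x') = e \<cdot> dG 0 \<and>
        dE l \<cdot> e = (y \<otimes>\<^bsub>HE (Suc l)\<^esub> y') \<cdot> f 0)"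
  proof (intro conjI exI[of _ "e \<otimes>\<^bsub>Hom \<C> (G 0) (E l)\<^esub> e'"])
    show "(x \<otimes>\<^bsub>HG l (Suc 0)\<^esub> x') \<cdot> dG (Suc 0) = zr (G (Suc (Suc 0))) (N l)"
      using comp_sum_left[OF dG_arr x(1,3)] x(2,4) sum_zr(1)[OF zr_arr] by simp
    show "dE (Suc l) \<cdot> (y \<otimes>\<^bsub>HE (Suc l)\<^esub> y') = zr (K 0) (E (Suc (Suc l)))"
      using comp_sum_right[OF y(1,3) dE_arr] y(2,4) sum_zr(1)[OF zr_arr] by simp
    show "a l \<cdot> (x \<otimes>\<^bsub>HG l (Suc 0)\<^esub> x') = (e \<otimes>\<^bsub>Hom \<C> (G 0) (E l)\<^esub> e') \<cdot> dG 0"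
      using comp_sum_right[OF x(1,3) arr_facts(3)] comp_sum_left[OF dG_arr e(1,4)] e(2,5) by simp
    show "dE l \<cdot> (e \<otimes>\<^bsub>Hom \<C> (G 0) (E l)\<^esub> e') = (y \<otimes>\<^bsub>HE (Suc l)\<^esub> y') \<cdot> f 0"
      using comp_sum_right[OF e(1,4) dE_arr] comp_sum_left[OF arr_facts(2) y(1,3)] e(3,6) by simp
  qed (rule sum_arr x y e)+
qed

text \<open>Each \<open>row_shift\<close> trades one degree for one cosyzygy until degree 1 is left,
  where \<open>corner\<close> passes to the other complex. A further shift would end in degree zero,
  where there are no coboundaries to match.\<close>

lemma balance:
  "cochain_cohomology (HG l) dHG (Suc m) \<cong> cochain_cohomology HE dHE (Suc (l + m))"
proof (induction m arbitrary: l)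
  case 0
  then show ?case using corner by simp
next
  case (Suc m)
  have "cochain_cohomology (HG (Suc l)) dHG (Suc m) \<cong> cochain_cohomology HE dHE (Suc (l + Suc m))"
    using Suc[of "Suc l"] by simp
  then show ?case by (rule iso_trans[OF row_shift])
qed

end

theorem theorem3p4:
  fixes \<C> :: "('o, 'm, 'e) ext_cat"
    and \<xi> :: "('o, 'm, 'e) etri set"
    and M N :: 'o
    and n :: nat
  assumes "extriangulated \<C>"
    and "WIC \<C>"
    and "proper_class \<C> \<xi>"
    and "enough_projectives \<C> \<xi>"
    and "enough_injectives \<C> \<xi>"
    and "M \<in> GP_finite \<C> \<xi>"
    and "N \<in> GI_finite \<C> \<xi>"
    and "n \<ge> 1"
  shows "xt_GP \<C> \<xi> n M N \<cong> xt_GI \<C> \<xi> n M N"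
proof -
  interpret proper_cat \<C> \<xi> by unfold_locales (use assms in auto)
  obtain G d where Gd: "(SOME (G, d). GP_resolution \<C> \<xi> M G d) = (G, d)" by fastforce
  \<comment> \<open>Existence turns the arbitrary choice in the definition of the cohomology into an
    actual resolution; the argument below works for any one.\<close>
  have "\<exists>p. case p of (G, d) \<Rightarrow> GP_resolution \<C> \<xi> M G d"
    using GP_resolution_exists[OF GP_finite_precover[OF assms(6)]] by auto
  from someI_ex[OF this] have rG: "GP_resolution \<C> \<xi> M G d" unfolding Gd by simp
  obtain E e where Ee: "(SOME (E, d). GI_coresolution \<C> \<xi> N E d) = (E, e)" by fastforce
  have "\<exists>p. case p of (E, d) \<Rightarrow> GI_coresolution \<C> \<xi> N E d"
    using GI_coresolution_exists[OF assms(7)] by auto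
  from someI_ex[OF this] have rE: "GI_coresolution \<C> \<xi> N E e" unfolding Ee by simp
  show ?thesis
  proof (rule GP_resolution_triangles[OF assms(6) rG])
    fix K g f \<delta>
    assume K: "K 0 = M" "\<And>i. tri (K (Suc i)) (g i) (G i) (f i) (K i) (\<delta> i)"
      "\<And>i. d (Suc i) = g i \<cdot>\<^bsub>\<C>\<^esub> f (Suc i)" "\<And>i. G i \<in> GPs"
      "\<And>i W. W \<in> GIs \<Longrightarrow> hom_into_exact \<C> W (K (Suc i), g i, G i, f i, K i, \<delta> i)"
    show ?thesis
    proof (rule GI_coresolution_triangles[OF assms(7) rE])
      fix L a b \<epsilon>
      assume L: "L 0 = N" "\<And>i. tri (L i) (a i) (E i) (b i) (L (Suc i)) (\<epsilon> i)"
        "\<And>i. e (Suc i) = a (Suc i) \<cdot>\<^bsub>\<C>\<^esub> b i" "\<And>i. E i \<in> GIs"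
        "\<And>i W. W \<in> GPs \<Longrightarrow> hom_from_exact \<C> W (L i, a i, E i, b i, L (Suc i), \<epsilon> i)"
      interpret balanced \<C> K G L E g f a b \<delta> \<epsilon>
        by (intro balanced.intro balanced_axioms.intro extri_cat_axioms K(2) L(2) K(5)[OF L(4)] L(5)[OF K(4)])
      obtain m where m: "n = Suc m" using assms(8) by (cases n) auto
      have "xt_GP \<C> \<xi> n M N = cochain_cohomology (HG 0) dHG (Suc m)"
        by (simp only: xt_GP_def Gd m K(3) dG_def L(1) Let_def prod.case)
      moreover have "xt_GI \<C> \<xi> n M N = cochain_cohomology HE dHE (Suc m)"
        by (simp only: xt_GI_def Ee m L(3) dE_def K(1) Let_def prod.case)
      ultimately show ?thesis using balance[of 0 m] by simp
    qed
  qed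
qed

end
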